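(* Let $K\subset\mathbb{R}^n$, $n\ge2$, be compact and let $A\subset K$ be such that both $A$ and $\mathrm{int}_fK\setminus A$ are finely open (i.e. $A$ is a union of fine connected components of $\mathrm{int}_fK$). Suppose that $\operatorname{supp}\mu\subset\overline{A}$ for all $\mu\in\mathcal{J}_x(K)$ and all $x\in A$. Then $\mathcal{J}_x(K)\subset\mathcal{J}_x(\overline{A})$ (and hence $\mathcal{J}_x(K)=\mathcal{J}_x(\overline{A})$) for all $x\in A$.
   Context: For a domain $U\subset\mathbb{R}^n$ and $x\in U$, $\mathcal{J}_x(U)$ is the set of positive Radon measures $\mu$ with support compactly contained in $U$ such that $\int f\,d\mu\le f(x)$ for every superharmonic $f$ on $U$; for compact $E$ and $x\in E$, $\mathcal{J}_x(E)=\bigcap_U\mathcal{J}_x(U)$ over all domains $U\supset E$. The fine topology is the coarsest topology on $\mathbb{R}^n$ making all superharmonic functions continuous; $\mathrm{int}_fK$ is the fine interior; $\overline{A}$ is the Euclidean closure. *)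

theory Defs
  imports "HOL-Analysis.Analysis"
begin

definition domain_set :: "'a::euclidean_space set \<Rightarrow> bool" where
  "domain_set U \<longleftrightarrow> open U \<and> connected U \<and> U \<noteq> {}"

text \<open>Superharmonic functions f : U \<rightarrow> (-\<infinity>, +\<infinity>] on an open set U:
  values > -\<infinity>, lower semicontinuous, not identically +\<infinity> on any component of U,
  and the super-mean value inequality over every closed ball contained in U
  (volume means w.r.t. Lebesgue measure; f is bounded below on the compact ball,
  so we integrate f - c for a real lower bound c).\<close>
definition superharmonic_on :: "'a::euclidean_space set \<Rightarrow> ('a \<Rightarrow> ereal) \<Rightarrow> bool" where
  "superharmonic_on U f \<longleftrightarrow>
     open U \<and>
     (\<forall>x\<in>U. f x \<noteq> -\<infinity>) \<and>
     (\<forall>x\<in>U. \<forall>a. a < f x \<longrightarrow> (\<exists>e>0. \<forall>y\<in>ball x e. a < f y)) \<and>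
     (\<forall>C\<in>components U. \<exists>x\<in>C. f x \<noteq> \<infinity>) \<and>
     (\<forall>x r c. 0 < r \<and> cball x r \<subseteq> U \<and> (\<forall>y\<in>cball x r. ereal c \<le> f y) \<longrightarrow>
        (\<integral>\<^sup>+ y. e2ennreal (f y - ereal c) * indicator (cball x r) y \<partial>lborel)
          \<le> e2ennreal (f x - ereal c) * emeasure lborel (cball x r))"

definition msupp :: "'a::metric_space measure \<Rightarrow> 'a set" where
  "msupp M = {x. \<forall>e>0. emeasure M (ball x e) > 0}"

definition radon_cpt_in :: "'a::euclidean_space measure \<Rightarrow> 'a set \<Rightarrow> bool" where
  "radon_cpt_in M U \<longleftrightarrow> sets M = sets borel \<and> (\<forall>K. compact K \<longrightarrow> emeasure M K < \<infinity>)
      \<and> compact (msupp M) \<and> msupp M \<subseteq> U"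

text \<open>The integral of f against M is \<le> v (f bounded below by a real c on supp M;
  the integral equals c*M(R^n) + \<integral>(f-c) over supp M, independently of c).\<close>
definition integral_le :: "'a::euclidean_space measure \<Rightarrow> ('a \<Rightarrow> ereal) \<Rightarrow> ereal \<Rightarrow> bool" where
  "integral_le M f v \<longleftrightarrow> (\<exists>c::real. (\<forall>y\<in>msupp M. ereal c \<le> f y) \<and>
      ereal c * ereal (measure M (space M))
        + enn2ereal (\<integral>\<^sup>+ y. e2ennreal (f y - ereal c) * indicator (msupp M) y \<partial>M) \<le> v)"

definition jensen_dom :: "'a::euclidean_space \<Rightarrow> 'a set \<Rightarrow> 'a measure set" where
  "jensen_dom x U = {M. radon_cpt_in M U \<and>
      (\<forall>f. superharmonic_on U f \<longrightarrow> integral_le M f (f x))}"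

definition jensen_cpt :: "'a::euclidean_space \<Rightarrow> 'a set \<Rightarrow> 'a measure set" where
  "jensen_cpt x E = {M. \<forall>U. domain_set U \<and> E \<subseteq> U \<longrightarrow> M \<in> jensen_dom x U}"

definition fine_topology :: "'a::euclidean_space topology" where
  "fine_topology = topology_generated_by
     {f -` V | f V. superharmonic_on (UNIV::'a set) f \<and> open (V :: ereal set)}"

end

theory Submission
  imports Defs
begin

text \<open>Let $C = \overline{A}$ and let $f$ be superharmonic near $C$. Since no measure in
  $\mathcal{J}_x(K)$ charges $K$ away from $C$, a Hahn--Banach argument yields, for each $\varepsilon > 0$, a
  superharmonic $u$ near $K$ with $u \ge 0$ on $K$, $u \ge 1$ on $K$ away from $C$ and $u(x) < \varepsilon$.
  For $0 \le f$ truncated at height $L$, the function $\min(f + L(u + \varepsilon), L)$ near $C$ extends by the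
  constant $L$ to a superharmonic function near $K$ which is at least $f$ on $C$ and at most
  $f(x) + 2L\varepsilon$ at $x$. Testing $\mu \in \mathcal{J}_x(K)$ against it and letting
  $\varepsilon \to 0$, $L \to \infty$ gives the claim.

  Gluing needs that the super-mean value property over small balls implies it over all balls:
  this comes from a compactly supported $C^{1,1}$ function $w \ge 0$ whose Laplacian is the
  difference of the normalised uniform densities of two concentric balls. Since Jensen measures are
  only tested on domains, the components of an open neighbourhood of $K$ are joined by thin tubes on which the
  function is constant; the tubes are attached near polar points, where a superharmonic function of small value
  at $x$ is large.\<close>

section \<open>Second moments of the unit ball\<close>

text \<open>Superharmonicity tests every closed ball in the open set, not only small ones, so
  pasting functions on overlapping open sets is not free; the constant extension and the tubes both
  rest on it. The proof is a discrete Green formula: averaging over balls is self-adjoint, so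
  pairing \<open>u\<close> with second differences of \<open>w\<close> equals pairing
  \<open>w\<close> \<ge> 0 with those of \<open>u\<close>, which are \<le> 0 at small scale, while
  second differences of \<open>w\<close> tend to a difference of two ball densities. No smoothness
  of \<open>u\<close> is used. Hahn-Banach is run on all bounded functions, as neither indicators
  nor superharmonic functions are continuous. The functional is then only finitely additive, and its
  measure satisfies just an inequality for lower semicontinuous integrands. That is the direction
  needed, both for superharmonic test functions and for minus the indicator of a closed set. Lower
  semicontinuity carries the bounds 0 and 1 for \<open>u\<close> from \<open>K\<close> to a
  neighbourhood only with an arbitrarily small loss; this is why \<epsilon> is added to
  \<open>u\<close> before gluing.\<close>

lemma borel_ball_cball [measurable]: "ball c r \<in> sets borel" "cball c r \<in> sets borel"
  for c :: "'a::euclidean_space"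
  by simp_all

text \<open>\<open>T\<close> exchanges the coordinates \<open>i\<close> and \<open>j\<close>. A box
  goes to a box with permuted side lengths, and boxes determine Lebesgue measure.\<close>

lemma lborel_swap_invariant:
  fixes i j :: "'a::euclidean_space"
  assumes "i \<in> Basis" "j \<in> Basis"
  defines "T \<equiv> \<lambda>x. x + (x \<bullet> j - x \<bullet> i) *\<^sub>R (i - j)"
  shows "distr lborel borel T = lborel"
proof (rule lborel_eqI[symmetric])
  define p where "p = Transposition.transpose i j"
  have [measurable]: "T \<in> borel \<rightarrow>\<^sub>M borel" unfolding T_def by measurable
  have Tb: "T x \<bullet> b = x \<bullet> p b" if "b \<in> Basis" for x b
    using assms that
    by (auto simp: T_def p_def Transposition.transpose_def inner_simps inner_Basis)
  have bij: "bij_betw p Basis Basis"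
    unfolding p_def by (rule permutes_imp_bij[OF permutes_swap_id]) fact+
  have pp: "p (p b) = b" for b by (simp add: p_def)
  have pB: "p b \<in> Basis" if "b \<in> Basis" for b using bij that by (auto simp: bij_betw_def)
  fix l u :: 'a assume le: "\<And>b. b \<in> Basis \<Longrightarrow> l \<bullet> b \<le> u \<bullet> b"
  have eq: "T -` box l u = box (T l) (T u)"
  proof (intro set_eqI iffI)
    fix x assume "x \<in> T -` box l u"
    then have *: "l \<bullet> b < x \<bullet> p b \<and> x \<bullet> p b < u \<bullet> b" if "b \<in> Basis" for b
      using that Tb by (auto simp: box_def)
    show "x \<in> box (T l) (T u)"
      unfolding box_def using *[OF pB] by (auto simp: Tb pp)
  next
    fix x assume "x \<in> box (T l) (T u)"
    then have *: "l \<bullet> p b < x \<bullet> b \<and> x \<bullet> b < u \<bullet> p b" if "b \<in> Basis" for b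
      using that Tb by (auto simp: box_def)
    show "x \<in> T -` box l u"
      using *[OF pB] by (auto simp: Tb pp box_def)
  qed
  have "emeasure (distr lborel borel T) (box l u) = emeasure lborel (box (T l) (T u))"
    by (simp add: emeasure_distr eq)
  also have "\<dots> = (\<Prod>b\<in>Basis. (T u - T l) \<bullet> b)"
    using le pB by (simp add: emeasure_lborel_box_eq Tb)
  also have "\<dots> = (\<Prod>b\<in>Basis. (u - l) \<bullet> p b)"
    by (simp add: inner_diff_left Tb)
  also have "\<dots> = (\<Prod>b\<in>Basis. (u - l) \<bullet> b)"
    by (rule arg_cong[where f=ennreal], rule prod.reindex_bij_betw[OF bij])
  finally show "emeasure (distr lborel borel T) (box l u) = (\<Prod>b\<in>Basis. (u - l) \<bullet> b)" .
qed simp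

lemma lborel_reflect_invariant:
  fixes j :: "'a::euclidean_space"
  assumes "j \<in> Basis"
  shows "distr lborel borel (\<lambda>x. x - (2 * (x \<bullet> j)) *\<^sub>R j) = lborel"
proof -
  \<comment> \<open>A diagonal scaling with entries 1 and -1, so that the affine change of variables
    applies with Jacobian 1.\<close>
  define c where "c = (\<lambda>i. if i = j then - 1 else 1 :: real)"
  have "(\<Sum>i\<in>Basis. (c i * (x \<bullet> i)) *\<^sub>R i) = x - (2 * (x \<bullet> j)) *\<^sub>R j" for x
  proof -
    have "(\<Sum>i\<in>Basis. (c i * (x \<bullet> i)) *\<^sub>R i)
        = (\<Sum>i\<in>Basis. (x \<bullet> i) *\<^sub>R i - (if i = j then (2 * (x \<bullet> j)) *\<^sub>R j else 0))"
      by (rule sum.cong) (auto simp: c_def algebra_simps scaleR_2[symmetric])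
    also have "\<dots> = x - (2 * (x \<bullet> j)) *\<^sub>R j"
      using assms by (simp add: sum_subtractf euclidean_representation)
    finally show ?thesis .
  qed
  moreover have "(\<Prod>i\<in>(Basis::'a set). \<bar>c i\<bar>) = 1"
    by (rule prod.neutral) (auto simp: c_def)
  ultimately show ?thesis
    using lborel_affine_euclidean[of c 0] by (simp add: c_def density_1)
qed

lemma lborel_uminus_invariant: "distr lborel borel uminus = (lborel :: 'a::euclidean_space measure)"
  using lborel_affine[of "-1" "0::'a"] by (simp add: density_1)

lemma integral_lborel_invariant:
  fixes f :: "'a::euclidean_space \<Rightarrow> real"
  assumes "distr lborel borel T = lborel" and [measurable]: "T \<in> borel_measurable borel" "f \<in> borel_measurable borel"
  shows "(\<integral>x. f (T x) \<partial>lborel) = (\<integral>x. f x \<partial>lborel)"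
  using integral_distr[of T lborel borel f] assms by simp

lemma integral_lborel_shift:
  fixes f :: "'a::euclidean_space \<Rightarrow> real"
  assumes [measurable]: "f \<in> borel_measurable borel"
  shows "(\<integral>x. f (c + x) \<partial>lborel) = (\<integral>x. f x \<partial>lborel)"
  by (rule integral_lborel_invariant[OF lborel_distr_plus]) simp_all

lemma integrable_cball_bounded:
  fixes f :: "'a::euclidean_space \<Rightarrow> real"
  assumes [measurable]: "(\<lambda>z. indicator (cball c r) z * f z) \<in> borel_measurable borel"
    and "\<And>z. z \<in> cball c r \<Longrightarrow> \<bar>f z\<bar> \<le> B"
  shows "integrable lborel (\<lambda>z. indicator (cball c r) z * f z)"
proof (rule Bochner_Integration.integrable_bound)
  show "integrable lborel (\<lambda>z. indicator (cball c r) z * B)"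
    by (intro integrable_mult_left integrable_real_indicator)
      (use emeasure_lborel_cball_finite[of c r] in simp_all)
  show "AE z in lborel. norm (indicator (cball c r) z * f z) \<le> norm (indicator (cball c r) z * B)"
    using assms(2) by (auto simp: indicator_def intro!: AE_I2 split: if_splits) (force+)?
qed simp

text \<open>Symmetry of the ball does the work: sign changes kill the mixed moments, coordinate
  swaps make the diagonal ones equal, and \<open>z \<mapsto> - z\<close> kills the first moments.
  Integrating a quadratic form over the ball thus yields \<open>\<kappa>\<close> times its trace,
  which is how a Laplacian arises from ball averages.\<close>

lemma second_moments_cball:
  obtains \<kappa> :: real where "\<kappa> > 0"
    "\<And>a::'a::euclidean_space. (\<integral>z. indicator (cball 0 1) z * (a \<bullet> z)\<^sup>2 \<partial>lborel) = \<kappa> * (a \<bullet> a)"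
    "(\<integral>z. indicator (cball (0::'a) 1) z * (z \<bullet> z) \<partial>lborel) = \<kappa> * DIM('a)"
    "\<And>a::'a. (\<integral>z. indicator (cball 0 1) z * (a \<bullet> z) \<partial>lborel) = 0"
proof -
  let ?I = "indicator (cball (0::'a) 1) :: 'a \<Rightarrow> real"
  have I_eq: "?I z = (if norm z \<le> 1 then 1 else 0)" for z by (simp add: indicator_def)
  define M where "M i j = (\<integral>z. ?I z * ((z \<bullet> i) * (z \<bullet> j)) \<partial>lborel)" for i j
  have le1: "\<bar>z \<bullet> i\<bar> \<le> norm i" if "z \<in> cball 0 1" for z i :: 'a
    using Cauchy_Schwarz_ineq2[of z i] that mult_right_mono[of "norm z" 1 "norm i"] by simp
  have int: "integrable lborel (\<lambda>z. ?I z * ((z \<bullet> i) * (z \<bullet> j)))" for i j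
  proof (rule integrable_cball_bounded[where B="norm i * norm j"])
    show "\<bar>z \<bullet> i * (z \<bullet> j)\<bar> \<le> norm i * norm j" if "z \<in> cball 0 1" for z
      using le1[OF that, of i] le1[OF that, of j] by (simp add: abs_mult mult_mono)
  qed measurable
  have off: "M i j = 0" if ij: "i \<in> Basis" "j \<in> Basis" "i \<noteq> j" for i j
  proof -
    let ?T = "\<lambda>x. x - (2 * (x \<bullet> j)) *\<^sub>R j"
    have n: "norm (?T x) = norm x" for x
      using ij by (simp add: norm_eq inner_simps inner_commute algebra_simps)
    have "M i j = (\<integral>z. ?I (?T z) * ((?T z \<bullet> i) * (?T z \<bullet> j)) \<partial>lborel)"
      unfolding M_def by (rule integral_lborel_invariant[OF lborel_reflect_invariant[OF ij(2)], symmetric]) simp_all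
    also have "\<dots> = (\<integral>z. - (?I z * ((z \<bullet> i) * (z \<bullet> j))) \<partial>lborel)"
    proof (rule Bochner_Integration.integral_cong[OF refl])
      fix z
      have "?I (?T z) = ?I z" using n by (simp only: I_eq)
      then show "?I (?T z) * ((?T z \<bullet> i) * (?T z \<bullet> j)) = - (?I z * ((z \<bullet> i) * (z \<bullet> j)))"
        using ij by (simp add: inner_simps inner_Basis)
    qed
    finally show ?thesis by (simp add: M_def)
  qed
  have diag: "M i i = M j j" if ij: "i \<in> Basis" "j \<in> Basis" for i j
  proof -
    let ?T = "\<lambda>x. x + (x \<bullet> j - x \<bullet> i) *\<^sub>R (i - j)"
    have n: "norm (?T x) = norm x" for x
      using ij by (cases "i = j") (simp_all add: norm_eq inner_simps inner_commute inner_Basis algebra_simps)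
    have "M i i = (\<integral>z. ?I (?T z) * ((?T z \<bullet> i) * (?T z \<bullet> i)) \<partial>lborel)"
      unfolding M_def by (rule integral_lborel_invariant[OF lborel_swap_invariant[OF ij], symmetric]) simp_all
    also have "\<dots> = M j j"
      unfolding M_def
    proof (rule Bochner_Integration.integral_cong[OF refl])
      fix z
      have "?I (?T z) = ?I z" using n by (simp only: I_eq)
      then show "?I (?T z) * ((?T z \<bullet> i) * (?T z \<bullet> i)) = ?I z * ((z \<bullet> j) * (z \<bullet> j))"
        using ij by (cases "i = j") (simp_all add: inner_simps inner_Basis)
    qed
    finally show ?thesis .
  qed
  obtain b :: 'a where b: "b \<in> Basis" using nonempty_Basis by blast
  define \<kappa> where "\<kappa> = M b b"
  have Mij: "M i j = (if i = j then \<kappa> else 0)" if "i \<in> Basis" "j \<in> Basis" for i j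
    using off[OF that] diag[OF that(1) b] by (cases "i = j") (simp_all add: \<kappa>_def)
  have sq: "(\<integral>z. ?I z * (a \<bullet> z)\<^sup>2 \<partial>lborel) = \<kappa> * (a \<bullet> a)" for a
  proof -
    have "?I z * (a \<bullet> z)\<^sup>2 = (\<Sum>i\<in>Basis. \<Sum>j\<in>Basis. (a \<bullet> i) * (a \<bullet> j) * (?I z * ((z \<bullet> i) * (z \<bullet> j))))" for z
      unfolding power2_eq_square euclidean_inner[of a z] sum_product sum_distrib_left
      by (intro sum.cong refl) (simp add: mult_ac sum_distrib_left)
    then have "(\<integral>z. ?I z * (a \<bullet> z)\<^sup>2 \<partial>lborel) =
        (\<integral>z. (\<Sum>i\<in>Basis. \<Sum>j\<in>Basis. (a \<bullet> i) * (a \<bullet> j) * (?I z * ((z \<bullet> i) * (z \<bullet> j)))) \<partial>lborel)"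
      by simp
    also have "\<dots> = (\<Sum>i\<in>Basis. \<Sum>j\<in>Basis. (a \<bullet> i) * (a \<bullet> j) * M i j)"
      unfolding M_def using int by simp
    also have "\<dots> = (\<Sum>i\<in>Basis. \<Sum>j\<in>Basis. if i = j then (a \<bullet> i) * (a \<bullet> i) * \<kappa> else 0)"
      by (intro sum.cong refl) (simp add: Mij)
    also have "\<dots> = \<kappa> * (a \<bullet> a)"
      by (simp add: euclidean_inner[of a a] sum_distrib_left mult_ac)
    finally show ?thesis .
  qed
  have nn: "(\<integral>z. ?I z * (z \<bullet> z) \<partial>lborel) = \<kappa> * DIM('a)"
  proof -
    have "?I z * (z \<bullet> z) = (\<Sum>i\<in>Basis. ?I z * ((z \<bullet> i) * (z \<bullet> i)))" for z
      unfolding euclidean_inner[of z z] sum_distrib_left by simp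
    then have "(\<integral>z. ?I z * (z \<bullet> z) \<partial>lborel) = (\<integral>z. (\<Sum>i\<in>Basis. ?I z * ((z \<bullet> i) * (z \<bullet> i))) \<partial>lborel)"
      by (simp only:)
    also have "\<dots> = (\<Sum>i\<in>Basis. M i i)"
      unfolding M_def using int by (rule Bochner_Integration.integral_sum)
    also have "\<dots> = \<kappa> * DIM('a)" by (simp add: Mij mult.commute)
    finally show ?thesis .
  qed
  have odd: "(\<integral>z. ?I z * (a \<bullet> z) \<partial>lborel) = 0" for a
  proof -
    have "(\<integral>z. ?I z * (a \<bullet> z) \<partial>lborel) = (\<integral>z. ?I (- z) * (a \<bullet> (- z)) \<partial>lborel)"
      by (rule integral_lborel_invariant[OF lborel_uminus_invariant, symmetric]) simp_all
    also have "\<dots> = - (\<integral>z. ?I z * (a \<bullet> z) \<partial>lborel)"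
      by (simp add: indicator_def)
    finally show ?thesis by simp
  qed
  have "\<kappa> > 0"
  proof -
    have "\<kappa> \<ge> 0" unfolding \<kappa>_def M_def by (intro integral_nonneg_AE) simp
    \<comment> \<open>If \<open>\<kappa>\<close> vanished, so would the integral of the squared norm
      over the ball, making the ball a null set.\<close>
    moreover have "\<kappa> \<noteq> 0"
    proof
      assume "\<kappa> = 0"
      then have "(\<integral>z. ?I z * (z \<bullet> z) \<partial>lborel) = 0" using nn by simp
      moreover have "integrable lborel (\<lambda>z. ?I z * (z \<bullet> z))"
        by (rule integrable_cball_bounded[where B=1]) (auto simp: power2_norm_eq_inner[symmetric] abs_square_le_1)
      ultimately have "AE z in lborel. ?I z * (z \<bullet> z) = 0"
        by (subst (asm) integral_nonneg_eq_0_iff_AE) auto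
      moreover have "AE z in lborel. z \<noteq> (0::'a)" using AE_lborel_singleton by blast
      ultimately have "AE z in lborel. z \<notin> cball (0::'a) 1" by eventually_elim (auto simp: indicator_def)
      then have "cball (0::'a) 1 \<in> null_sets lborel"
        by (subst AE_iff_null_sets) auto
      then show False using content_cball_pos[of 1 "0::'a"] by (simp add: measure_def null_setsD1)
    qed
    ultimately show ?thesis by simp
  qed
  with sq nn odd that show thesis by blast
qed

section \<open>Ball averages of radial functions\<close>

text \<open>The mean value theorem puts \<open>q\<close> at an intermediate point, and the Lipschitz
  bound compares it with \<open>q a\<close>. The constant is not the sharp
  \<open>\<Lambda> / 2\<close>; it only has to dominate second differences uniformly in the
  step.\<close>

lemma taylor1_lipschitz_derivative:
  fixes Q q :: "real \<Rightarrow> real"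
  assumes Q: "\<And>t. t \<ge> 0 \<Longrightarrow> (Q has_real_derivative q t) (at t)"
    and lip: "\<And>s t. 0 \<le> s \<Longrightarrow> 0 \<le> t \<Longrightarrow> \<bar>q s - q t\<bar> \<le> \<Lambda> * \<bar>s - t\<bar>"
    and ab: "0 \<le> a" "0 \<le> b"
  shows "\<bar>Q b - Q a - q a * (b - a)\<bar> \<le> \<Lambda> * (b - a)\<^sup>2"
proof -
  have "\<exists>t\<ge>0. \<bar>t - a\<bar> \<le> \<bar>b - a\<bar> \<and> Q b - Q a = (b - a) * q t"
  proof (cases a b rule: linorder_cases)
    case less
    then obtain t where "t > a" "t < b" "Q b - Q a = (b - a) * q t"
      using MVT2[OF less, of Q q] Q ab by force
    with ab show ?thesis by (intro exI[of _ t]) auto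
  next
    case greater
    then obtain t where "t > b" "t < a" "Q a - Q b = (a - b) * q t"
      using MVT2[OF greater, of Q q] Q ab by force
    with ab show ?thesis by (intro exI[of _ t]) (auto simp: algebra_simps)
  qed (use ab in auto)
  then obtain t where t: "t \<ge> 0" "\<bar>t - a\<bar> \<le> \<bar>b - a\<bar>" "Q b - Q a = (b - a) * q t" by blast
  have "0 \<le> \<Lambda>" using lip[of 0 1] by simp
  have "\<bar>Q b - Q a - q a * (b - a)\<bar> = \<bar>b - a\<bar> * \<bar>q t - q a\<bar>"
    using t by (simp add: abs_mult[symmetric] algebra_simps)
  also have "\<dots> \<le> \<bar>b - a\<bar> * (\<Lambda> * \<bar>b - a\<bar>)"
    using lip[OF t(1) ab(1)] mult_left_mono[OF t(2) \<open>0 \<le> \<Lambda>\<close>] by (intro mult_left_mono) auto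
  also have "\<dots> = \<Lambda> * (b - a)\<^sup>2" by (simp add: power2_eq_square abs_mult_self_eq mult.left_commute)
  finally show ?thesis .
qed

text \<open>Differentiability of \<open>q\<close> is assumed at the single point \<open>a\<close>,
  because the profiles used later have kinks in \<open>q\<close>. The mean value theorem is applied
  to \<open>Q\<close> minus the linear and quadratic Taylor terms.\<close>

lemma taylor2_derivative_at:
  fixes Q q :: "real \<Rightarrow> real"
  assumes Q: "\<And>t. t \<ge> 0 \<Longrightarrow> (Q has_real_derivative q t) (at t)"
    and q': "(q has_real_derivative q') (at a)" and a: "0 \<le> a" and e: "e > 0"
  obtains d where "d > 0"
    "\<And>b. 0 \<le> b \<Longrightarrow> \<bar>b - a\<bar> < d \<Longrightarrow> \<bar>Q b - Q a - q a * (b - a) - q' / 2 * (b - a)\<^sup>2\<bar> \<le> e * (b - a)\<^sup>2"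
proof -
  obtain d where d: "d > 0" "\<And>t. \<bar>t - a\<bar> < d \<Longrightarrow> \<bar>q t - q a - q' * (t - a)\<bar> \<le> e * \<bar>t - a\<bar>"
    using q' e unfolding has_field_derivative_def has_derivative_at_alt by auto
  define F where "F t = Q t - q a * (t - a) - q' / 2 * (t - a)\<^sup>2" for t
  have F: "(F has_real_derivative (q t - q a - q' * (t - a))) (at t)" if "t \<ge> 0" for t
    unfolding F_def by (auto intro!: derivative_eq_intros Q that)
  have "\<bar>Q b - Q a - q a * (b - a) - q' / 2 * (b - a)\<^sup>2\<bar> \<le> e * (b - a)\<^sup>2"
    if b: "0 \<le> b" "\<bar>b - a\<bar> < d" for b
  proof -
    let ?f = "\<lambda>t. q t - q a - q' * (t - a)"
    have "\<exists>t\<ge>0. \<bar>t - a\<bar> \<le> \<bar>b - a\<bar> \<and> F b - F a = (b - a) * ?f t"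
    proof (cases a b rule: linorder_cases)
      case less
      then obtain t where "t > a" "t < b" "F b - F a = (b - a) * ?f t"
        using MVT2[OF less, of F ?f] F a by force
      with a show ?thesis by (intro exI[of _ t]) auto
    next
      case greater
      then obtain t where "t > b" "t < a" "F a - F b = (a - b) * ?f t"
        using MVT2[OF greater, of F ?f] F b by force
      with b show ?thesis by (intro exI[of _ t]) (auto simp: algebra_simps)
    qed (use a in auto)
    then obtain t where t: "t \<ge> 0" "\<bar>t - a\<bar> \<le> \<bar>b - a\<bar>" "F b - F a = (b - a) * ?f t" by blast
    have "\<bar>Q b - Q a - q a * (b - a) - q' / 2 * (b - a)\<^sup>2\<bar> = \<bar>b - a\<bar> * \<bar>?f t\<bar>"
      using t(3) by (simp add: F_def abs_mult[symmetric])
    also have "\<dots> \<le> \<bar>b - a\<bar> * (e * \<bar>b - a\<bar>)"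
    proof (rule mult_left_mono)
      have "\<bar>?f t\<bar> \<le> e * \<bar>t - a\<bar>" using d(2) t(2) b(2) by simp
      also have "\<dots> \<le> e * \<bar>b - a\<bar>" using t(2) e by (simp add: mult_left_mono)
      finally show "\<bar>?f t\<bar> \<le> e * \<bar>b - a\<bar>" .
    qed simp
    also have "\<dots> = e * (b - a)\<^sup>2" by (simp add: power2_eq_square abs_mult_self_eq mult.left_commute)
    finally show ?thesis .
  qed
  with d(1) that show thesis by blast
qed

text \<open>Up to normalisation, \<open>bdiff u s y\<close> is the mean of \<open>u\<close> over the ball of radius \<open>s\<close> about \<open>y\<close> minus \<open>u y\<close>;
  \<open>bdiff u s y / s\<^sup>2\<close> plays the role of the Laplacian.\<close>

definition bdiff :: "('a::euclidean_space \<Rightarrow> real) \<Rightarrow> real \<Rightarrow> 'a \<Rightarrow> real" where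
  "bdiff u s y = (\<integral>z. indicator (cball 0 1) z * (u (y + s *\<^sub>R z) - u y) \<partial>lborel)"

text \<open>The profile of a radial function is a function of the squared norm, so that no
  singularity arises at the origin.\<close>

locale radial_profile =
  fixes Q q :: "real \<Rightarrow> real" and \<Lambda> B :: real
  assumes Q: "\<And>t. t \<ge> 0 \<Longrightarrow> (Q has_real_derivative q t) (at t)"
    and lip: "\<And>s t. 0 \<le> s \<Longrightarrow> 0 \<le> t \<Longrightarrow> \<bar>q s - q t\<bar> \<le> \<Lambda> * \<bar>s - t\<bar>"
    and bnd: "\<And>t. 0 \<le> t \<Longrightarrow> \<bar>q t\<bar> \<le> B"
begin

lemma Lambda_nonneg: "0 \<le> \<Lambda>" using lip[of 0 1] by simp
lemma B_nonneg: "0 \<le> B" using bnd[of 0] by simp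

lemma continuous_radial: "continuous_on UNIV (\<lambda>y::'a::euclidean_space. Q (y \<bullet> y))"
proof -
  have "continuous_on {0..} Q"
    using Q by (intro continuous_at_imp_continuous_on ballI) (auto intro: DERIV_isCont)
  then show ?thesis
    by (rule continuous_on_compose2) (auto intro!: continuous_intros)
qed

lemma borel_radial [measurable]: "(\<lambda>y::'a::euclidean_space. Q (y \<bullet> y)) \<in> borel_measurable borel"
  by (rule borel_measurable_continuous_onI[OF continuous_radial])

lemma remainder_bound:
  fixes y z :: "'a::euclidean_space"
  assumes "norm z \<le> 1" "0 < s" "s \<le> 1"
  shows "\<bar>(Q ((y + s *\<^sub>R z) \<bullet> (y + s *\<^sub>R z)) - Q (y \<bullet> y) - q (y \<bullet> y) * (2 * s * (y \<bullet> z))) / s\<^sup>2\<bar>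
     \<le> B + \<Lambda> * (2 * norm y + 1)\<^sup>2"
proof -
  let ?a = "y \<bullet> y" and ?b = "(y + s *\<^sub>R z) \<bullet> (y + s *\<^sub>R z)"
  have ba: "?b - ?a = s * (2 * (y \<bullet> z) + s * (z \<bullet> z))"
    by (simp add: inner_simps inner_commute algebra_simps)
  have zz: "0 \<le> z \<bullet> z" "z \<bullet> z \<le> 1"
    using assms(1) by (auto simp: power2_norm_eq_inner[symmetric] abs_square_le_1)
  have "\<bar>y \<bullet> z\<bar> \<le> norm y"
    using Cauchy_Schwarz_ineq2[of y z] mult_left_mono[OF assms(1), of "norm y"] by simp
  moreover have "s * (z \<bullet> z) \<le> 1" using assms zz by (simp add: mult_le_one)
  moreover have "0 \<le> s * (z \<bullet> z)" using assms zz by simp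
  ultimately have "\<bar>2 * (y \<bullet> z) + s * (z \<bullet> z)\<bar> \<le> 2 * norm y + 1" by linarith
  then have sq: "(2 * (y \<bullet> z) + s * (z \<bullet> z))\<^sup>2 \<le> (2 * norm y + 1)\<^sup>2"
    by (simp add: abs_le_square_iff[symmetric])
  have "\<bar>Q ?b - Q ?a - q ?a * (?b - ?a)\<bar> \<le> \<Lambda> * (?b - ?a)\<^sup>2"
    by (rule taylor1_lipschitz_derivative[OF Q lip]) auto
  also have "\<dots> = s\<^sup>2 * (\<Lambda> * (2 * (y \<bullet> z) + s * (z \<bullet> z))\<^sup>2)" by (simp add: ba power_mult_distrib)
  also have "\<dots> \<le> s\<^sup>2 * (\<Lambda> * (2 * norm y + 1)\<^sup>2)"
    using sq Lambda_nonneg by (intro mult_left_mono) auto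
  finally have 1: "\<bar>Q ?b - Q ?a - q ?a * (?b - ?a)\<bar> \<le> s\<^sup>2 * (\<Lambda> * (2 * norm y + 1)\<^sup>2)" .
  have "Q ?b - Q ?a - q ?a * (2 * s * (y \<bullet> z)) = (Q ?b - Q ?a - q ?a * (?b - ?a)) + s\<^sup>2 * (q ?a * (z \<bullet> z))"
    unfolding ba by (simp add: algebra_simps power2_eq_square)
  moreover have "\<bar>s\<^sup>2 * (q ?a * (z \<bullet> z))\<bar> \<le> s\<^sup>2 * B"
    using bnd[of ?a] zz mult_mono[of "\<bar>q ?a\<bar>" B "z \<bullet> z" 1] B_nonneg
    by (simp add: abs_mult mult_left_mono)
  ultimately have "\<bar>Q ?b - Q ?a - q ?a * (2 * s * (y \<bullet> z))\<bar> \<le> s\<^sup>2 * (B + \<Lambda> * (2 * norm y + 1)\<^sup>2)"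
    using 1 by (simp add: distrib_left)
  then show ?thesis using assms by (simp add: divide_le_eq mult.commute)
qed

lemma bdiff_radial_eq:
  fixes y :: "'a::euclidean_space"
  assumes s: "0 < s" "s \<le> 1"
  shows "bdiff (\<lambda>y. Q (y \<bullet> y)) s y = s\<^sup>2 * (\<integral>z. indicator (cball 0 1) z *
     ((Q ((y + s *\<^sub>R z) \<bullet> (y + s *\<^sub>R z)) - Q (y \<bullet> y) - q (y \<bullet> y) * (2 * s * (y \<bullet> z))) / s\<^sup>2) \<partial>lborel)" (is ?eq)
   and bdiff_radial_bound: "\<bar>bdiff (\<lambda>y. Q (y \<bullet> y)) s y\<bar>
     \<le> s\<^sup>2 * ((B + \<Lambda> * (2 * norm y + 1)\<^sup>2) * measure lborel (cball (0::'a) 1))" (is ?bd)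
proof -
  let ?e = "\<lambda>z. (Q ((y + s *\<^sub>R z) \<bullet> (y + s *\<^sub>R z)) - Q (y \<bullet> y) - q (y \<bullet> y) * (2 * s * (y \<bullet> z))) / s\<^sup>2"
  let ?C = "B + \<Lambda> * (2 * norm y + 1)\<^sup>2"
  have [measurable]: "(\<lambda>z. Q ((y + s *\<^sub>R z) \<bullet> (y + s *\<^sub>R z))) \<in> borel_measurable borel"
    by (rule measurable_compose[OF _ borel_radial, of "\<lambda>z. y + s *\<^sub>R z"]) simp
  have i1: "integrable lborel (\<lambda>z. indicator (cball 0 1) z * ?e z)"
    using remainder_bound[OF _ s, of _ y] by (intro integrable_cball_bounded[where B="?C"]) auto
  have i2: "integrable lborel (\<lambda>z. indicator (cball 0 1) z * (y \<bullet> z))"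
  proof (rule integrable_cball_bounded[where B="norm y"])
    show "\<bar>y \<bullet> z\<bar> \<le> norm y" if "z \<in> cball 0 1" for z
      using Cauchy_Schwarz_ineq2[of y z] mult_left_mono[of "norm z" 1 "norm y"] that by simp
  qed measurable
  obtain \<kappa> :: real where odd: "\<And>a::'a. (\<integral>z. indicator (cball 0 1) z * (a \<bullet> z) \<partial>lborel) = 0"
    using second_moments_cball by blast
  have "bdiff (\<lambda>y. Q (y \<bullet> y)) s y = (\<integral>z. s\<^sup>2 * (indicator (cball 0 1) z * ?e z)
      + (q (y \<bullet> y) * 2 * s) * (indicator (cball 0 1) z * (y \<bullet> z)) \<partial>lborel)"
    unfolding bdiff_def using s by (intro Bochner_Integration.integral_cong refl) (simp add: field_simps)
  also have "\<dots> = (\<integral>z. s\<^sup>2 * (indicator (cball 0 1) z * ?e z) \<partial>lborel)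
      + (\<integral>z. (q (y \<bullet> y) * 2 * s) * (indicator (cball 0 1) z * (y \<bullet> z)) \<partial>lborel)"
    by (intro Bochner_Integration.integral_add integrable_mult_right i1 i2)
  also have "\<dots> = s\<^sup>2 * (\<integral>z. indicator (cball 0 1) z * ?e z \<partial>lborel)"
    by (simp only: integral_mult_right_zero odd mult_zero_right add_0_right)
  finally show eq: ?eq .
  have "\<bar>\<integral>z. indicator (cball 0 1) z * ?e z \<partial>lborel\<bar> \<le> (\<integral>z. \<bar>indicator (cball 0 1) z * ?e z\<bar> \<partial>lborel)"
    by (rule integral_abs_bound)
  also have "\<dots> \<le> (\<integral>z. indicator (cball (0::'a) 1) z * ?C \<partial>lborel)"
  proof (rule integral_mono)
    show "integrable lborel (\<lambda>z. indicator (cball (0::'a) 1) z * ?C)"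
      by (rule integrable_cball_bounded[where B="\<bar>?C\<bar>"]) auto
    show "\<bar>indicator (cball 0 1) z * ?e z\<bar> \<le> indicator (cball (0::'a) 1) z * ?C" for z
      using remainder_bound[OF _ s, of z y] by (simp add: indicator_def)
  qed (rule integrable_abs[OF i1])
  also have "\<dots> = ?C * measure lborel (cball (0::'a) 1)" by simp
  finally have *: "\<bar>\<integral>z. indicator (cball 0 1) z * ?e z \<partial>lborel\<bar> \<le> ?C * measure lborel (cball (0::'a) 1)" .
  show ?bd unfolding eq abs_mult using mult_left_mono[OF *, of "s\<^sup>2"] by (simp only: abs_power2 zero_le_power2)
qed

text \<open>In dimension \<open>n\<close> the Laplacian of
  \<open>\<lambda>y. Q (y \<bullet> y)\<close> is
  \<open>2 * n * q + 4 * (y \<bullet> y) * q'\<close>, so the limit is \<open>\<kappa> / 2\<close>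
  times the Laplacian.\<close>

lemma bdiff_radial_limit:
  fixes y :: "'a::euclidean_space" and \<kappa> :: real
  assumes q': "(q has_real_derivative q') (at (y \<bullet> y))"
    and \<kappa>: "\<And>a::'a. (\<integral>z. indicator (cball 0 1) z * (a \<bullet> z)\<^sup>2 \<partial>lborel) = \<kappa> * (a \<bullet> a)"
      "(\<integral>z. indicator (cball (0::'a) 1) z * (z \<bullet> z) \<partial>lborel) = \<kappa> * DIM('a)"
    and s: "\<And>k. 0 < s k" "\<And>k. s k \<le> 1" "s \<longlonglongrightarrow> 0"
  shows "(\<lambda>k. bdiff (\<lambda>y. Q (y \<bullet> y)) (s k) y / (s k)\<^sup>2)
     \<longlonglongrightarrow> \<kappa> * (DIM('a) * q (y \<bullet> y) + 2 * (y \<bullet> y) * q')"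
proof -
  let ?a = "y \<bullet> y" and ?b = "\<lambda>k z. (y + s k *\<^sub>R z) \<bullet> (y + s k *\<^sub>R z)"
  let ?e = "\<lambda>k z. (Q (?b k z) - Q ?a - q ?a * (2 * s k * (y \<bullet> z))) / (s k)\<^sup>2"
  let ?I = "indicator (cball 0 1) :: 'a \<Rightarrow> real"
  let ?C = "B + \<Lambda> * (2 * norm y + 1)\<^sup>2"
  have [measurable]: "(\<lambda>z. Q (?b k z)) \<in> borel_measurable borel" for k
    by (rule measurable_compose[OF _ borel_radial, of "\<lambda>z. y + s k *\<^sub>R z"]) simp
  have sz: "s k \<noteq> 0" for k using s(1)[of k] by simp
  have lim: "(\<lambda>k. ?e k z) \<longlonglongrightarrow> q ?a * (z \<bullet> z) + 2 * q' * (y \<bullet> z)\<^sup>2" for z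
  proof -
    \<comment> \<open>\<open>s k * m k\<close> is the increment of the squared norm, and
      \<open>\<rho> k\<close> below is the Taylor remainder divided by the squared radius.\<close>
    define m where "m k = 2 * (y \<bullet> z) + s k * (z \<bullet> z)" for k
    have m: "m \<longlonglongrightarrow> 2 * (y \<bullet> z)"
      unfolding m_def using tendsto_add[OF tendsto_const tendsto_mult_left_zero[OF s(3), of "z \<bullet> z"], of "2 * (y \<bullet> z)"] by simp
    have ba: "?b k z - ?a = s k * m k" for k
      by (simp add: m_def inner_simps inner_commute algebra_simps)
    have ba0: "(\<lambda>k. ?b k z - ?a) \<longlonglongrightarrow> 0" unfolding ba using tendsto_mult[OF s(3) m] by simp
    define \<rho> where "\<rho> k = (Q (?b k z) - Q ?a - q ?a * (?b k z - ?a) - q' / 2 * (?b k z - ?a)\<^sup>2) / (s k)\<^sup>2" for k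
    have e_eq: "?e k z = q ?a * (z \<bullet> z) + q' / 2 * (m k)\<^sup>2 + \<rho> k" for k
      unfolding \<rho>_def ba using sz[of k]
      by (simp add: field_simps m_def power2_eq_square)
    have "\<rho> \<longlonglongrightarrow> 0"
    proof (rule LIMSEQ_I)
      fix r :: real assume r: "r > 0"
      \<comment> \<open>An eventual bound for \<open>(m k)\<^sup>2\<close>; adding 1 keeps it
        positive when \<open>y\<close> and \<open>z\<close> are orthogonal.\<close>
      define c where "c = (2 * (y \<bullet> z))\<^sup>2 + 1"
      have c: "c > 0" unfolding c_def by (rule add_nonneg_pos) auto
      obtain d where d: "d > 0" "\<And>b. 0 \<le> b \<Longrightarrow> \<bar>b - ?a\<bar> < d \<Longrightarrow>
          \<bar>Q b - Q ?a - q ?a * (b - ?a) - q' / 2 * (b - ?a)\<^sup>2\<bar> \<le> (r / (2 * c)) * (b - ?a)\<^sup>2"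
        using taylor2_derivative_at[OF Q q', of "r / (2 * c)"] r c by auto
      have "\<forall>\<^sub>F k in sequentially. \<bar>?b k z - ?a\<bar> < d"
        using tendstoD[OF ba0 d(1)] by (simp add: dist_real_def)
      moreover have "\<forall>\<^sub>F k in sequentially. (m k)\<^sup>2 < c"
        by (rule order_tendstoD(2)[OF tendsto_power[OF m]]) (simp add: c_def)
      ultimately have "\<forall>\<^sub>F k in sequentially. norm (\<rho> k - 0) < r"
      proof eventually_elim
        case (elim k)
        have "\<bar>\<rho> k\<bar> = \<bar>Q (?b k z) - Q ?a - q ?a * (?b k z - ?a) - q' / 2 * (?b k z - ?a)\<^sup>2\<bar> / (s k)\<^sup>2"
          unfolding \<rho>_def abs_divide by simp
        also have "\<dots> \<le> (r / (2 * c)) * (?b k z - ?a)\<^sup>2 / (s k)\<^sup>2"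
          using d(2)[OF _ elim(1)] by (intro divide_right_mono) simp_all
        also have "\<dots> = (r / (2 * c)) * (s k * m k)\<^sup>2 / (s k)\<^sup>2" by (simp only: ba)
        also have "\<dots> = (r / (2 * c)) * (m k)\<^sup>2" using sz[of k] by (simp add: power_mult_distrib)
        also have "\<dots> \<le> (r / (2 * c)) * c" using elim(2) r c by (intro mult_left_mono) auto
        also have "\<dots> < r" using r c by simp
        finally show ?case by simp
      qed
      then show "\<exists>no. \<forall>n\<ge>no. norm (\<rho> n - 0) < r" by (simp add: eventually_sequentially)
    qed
    moreover have "(\<lambda>k. q' / 2 * (m k)\<^sup>2) \<longlonglongrightarrow> q' / 2 * (2 * (y \<bullet> z))\<^sup>2"
      by (intro tendsto_intros m)
    ultimately have "(\<lambda>k. q ?a * (z \<bullet> z) + q' / 2 * (m k)\<^sup>2 + \<rho> k) \<longlonglongrightarrow> q ?a * (z \<bullet> z) + q' / 2 * (2 * (y \<bullet> z))\<^sup>2 + 0"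
      by (intro tendsto_add tendsto_const)
    then show ?thesis unfolding e_eq by (simp add: power_mult_distrib mult.assoc)
  qed
  have "(\<lambda>k. \<integral>z. ?I z * ?e k z \<partial>lborel) \<longlonglongrightarrow> (\<integral>z. ?I z * (q ?a * (z \<bullet> z) + 2 * q' * (y \<bullet> z)\<^sup>2) \<partial>lborel)"
  proof (rule integral_dominated_convergence[where w="\<lambda>z. ?I z * ?C"])
    show "integrable lborel (\<lambda>z. ?I z * ?C)"
      by (rule integrable_cball_bounded[where B="\<bar>?C\<bar>"]) auto
    show "AE z in lborel. norm (?I z * ?e k z) \<le> ?I z * ?C" for k
      using remainder_bound[OF _ s(1,2), of _ y k] by (intro AE_I2) (simp add: indicator_def)
    show "AE z in lborel. (\<lambda>k. ?I z * ?e k z) \<longlonglongrightarrow> ?I z * (q ?a * (z \<bullet> z) + 2 * q' * (y \<bullet> z)\<^sup>2)"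
      by (intro AE_I2 tendsto_mult tendsto_const lim)
  qed measurable
  also have "(\<integral>z. ?I z * (q ?a * (z \<bullet> z) + 2 * q' * (y \<bullet> z)\<^sup>2) \<partial>lborel)
     = (\<integral>z. q ?a * (?I z * (z \<bullet> z)) + 2 * q' * (?I z * (y \<bullet> z)\<^sup>2) \<partial>lborel)"
    by (intro Bochner_Integration.integral_cong refl) (simp add: algebra_simps)
  also have "\<dots> = q ?a * (\<integral>z. ?I z * (z \<bullet> z) \<partial>lborel) + 2 * q' * (\<integral>z. ?I z * (y \<bullet> z)\<^sup>2 \<partial>lborel)"
  proof -
    have "integrable lborel (\<lambda>z. ?I z * (z \<bullet> z))"
      by (rule integrable_cball_bounded[where B=1]) (auto simp: power2_norm_eq_inner[symmetric] abs_square_le_1)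
    moreover have "integrable lborel (\<lambda>z. ?I z * (y \<bullet> z)\<^sup>2)"
    proof (rule integrable_cball_bounded[where B="(norm y)\<^sup>2"])
      show "\<bar>(y \<bullet> z)\<^sup>2\<bar> \<le> (norm y)\<^sup>2" if "z \<in> cball 0 1" for z
        using Cauchy_Schwarz_ineq2[of y z] mult_left_mono[of "norm z" 1 "norm y"] that
        by (simp add: abs_le_square_iff[symmetric])
    qed measurable
    ultimately show ?thesis by simp
  qed
  also have "\<dots> = \<kappa> * (DIM('a) * q ?a + 2 * ?a * q')" unfolding \<kappa> by (simp only: algebra_simps)
  finally have *: "(\<lambda>k. \<integral>z. ?I z * ?e k z \<partial>lborel) \<longlonglongrightarrow> \<kappa> * (DIM('a) * q ?a + 2 * ?a * q')" .
  have "bdiff (\<lambda>y. Q (y \<bullet> y)) (s k) y / (s k)\<^sup>2 = (\<integral>z. ?I z * ?e k z \<partial>lborel)" for k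
    unfolding bdiff_radial_eq[OF s(1,2)] by (rule nonzero_mult_div_cancel_left) (use sz in simp)
  with * show ?thesis by (simp only:)
qed

end

section \<open>Green-type radial profiles\<close>

lemma powr_lipschitz_above:
  fixes p \<rho> a b :: real
  assumes "\<rho> > 0" "a \<ge> \<rho>" "b \<ge> \<rho>" "p \<ge> 0"
  shows "\<bar>a powr - p - b powr - p\<bar> \<le> p * \<rho> powr (- p - 1) * \<bar>a - b\<bar>"
proof -
  have main: "\<bar>b powr - p - a powr - p\<bar> \<le> p * \<rho> powr (- p - 1) * \<bar>b - a\<bar>"
    if "a \<ge> \<rho>" "a < b" for a b
  proof -
    have "((\<lambda>x. x powr - p) has_real_derivative (- p) * t powr (- p - 1)) (at t)" if "a \<le> t" for t
      using that \<open>a \<ge> \<rho>\<close> assms(1) by (auto intro!: derivative_eq_intros)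
    then obtain t where t: "a < t" "b powr - p - a powr - p = (b - a) * (- p * t powr (- p - 1))"
      using MVT2[OF \<open>a < b\<close>, of "\<lambda>x. x powr - p" "\<lambda>t. (- p) * t powr (- p - 1)"] by blast
    have "t powr (- p - 1) \<le> \<rho> powr (- p - 1)"
      using t that assms by (intro powr_mono2') auto
    then have "(b - a) * (p * t powr (- p - 1)) \<le> (b - a) * (p * \<rho> powr (- p - 1))"
      using that assms by (intro mult_left_mono) auto
    then show ?thesis unfolding t(2) using that assms by (simp add: abs_mult mult_ac)
  qed
  show ?thesis
    using main[of a b] main[of b a] assms by (cases a b rule: linorder_cases) (auto simp: abs_minus_commute)
qed

lemma antiderivative_halfline:
  fixes q :: "real \<Rightarrow> real"
  assumes "continuous_on UNIV q"
  obtains Q where "\<And>t. t \<ge> 0 \<Longrightarrow> (Q has_real_derivative q t) (at t)" "Q t0 = 0"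
proof -
  \<comment> \<open>Integration starts at -1, so that 0 is an interior point and the derivative
    there is two-sided.\<close>
  define Q where "Q t = integral {- 1..t} q - integral {- 1..t0} q" for t
  have "(Q has_real_derivative q t) (at t)" if "t \<ge> 0" for t
  proof -
    have "continuous_on {- 1..t + 1} q" using assms continuous_on_subset by blast
    then have "((\<lambda>x. integral {- 1..x} q) has_real_derivative q t) (at t within {- 1..t + 1})"
      using that by (intro integral_has_real_derivative) auto
    then have "((\<lambda>x. integral {- 1..x} q) has_real_derivative q t) (at t)"
      using that by (simp add: at_within_Icc_at)
    then show ?thesis unfolding Q_def by (auto intro!: derivative_eq_intros)
  qed
  moreover have "Q t0 = 0" by (simp add: Q_def)
  ultimately show thesis using that by blast
qed


text \<open>With \<open>t\<close> the squared distance from the centre, \<open>- 1 / 2\<close> times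
  this is the derivative in \<open>t\<close> of the (normalised) potential of a mass spread
  uniformly over the ball of radius \<open>r\<close>: constant inside, that of a point mass outside.
  Starting from the derivative treats the logarithm of dimension two and the powers of higher
  dimensions alike.\<close>

definition cut_powr :: "real \<Rightarrow> real \<Rightarrow> real \<Rightarrow> real" where
  "cut_powr r n t = max (r\<^sup>2) t powr (- (n / 2))"

lemma cut_powr:
  fixes r n :: real
  assumes "r > 0" "n \<ge> 0"
  shows "continuous_on UNIV (cut_powr r n)"
    "\<bar>cut_powr r n s - cut_powr r n t\<bar> \<le> n / 2 * (r\<^sup>2) powr (- (n / 2) - 1) * \<bar>s - t\<bar>"
    "0 \<le> cut_powr r n t" "cut_powr r n t \<le> (r\<^sup>2) powr (- (n / 2))"
    "t < r\<^sup>2 \<Longrightarrow> ((cut_powr r n) has_real_derivative 0) (at t)"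
    "t > r\<^sup>2 \<Longrightarrow> ((cut_powr r n) has_real_derivative (- (n / 2)) * t powr (- (n / 2) - 1)) (at t)"
proof -
  have r2: "r\<^sup>2 > 0" using assms by simp
  have mx: "max (r\<^sup>2) t > 0" for t using r2 by linarith
  show "continuous_on UNIV (cut_powr r n)"
    unfolding cut_powr_def by (intro continuous_intros) (use mx less_imp_neq in \<open>metis\<close>)
  show "\<bar>cut_powr r n s - cut_powr r n t\<bar> \<le> n / 2 * (r\<^sup>2) powr (- (n / 2) - 1) * \<bar>s - t\<bar>"
  proof -
    have "\<bar>cut_powr r n s - cut_powr r n t\<bar> \<le> n / 2 * (r\<^sup>2) powr (- (n / 2) - 1) * \<bar>max (r\<^sup>2) s - max (r\<^sup>2) t\<bar>"
      unfolding cut_powr_def by (rule powr_lipschitz_above) (use assms r2 in auto)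
    also have "\<dots> \<le> n / 2 * (r\<^sup>2) powr (- (n / 2) - 1) * \<bar>s - t\<bar>"
      using assms by (intro mult_left_mono) auto
    finally show ?thesis .
  qed
  show "0 \<le> cut_powr r n t" by (simp add: cut_powr_def)
  show "cut_powr r n t \<le> (r\<^sup>2) powr (- (n / 2))"
    unfolding cut_powr_def by (intro powr_mono2') (use assms r2 in auto)
  show "((cut_powr r n) has_real_derivative 0) (at t)" if "t < r\<^sup>2"
  proof -
    have "((\<lambda>_. (r\<^sup>2) powr (- (n / 2))) has_real_derivative 0) (at t)" by simp
    moreover have "\<forall>\<^sub>F x in nhds t. (r\<^sup>2) powr (- (n / 2)) = cut_powr r n x"
      using eventually_nhds_in_open[of "{..<r\<^sup>2}" t] that by (auto elim!: eventually_mono simp: cut_powr_def max_def)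
    ultimately show ?thesis by (subst (asm) DERIV_cong_ev) auto
  qed
  show "((cut_powr r n) has_real_derivative (- (n / 2)) * t powr (- (n / 2) - 1)) (at t)" if "t > r\<^sup>2"
  proof -
    have "((\<lambda>x. x powr (- (n / 2))) has_real_derivative (- (n / 2)) * t powr (- (n / 2) - 1)) (at t)"
      using order_less_trans[OF r2 that] by (auto intro!: derivative_eq_intros)
    moreover have "\<forall>\<^sub>F x in nhds t. x powr (- (n / 2)) = cut_powr r n x"
      using eventually_nhds_in_open[of "{r\<^sup>2<..}" t] that by (auto elim!: eventually_mono simp: cut_powr_def max_def)
    ultimately show ?thesis by (subst (asm) DERIV_cong_ev) auto
  qed
qed

lemma antiderivative_nonincreasing:
  fixes Q q :: "real \<Rightarrow> real"
  assumes "\<And>t. t \<ge> 0 \<Longrightarrow> (Q has_real_derivative q t) (at t)" "\<And>t. t \<ge> 0 \<Longrightarrow> q t \<le> 0" "0 \<le> a" "a \<le> b"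
  shows "Q b \<le> Q a"
proof (rule DERIV_nonpos_imp_nonincreasing[OF \<open>a \<le> b\<close>])
  fix x assume "a \<le> x" "x \<le> b"
  with assms show "\<exists>y. DERIV Q x :> y \<and> y \<le> 0" by (intro exI[of _ "q x"]) auto
qed

text \<open>\<open>Q\<close> is the potential of the uniform mass on the ball of radius
  \<open>r\<close> minus that on the ball of radius \<open>R\<close>, as a function of the squared
  norm. Outside radius \<open>R\<close> equal masses have equal potentials, so the difference has
  compact support; inside it decreases outwards. Its Laplacian is the difference of the two
  densities.\<close>

lemma green_profile:
  fixes r R n :: real
  assumes rR: "0 < r" "r < R" and n: "n \<ge> 0"
  obtains Q q \<Lambda> B where "radial_profile Q q \<Lambda> B"
    "\<And>t. t \<ge> R\<^sup>2 \<Longrightarrow> Q t = 0" "\<And>t. t \<ge> 0 \<Longrightarrow> 0 \<le> Q t \<and> Q t \<le> Q 0"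
    "\<And>t. t \<ge> 0 \<Longrightarrow> t \<noteq> r\<^sup>2 \<Longrightarrow> t \<noteq> R\<^sup>2 \<Longrightarrow> \<exists>q'. (q has_real_derivative q') (at t) \<and>
       n * q t + 2 * t * q' = n / 2 * ((if t < R\<^sup>2 then R powr - n else 0) - (if t < r\<^sup>2 then r powr - n else 0))"
proof -
  define \<eta> where "\<eta> = cut_powr r n"
  note \<eta> = cut_powr[OF rR(1) n, folded \<eta>_def]
  have sq: "(x\<^sup>2) powr (- (n / 2)) = x powr - n" if "x > 0" for x :: real
    using that by (simp add: powr_powr flip: powr_numeral)
  have rR2: "0 < r\<^sup>2" "r\<^sup>2 < R\<^sup>2" using rR by (simp_all add: power_strict_mono)
  have mx_pos: "max (r\<^sup>2) t > 0" "max (r\<^sup>2) t \<noteq> 0" for t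
    using order_less_le_trans[OF rR2(1) max.cobounded1[of "r\<^sup>2" t]] by auto
  define c where "c = R powr - n"
  have c: "c \<ge> 0" by (simp add: c_def)
  \<comment> \<open>The maximum is the difference of the cut powers of radii \<open>r\<close> and
    \<open>R\<close>, which coincide from \<open>R\<^sup>2\<close> on.\<close>
  define q where "q t = - (1 / 2) * max 0 (\<eta> t - c)" for t
  have contq: "continuous_on UNIV q" unfolding q_def by (intro continuous_intros \<eta>(1))
  obtain Q where Q: "\<And>t. t \<ge> 0 \<Longrightarrow> (Q has_real_derivative q t) (at t)" "Q (R\<^sup>2) = 0"
    using antiderivative_halfline[OF contq] by blast
  have qneg: "q t \<le> 0" for t by (simp add: q_def)
  have eta_R: "\<eta> t \<le> c \<longleftrightarrow> t \<ge> R\<^sup>2 \<or> n = 0" if "t \<ge> 0" for t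
  proof -
    have "\<eta> (R\<^sup>2) = c" using rR2 rR by (simp add: \<eta>_def cut_powr_def c_def sq max_def)
    moreover have "\<eta> t \<le> \<eta> (R\<^sup>2)" if "t \<ge> R\<^sup>2"
      unfolding \<eta>_def cut_powr_def using that rR2 n by (intro powr_mono2') auto
    moreover have "\<eta> t > \<eta> (R\<^sup>2)" if "t < R\<^sup>2" "n \<noteq> 0"
      unfolding \<eta>_def cut_powr_def using that rR2 n mx_pos by (intro powr_less_mono2_neg) auto
    moreover have "\<eta> t = 1 \<and> c = 1" if "n = 0" using that rR rR2 by (auto simp: \<eta>_def cut_powr_def c_def max_def)
    ultimately show ?thesis by (smt (verit))
  qed
  show thesis
  proof (rule that[of Q q])
    show "radial_profile Q q (n / 2 * (r\<^sup>2) powr (- (n / 2) - 1)) ((r\<^sup>2) powr (- (n / 2)))"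
    proof
      show "\<bar>q s - q t\<bar> \<le> n / 2 * (r\<^sup>2) powr (- (n / 2) - 1) * \<bar>s - t\<bar>" for s t
      proof -
        have "\<bar>max 0 (\<eta> s - c) - max 0 (\<eta> t - c)\<bar> \<le> \<bar>\<eta> s - \<eta> t\<bar>" by (auto simp: max_def)
        moreover have "q s - q t = - (1 / 2) * (max 0 (\<eta> s - c) - max 0 (\<eta> t - c))"
          unfolding q_def by (simp only: right_diff_distrib)
        then have "\<bar>q s - q t\<bar> = 1 / 2 * \<bar>max 0 (\<eta> s - c) - max 0 (\<eta> t - c)\<bar>"
          by (simp only: abs_mult)
        moreover have "1 / 2 * \<bar>x\<bar> \<le> \<bar>x\<bar>" for x :: real by simp
        ultimately have "\<bar>q s - q t\<bar> \<le> \<bar>\<eta> s - \<eta> t\<bar>" by (metis order_trans)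
        with \<eta>(2)[of s t] show ?thesis by linarith
      qed
      show "\<bar>q t\<bar> \<le> (r\<^sup>2) powr (- (n / 2))" for t
      proof -
        have "0 \<le> max 0 (\<eta> t - c)" "max 0 (\<eta> t - c) \<le> \<eta> t" using \<eta>(3)[of t] c by auto
        then have "\<bar>q t\<bar> \<le> \<eta> t" unfolding q_def abs_mult by simp
        with \<eta>(4)[of t] show ?thesis by linarith
      qed
    qed (rule Q)
    have mono: "Q b \<le> Q a" if "0 \<le> a" "a \<le> b" for a b
      using antiderivative_nonincreasing[OF Q(1) qneg that] by simp
    show zero: "Q t = 0" if "t \<ge> R\<^sup>2" for t
    proof (cases "t = R\<^sup>2")
      case False
      then have "R\<^sup>2 < t" using that by simp
      have "q x = 0" if "x \<ge> R\<^sup>2" for x using that eta_R[of x] rR2 by (simp add: q_def)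
      then have "(Q has_real_derivative 0) (at x)" if "x \<ge> R\<^sup>2" for x
        using Q(1)[of x] that rR2 by force
      then show ?thesis using MVT2[OF \<open>R\<^sup>2 < t\<close>, of Q "\<lambda>_. 0"] Q(2) by auto
    qed (use Q in simp)
    show "0 \<le> Q t \<and> Q t \<le> Q 0" if "t \<ge> 0" for t
      using mono[of 0 t] mono[of t "max t (R\<^sup>2)"] zero[of "max t (R\<^sup>2)"] that by auto
    show "\<exists>q'. (q has_real_derivative q') (at t) \<and>
       n * q t + 2 * t * q' = n / 2 * ((if t < R\<^sup>2 then R powr - n else 0) - (if t < r\<^sup>2 then r powr - n else 0))"
      if t: "t \<ge> 0" "t \<noteq> r\<^sup>2" "t \<noteq> R\<^sup>2" for t
    proof (cases "n = 0")
      case True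
      have "q = (\<lambda>_. 0)" using rR rR2 mx_pos True by (auto simp: q_def \<eta>_def cut_powr_def c_def)
      then show ?thesis using True by (intro exI[of _ 0]) simp
    next
      case n0: False
      have q_eq: "\<forall>\<^sub>F x in nhds t. - (1 / 2) * (\<eta> x - c) = q x" if "t < R\<^sup>2"
      proof (rule eventually_mono[OF eventually_nhds_in_open[of "{..<R\<^sup>2}" t]])
        fix x assume "x \<in> {..<R\<^sup>2}"
        then have "x < R\<^sup>2" by simp
        have "\<eta> x \<ge> c"
        proof (cases "x \<ge> 0")
          case True then show ?thesis using eta_R[of x] n0 \<open>x < R\<^sup>2\<close> by simp
        next
          case False
          then have "max (r\<^sup>2) x = max (r\<^sup>2) 0" using rR2(1) by linarith
          then have "\<eta> x = \<eta> 0" by (simp only: \<eta>_def cut_powr_def)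
          moreover have "\<not> \<eta> 0 \<le> c" using eta_R[of 0] n0 rR2 by auto
          ultimately show ?thesis by simp
        qed
        then have "max 0 (\<eta> x - c) = \<eta> x - c" by simp
        then show "- (1 / 2) * (\<eta> x - c) = q x" unfolding q_def by (simp only:)
      qed (use that in auto)
      have q_val: "q t = - (1 / 2) * (\<eta> t - c)" if "t < R\<^sup>2"
        using eventually_nhds_x_imp_x[OF q_eq[OF that]] by simp
      consider "t < r\<^sup>2" | "r\<^sup>2 < t" "t < R\<^sup>2" | "R\<^sup>2 < t" using t by linarith
      then show ?thesis
      proof cases
        case 1
        have "((\<lambda>x. - (1 / 2) * (\<eta> x - c)) has_real_derivative 0) (at t)"
          using \<eta>(5)[OF 1] by (auto intro!: derivative_eq_intros)
        then have "(q has_real_derivative 0) (at t)"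
          using q_eq 1 rR2 by (subst (asm) DERIV_cong_ev) auto
        moreover have eta: "\<eta> t = r powr - n" using 1 rR sq[of r] by (simp add: \<eta>_def cut_powr_def max_def)
        have "n * q t + 2 * t * 0 = n / 2 * (c - r powr - n)"
          unfolding q_val[OF less_trans[OF 1 rR2(2)]] eta by (simp add: algebra_simps)
        moreover have "(if t < R\<^sup>2 then R powr - n else 0) = c" "(if t < r\<^sup>2 then r powr - n else 0) = r powr - n"
          using 1 rR2 by (simp_all add: c_def)
        ultimately show ?thesis by (intro exI[of _ 0]) (simp only: simp_thms)
      next
        case 2
        let ?q' = "n / 4 * t powr (- (n / 2) - 1)"
        have "((\<lambda>x. - (1 / 2) * (\<eta> x - c)) has_real_derivative ?q') (at t)"
          using \<eta>(6)[OF 2(1)] by (auto intro!: derivative_eq_intros)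
        then have "(q has_real_derivative ?q') (at t)"
          using q_eq 2 by (subst (asm) DERIV_cong_ev) auto
        moreover have "t * t powr (- (n / 2) - 1) = \<eta> t"
          using 2(1) less_trans[OF rR2(1) 2(1)] by (simp add: \<eta>_def cut_powr_def powr_diff)
        then have E: "2 * t * ?q' = n / 2 * \<eta> t" by (simp add: algebra_simps)
        have "n * q t + 2 * t * ?q' = n / 2 * (c - 0)"
          unfolding q_val[OF 2(2)] E by (simp add: field_simps)
        moreover have "(if t < R\<^sup>2 then R powr - n else 0) = c" "(if t < r\<^sup>2 then r powr - n else 0) = 0"
          using 2 rR2 by (simp_all add: c_def)
        ultimately show ?thesis by (intro exI[of _ ?q']) (simp only: simp_thms)
      next
        case 3
        have "0 = q x" if "x \<in> {R\<^sup>2<..}" for x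
        proof -
          have "R\<^sup>2 < x" using that by simp
          then have "0 \<le> x" using zero_le_power2[of R] by linarith
          then show ?thesis using eta_R[of x] that by (simp add: q_def)
        qed
        then have "\<forall>\<^sub>F x in nhds t. 0 = q x"
          using eventually_nhds_in_open[of "{R\<^sup>2<..}" t] 3 by (auto elim: eventually_mono)
        then have "(q has_real_derivative 0) (at t)"
          using DERIV_const[of 0 "at t"] by (subst (asm) DERIV_cong_ev) auto
        moreover have "q t = 0" using 3 eta_R[of t] t by (simp add: q_def)
        ultimately show ?thesis using 3 rR2 by (intro exI[of _ 0]) simp
      qed
    qed
  qed
qed

section \<open>Self-adjointness of ball averaging and decrease of ball means\<close>

text \<open>Averaging over balls is convolution with an even kernel, hence self-adjoint: Fubini, a
  translation in \<open>y\<close> and the substitution \<open>z \<mapsto> - z\<close> move the shift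
  from \<open>u\<close> to \<open>w\<close>. Boundedness and the common bounded support make all
  integrals finite.\<close>

lemma bdiff_symmetric:
  fixes u w :: "'a::euclidean_space \<Rightarrow> real"
  assumes [measurable]: "u \<in> borel_measurable borel" "w \<in> borel_measurable borel"
    and bu: "\<And>y. \<bar>u y\<bar> \<le> Bu" and bw: "\<And>y. \<bar>w y\<bar> \<le> Bw"
    and su: "\<And>y. y \<notin> cball c \<rho> \<Longrightarrow> u y = 0" and sw: "\<And>y. y \<notin> cball c \<rho> \<Longrightarrow> w y = 0"
  shows "(\<integral>y. w y * bdiff u s y \<partial>lborel) = (\<integral>y. u y * bdiff w s y \<partial>lborel)"
proof -
  let ?I = "indicator (cball 0 1) :: 'a \<Rightarrow> real"
  define P where "P u y = (\<integral>z. ?I z * u (y + s *\<^sub>R z) \<partial>lborel)" for u :: "'a \<Rightarrow> real" and y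
  define m where "m = measure lborel (cball (0::'a) 1)"
  have int0: "integrable lborel (\<lambda>z. ?I z * f z)"
    if "f \<in> borel_measurable borel" "\<And>y. \<bar>f y\<bar> \<le> b" for f :: "'a \<Rightarrow> real" and b
    using that by (intro integrable_cball_bounded[where B=b]) auto
  have bd: "bdiff f s y = P f y - m * f y"
    if [measurable]: "f \<in> borel_measurable borel" and b: "\<And>y. \<bar>f y\<bar> \<le> b" for f y b
  proof -
    have "bdiff f s y = (\<integral>z. ?I z * f (y + s *\<^sub>R z) - ?I z * f y \<partial>lborel)"
      unfolding bdiff_def by (simp add: right_diff_distrib)
    also have "\<dots> = P f y - (\<integral>z. ?I z * f y \<partial>lborel)"
      unfolding P_def
      by (rule Bochner_Integration.integral_diff; rule int0[where b=b]) (use b in simp_all)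
    also have "(\<integral>z. ?I z * f y \<partial>lborel) = m * f y" by (simp add: m_def)
    finally show ?thesis .
  qed
  have pint: "integrable (lborel \<Otimes>\<^sub>M lborel) (\<lambda>(y, z). f y * (?I z * g (y + t *\<^sub>R z)))"
    if [measurable]: "f \<in> borel_measurable borel" "g \<in> borel_measurable borel"
      and f: "\<And>y. \<bar>f y\<bar> \<le> a" "\<And>y. y \<notin> cball c \<rho> \<Longrightarrow> f y = 0" and g: "\<And>y. \<bar>g y\<bar> \<le> b"
    for f g :: "'a \<Rightarrow> real" and a b t
  proof (rule Bochner_Integration.integrable_bound)
    let ?S = "cball c \<rho> \<times> cball (0::'a) 1"
    have "emeasure (lborel \<Otimes>\<^sub>M lborel) ?S = emeasure lborel (cball c \<rho>) * emeasure lborel (cball (0::'a) 1)"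
      by (rule lborel.emeasure_pair_measure_Times) auto
    also have "\<dots> < \<infinity>"
      using emeasure_lborel_cball_finite[of c \<rho>] emeasure_lborel_cball_finite[of "0::'a" 1]
      by (simp add: ennreal_mult_less_top)
    finally have "emeasure (lborel \<Otimes>\<^sub>M lborel) ?S < \<infinity>" .
    then show "integrable (lborel \<Otimes>\<^sub>M lborel) (\<lambda>p. indicator ?S p * (a * b))"
      by (intro integrable_mult_left integrable_real_indicator) auto
    have "\<bar>f y * (?I z * g (y + t *\<^sub>R z))\<bar> \<le> indicator ?S (y, z) * (a * b)" for y z
    proof (cases "y \<in> cball c \<rho> \<and> z \<in> cball 0 1")
      case True
      then show ?thesis using f(1)[of y] g[of "y + t *\<^sub>R z"] by (simp add: abs_mult mult_mono')
    next
      case False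
      then show ?thesis using f(2)[of y] by (auto simp: indicator_def)
    qed
    moreover have "0 \<le> a" "0 \<le> b" using order_trans[OF abs_ge_zero f(1)] order_trans[OF abs_ge_zero g] by auto
    ultimately show "AE p in lborel \<Otimes>\<^sub>M lborel. norm (case p of (y, z) \<Rightarrow> f y * (?I z * g (y + t *\<^sub>R z))) \<le> norm (indicator ?S p * (a * b))"
      by (intro AE_I2) (auto simp: abs_mult)
  qed measurable
  have move: "(\<integral>y. w y * P u y \<partial>lborel) = (\<integral>y. u y * P w y \<partial>lborel)"
  proof -
    have "(\<integral>y. w y * P u y \<partial>lborel) = (\<integral>y. (\<integral>z. w y * (?I z * u (y + s *\<^sub>R z)) \<partial>lborel) \<partial>lborel)"
      unfolding P_def by simp
    also have "\<dots> = (\<integral>z. (\<integral>y. w y * (?I z * u (y + s *\<^sub>R z)) \<partial>lborel) \<partial>lborel)"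
      by (rule lborel_pair.Fubini_integral[symmetric]) (rule pint[OF assms(2,1) bw sw bu])
    also have "\<dots> = (\<integral>z. (\<integral>y. w (y - s *\<^sub>R z) * (?I z * u y) \<partial>lborel) \<partial>lborel)"
    proof (rule Bochner_Integration.integral_cong[OF refl])
      fix z
      show "(\<integral>y. w y * (?I z * u (y + s *\<^sub>R z)) \<partial>lborel) = (\<integral>y. w (y - s *\<^sub>R z) * (?I z * u y) \<partial>lborel)"
        by (subst integral_lborel_shift[of "\<lambda>y. w y * (?I z * u (y + s *\<^sub>R z))" "- (s *\<^sub>R z)", symmetric])
           (simp_all add: algebra_simps)
    qed
    also have "\<dots> = (\<integral>z. (\<integral>y. w (y - s *\<^sub>R (- z)) * (?I (- z) * u y) \<partial>lborel) \<partial>lborel)"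
      by (rule integral_lborel_invariant[OF lborel_uminus_invariant, symmetric]) measurable
    also have "\<dots> = (\<integral>z. (\<integral>y. u y * (?I z * w (y + s *\<^sub>R z)) \<partial>lborel) \<partial>lborel)"
      by (simp add: indicator_def mult_ac)
    also have "\<dots> = (\<integral>y. (\<integral>z. u y * (?I z * w (y + s *\<^sub>R z)) \<partial>lborel) \<partial>lborel)"
      by (rule lborel_pair.Fubini_integral) (rule pint[OF assms(1,2) bu su bw])
    also have "\<dots> = (\<integral>y. u y * P w y \<partial>lborel)" unfolding P_def by simp
    finally show ?thesis .
  qed
  have intP: "integrable lborel (\<lambda>y. f y * P g y)"
    if "f \<in> borel_measurable borel" "g \<in> borel_measurable borel"
      "\<And>y. \<bar>f y\<bar> \<le> a" "\<And>y. y \<notin> cball c \<rho> \<Longrightarrow> f y = 0" "\<And>y. \<bar>g y\<bar> \<le> b"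
    for f g :: "'a \<Rightarrow> real" and a b
    using lborel_pair.integrable_fst[OF pint[OF that]] by (simp add: P_def)
  have intuw: "integrable lborel (\<lambda>y. u y * w y)"
  proof -
    have "integrable lborel (\<lambda>y. indicator (cball c \<rho>) y * (u y * w y))"
      using bu bw by (intro integrable_cball_bounded[where B="Bu * Bw"]) (auto simp: abs_mult intro!: mult_mono')
    moreover have "(\<lambda>y. indicator (cball c \<rho>) y * (u y * w y)) = (\<lambda>y. u y * w y)"
      using su by (auto simp: fun_eq_iff indicator_def)
    ultimately show ?thesis by simp
  qed
  have "(\<integral>y. w y * bdiff u s y \<partial>lborel) = (\<integral>y. w y * P u y - m * (u y * w y) \<partial>lborel)"
    by (simp add: bd[OF assms(1) bu] right_diff_distrib mult_ac)
  also have "\<dots> = (\<integral>y. w y * P u y \<partial>lborel) - m * (\<integral>y. u y * w y \<partial>lborel)"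
    using intP[OF assms(2,1) bw sw bu] intuw by (subst Bochner_Integration.integral_diff) auto
  also have "\<dots> = (\<integral>y. u y * P w y \<partial>lborel) - m * (\<integral>y. u y * w y \<partial>lborel)"
    by (simp only: move)
  also have "\<dots> = (\<integral>y. u y * P w y - m * (u y * w y) \<partial>lborel)"
    using intP[OF assms(1,2) bu su bw] intuw by (subst Bochner_Integration.integral_diff) auto
  also have "\<dots> = (\<integral>y. u y * bdiff w s y \<partial>lborel)"
    by (simp add: bd[OF assms(2) bw] right_diff_distrib mult_ac)
  finally show ?thesis .
qed

lemma bdiff_measurable [measurable]:
  fixes u :: "'a::euclidean_space \<Rightarrow> real"
  assumes [measurable]: "u \<in> borel_measurable borel"
  shows "bdiff u s \<in> borel_measurable borel"
  unfolding bdiff_def by measurable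

lemma bdiff_local:
  fixes u v :: "'a::euclidean_space \<Rightarrow> real"
  assumes "\<And>x. x \<in> cball y s \<Longrightarrow> u x = v x" "0 \<le> s"
  shows "bdiff u s y = bdiff v s y"
  unfolding bdiff_def
proof (rule Bochner_Integration.integral_cong[OF refl])
  fix z :: 'a
  have "norm z \<le> 1 \<Longrightarrow> y + s *\<^sub>R z \<in> cball y s"
    using assms(2) by (simp add: dist_norm mult_left_le)
  then show "indicator (cball 0 1) z * (u (y + s *\<^sub>R z) - u y) = indicator (cball 0 1) z * (v (y + s *\<^sub>R z) - v y)"
    using assms by (auto simp: indicator_def)
qed

lemma bdiff_translate: "bdiff (\<lambda>y. w (y - c)) s y = bdiff w s (y - c)"
  unfolding bdiff_def by (simp add: algebra_simps)

lemma AE_lborel_sphere: "AE y in lborel. dist c y \<noteq> r" for c :: "'a::euclidean_space"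
proof -
  have "sphere c r \<in> null_sets lborel"
    using negligible_sphere[of c r] by (simp add: negligible_iff_null_sets null_sets_completion_iff)
  then show ?thesis using AE_not_in by force
qed

text \<open>Pairs \<open>u\<close> with the function \<open>w\<close> of the Green-type profile, moving the second difference from \<open>u\<close> to \<open>w\<close>.\<close>

lemma ball_average_decreasing:
  fixes u :: "'a::euclidean_space \<Rightarrow> real"
  assumes rR: "0 < r" "r < R" and \<delta>: "0 < \<delta>" "\<delta> \<le> 1"
    and um [measurable]: "u \<in> borel_measurable borel" and bu: "\<And>y. \<bar>u y\<bar> \<le> Bu"
    and lim: "AE y in lborel. y \<in> cball c R \<longrightarrow>
      (\<lambda>k. max 0 (bdiff u (\<delta> / Suc k) y / (\<delta> / Suc k)\<^sup>2)) \<longlonglongrightarrow> 0"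
    and bound: "\<And>k y. y \<in> cball c R \<Longrightarrow> bdiff u (\<delta> / Suc k) y / (\<delta> / Suc k)\<^sup>2 \<le> C"
  shows "(\<integral>y. indicator (cball c R) y * u y \<partial>lborel) / R ^ DIM('a)
    \<le> (\<integral>y. indicator (cball c r) y * u y \<partial>lborel) / r ^ DIM('a)"
proof -
  let ?n = "real DIM('a)"
  define s where "s k = \<delta> / Suc k" for k
  have s: "0 < s k" "s k \<le> 1" for k
    using \<delta> by (auto simp: s_def divide_simps)
  have s0: "s \<longlonglongrightarrow> 0" unfolding s_def by real_asymp
  obtain \<kappa> :: real where \<kappa>: "\<kappa> > 0"
    "\<And>a::'a. (\<integral>z. indicator (cball 0 1) z * (a \<bullet> z)\<^sup>2 \<partial>lborel) = \<kappa> * (a \<bullet> a)"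
    "(\<integral>z. indicator (cball (0::'a) 1) z * (z \<bullet> z) \<partial>lborel) = \<kappa> * DIM('a)"
    "\<And>a::'a. (\<integral>z. indicator (cball 0 1) z * (a \<bullet> z) \<partial>lborel) = 0"
    by (rule second_moments_cball[where 'a='a]) (rule that)
  obtain Q q \<Lambda> B where GP: "radial_profile Q q \<Lambda> B"
    "\<And>t. t \<ge> R\<^sup>2 \<Longrightarrow> Q t = 0" "\<And>t. t \<ge> 0 \<Longrightarrow> 0 \<le> Q t \<and> Q t \<le> Q 0"
    "\<And>t. t \<ge> 0 \<Longrightarrow> t \<noteq> r\<^sup>2 \<Longrightarrow> t \<noteq> R\<^sup>2 \<Longrightarrow> \<exists>q'. (q has_real_derivative q') (at t) \<and>
       ?n * q t + 2 * t * q' = ?n / 2 * ((if t < R\<^sup>2 then R powr - ?n else 0) - (if t < r\<^sup>2 then r powr - ?n else 0))"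
    by (rule green_profile[OF rR of_nat_0_le_iff[of "DIM('a)"]]) (rule that)
  interpret radial_profile Q q \<Lambda> B by (rule GP)
  define w where "w y = Q ((y - c) \<bullet> (y - c))" for y
  have wm [measurable]: "w \<in> borel_measurable borel"
    unfolding w_def by (rule measurable_compose[OF _ borel_radial, of "\<lambda>y. y - c"]) simp
  have w0: "0 \<le> w y" "w y \<le> Q 0" for y using GP(3) by (auto simp: w_def)
  have dist_sq: "(y - c) \<bullet> (y - c) = (dist c y)\<^sup>2" for y
    by (metis dist_norm dist_commute power2_norm_eq_inner)
  have ws: "w y = 0" if "y \<notin> cball c R" for y
    using that rR GP(2) by (auto simp: w_def dist_sq intro!: power_mono)
  \<comment> \<open>The radii \<open>s k\<close> are at most 1, so cutting \<open>u\<close> off at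
    radius \<open>R + 1\<close> changes no second difference centred in \<open>cball c R\<close>,
    and it makes \<open>bdiff_symmetric\<close> applicable.\<close>
  define u' where "u' y = indicator (cball c (R + 1)) y * u y" for y
  have um' [measurable]: "u' \<in> borel_measurable borel" unfolding u'_def by measurable
  have bu': "\<bar>u' y\<bar> \<le> Bu" for y using bu[of y] by (auto simp: u'_def indicator_def)
  have bd_eq: "bdiff u' (s k) y = bdiff u (s k) y" if "y \<in> cball c R" for k y
  proof (rule bdiff_local)
    fix x assume "x \<in> cball y (s k)"
    then have "dist c x \<le> R + 1" using that s(2)[of k] dist_triangle[of c x y] by (auto simp: dist_commute)
    then show "u' x = u x" by (simp add: u'_def)
  qed (use s(1)[of k] in simp)
  have bw: "bdiff w t y = bdiff (\<lambda>y. Q (y \<bullet> y)) t (y - c)" for t y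
    unfolding bdiff_translate[symmetric] w_def ..
  \<comment> \<open>The limit of the second differences of \<open>w\<close>, that is
    \<open>\<kappa> / 2\<close> times its Laplacian; convergence may fail only on the two bounding
    spheres, which are null sets.\<close>
  define T where "T y = \<kappa> * (?n / 2) * (indicator (cball c R) y / R ^ DIM('a) - indicator (cball c r) y / r ^ DIM('a))" for y
  have T: "AE y in lborel. (\<lambda>k. bdiff w (s k) y / (s k)\<^sup>2) \<longlonglongrightarrow> T y"
    using AE_lborel_sphere[of c r] AE_lborel_sphere[of c R]
  proof eventually_elim
    case (elim y)
    let ?t = "(y - c) \<bullet> (y - c)"
    have "?t \<noteq> r\<^sup>2" "?t \<noteq> R\<^sup>2" using elim rR by (auto simp: dist_sq)
    then obtain q' where q': "(q has_real_derivative q') (at ?t)"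
      "?n * q ?t + 2 * ?t * q' = ?n / 2 * ((if ?t < R\<^sup>2 then R powr - ?n else 0) - (if ?t < r\<^sup>2 then r powr - ?n else 0))"
      using GP(4)[of ?t] by auto
    have sqlt: "a\<^sup>2 < b\<^sup>2 \<longleftrightarrow> a < b" if "0 \<le> a" "0 \<le> b" for a b :: real
      using that by (auto intro: power_strict_mono power2_less_imp_less)
    have "?t < R\<^sup>2 \<longleftrightarrow> y \<in> cball c R" "?t < r\<^sup>2 \<longleftrightarrow> y \<in> cball c r"
      unfolding dist_sq mem_cball using elim rR by (auto simp: sqlt)
    moreover have "x powr - ?n = 1 / x ^ DIM('a)" if "x > 0" for x :: real
      using that by (simp add: powr_minus powr_realpow divide_inverse)
    ultimately have "\<kappa> * (?n * q ?t + 2 * ?t * q') = T y"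
      unfolding q'(2) T_def using rR by (simp add: indicator_def)
    then show ?case
      unfolding bw using bdiff_radial_limit[OF q'(1) \<kappa>(2,3) s s0] by simp
  qed
  have cv: "(\<lambda>k. \<integral>y. u' y * (bdiff w (s k) y / (s k)\<^sup>2) \<partial>lborel) \<longlonglongrightarrow> (\<integral>y. u' y * T y \<partial>lborel)"
  proof (rule integral_dominated_convergence)
    let ?M = "(B + \<Lambda> * (2 * (R + 1) + 1)\<^sup>2) * measure lborel (cball (0::'a) 1)"
    show "integrable lborel (\<lambda>y. indicator (cball c (R + 1)) y * (Bu * ?M))"
      by (rule integrable_cball_bounded[where B="\<bar>Bu * ?M\<bar>"]) auto
    show "AE y in lborel. norm (u' y * (bdiff w (s k) y / (s k)\<^sup>2)) \<le> indicator (cball c (R + 1)) y * (Bu * ?M)" for k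
    proof (rule AE_I2)
      fix y
      show "norm (u' y * (bdiff w (s k) y / (s k)\<^sup>2)) \<le> indicator (cball c (R + 1)) y * (Bu * ?M)"
      proof (cases "y \<in> cball c (R + 1)")
        case True
        then have n: "norm (y - c) \<le> R + 1" by (simp add: dist_norm norm_minus_commute)
        have "\<bar>bdiff w (s k) y\<bar> \<le> (s k)\<^sup>2 * ((B + \<Lambda> * (2 * norm (y - c) + 1)\<^sup>2) * measure lborel (cball (0::'a) 1))"
          unfolding bw by (rule bdiff_radial_bound[OF s])
        also have "\<dots> \<le> (s k)\<^sup>2 * ?M"
          using n Lambda_nonneg by (intro mult_left_mono mult_right_mono add_left_mono power_mono) auto
        finally have "\<bar>bdiff w (s k) y / (s k)\<^sup>2\<bar> \<le> ?M"
          using s(1)[of k] by (simp add: divide_le_eq mult.commute)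
        then have "\<bar>u' y * (bdiff w (s k) y / (s k)\<^sup>2)\<bar> \<le> Bu * ?M"
          unfolding abs_mult using bu'[of y] by (intro mult_mono') auto
        moreover have "indicator (cball c (R + 1)) y = (1::real)" using True by simp
        ultimately show ?thesis by (simp only: real_norm_def mult_1)
      qed (simp add: u'_def)
    qed
    show "AE y in lborel. (\<lambda>k. u' y * (bdiff w (s k) y / (s k)\<^sup>2)) \<longlonglongrightarrow> u' y * T y"
      using T by eventually_elim (intro tendsto_mult tendsto_const)
  qed (unfold T_def, measurable)
  \<comment> \<open>The second differences of \<open>u\<close> have a uniform bound from above only,
    so just their positive part is sent to the limit; \<open>w\<close> \<ge> 0 makes this an upper
    estimate.\<close>
  have cv0: "(\<lambda>k. \<integral>y. w y * max 0 (bdiff u' (s k) y / (s k)\<^sup>2) \<partial>lborel) \<longlonglongrightarrow> (\<integral>y. (0::real) \<partial>(lborel :: 'a measure))"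
  proof (rule integral_dominated_convergence)
    show "integrable lborel (\<lambda>y. indicator (cball c R) y * (Q 0 * max 0 C))"
      by (rule integrable_cball_bounded[where B="\<bar>Q 0 * max 0 C\<bar>"]) auto
    show "AE y in lborel. norm (w y * max 0 (bdiff u' (s k) y / (s k)\<^sup>2)) \<le> indicator (cball c R) y * (Q 0 * max 0 C)" for k
    proof (rule AE_I2)
      fix y
      show "norm (w y * max 0 (bdiff u' (s k) y / (s k)\<^sup>2)) \<le> indicator (cball c R) y * (Q 0 * max 0 C)"
      proof (cases "y \<in> cball c R")
        case True
        then have "max 0 (bdiff u' (s k) y / (s k)\<^sup>2) \<le> max 0 C"
          using bound[OF True, of k] bd_eq[OF True, of k] by (simp add: s_def max_def)
        then have "\<bar>w y * max 0 (bdiff u' (s k) y / (s k)\<^sup>2)\<bar> \<le> Q 0 * max 0 C"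
          unfolding abs_mult using w0[of y] by (intro mult_mono') auto
        moreover have "indicator (cball c R) y = (1::real)" using True by simp
        ultimately show ?thesis by (simp only: real_norm_def mult_1)
      qed (simp add: ws)
    qed
    show "AE y in lborel. (\<lambda>k. w y * max 0 (bdiff u' (s k) y / (s k)\<^sup>2)) \<longlonglongrightarrow> 0"
      using lim
    proof eventually_elim
      case (elim y)
      then show ?case
        using bd_eq[of y] ws[of y] by (cases "y \<in> cball c R") (auto simp: s_def intro!: tendsto_mult_right_zero)
    qed
  qed measurable
  \<comment> \<open>A crude bound that degenerates after division by the squared radius; it serves
    integrability at each fixed \<open>k\<close>.\<close>
  have bdd_abs: "\<bar>bdiff f t y\<bar> \<le> 2 * b * measure lborel (cball (0::'a) 1)"
    if "f \<in> borel_measurable borel" "\<And>y. \<bar>f y\<bar> \<le> b" for f :: "'a \<Rightarrow> real" and t y b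
  proof -
    note [measurable] = that(1)
    have "\<bar>bdiff f t y\<bar> \<le> (\<integral>z. \<bar>indicator (cball 0 1) z * (f (y + t *\<^sub>R z) - f y)\<bar> \<partial>lborel)"
      unfolding bdiff_def by (rule integral_abs_bound)
    also have "\<dots> \<le> (\<integral>z. indicator (cball (0::'a) 1) z * (2 * b) \<partial>lborel)"
    proof (rule integral_mono)
      have le: "\<bar>f (y + t *\<^sub>R z) - f y\<bar> \<le> 2 * b" for z
        using that(2)[of "y + t *\<^sub>R z"] that(2)[of y] by linarith
      show "integrable lborel (\<lambda>z. \<bar>indicator (cball 0 1) z * (f (y + t *\<^sub>R z) - f y)\<bar>)"
        by (rule integrable_abs, rule integrable_cball_bounded[where B="2 * b"]) (use le in auto)
      show "integrable lborel (\<lambda>z. indicator (cball (0::'a) 1) z * (2 * b))"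
        by (rule integrable_cball_bounded[where B="\<bar>2 * b\<bar>"]) auto
      show "\<bar>indicator (cball 0 1) z * (f (y + t *\<^sub>R z) - f y)\<bar> \<le> indicator (cball (0::'a) 1) z * (2 * b)" for z
        using le[of z] by (simp add: indicator_def)
    qed
    finally show ?thesis by (simp add: mult_ac)
  qed
  have le0: "(\<integral>y. u' y * (bdiff w (s k) y / (s k)\<^sup>2) \<partial>lborel) \<le> (\<integral>y. w y * max 0 (bdiff u' (s k) y / (s k)\<^sup>2) \<partial>lborel)" for k
  proof -
    have "(\<integral>y. u' y * (bdiff w (s k) y / (s k)\<^sup>2) \<partial>lborel) = (\<integral>y. u' y * bdiff w (s k) y \<partial>lborel) / (s k)\<^sup>2"
      by simp
    also have "(\<integral>y. u' y * bdiff w (s k) y \<partial>lborel) = (\<integral>y. w y * bdiff u' (s k) y \<partial>lborel)"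
    proof (rule bdiff_symmetric[symmetric, where c=c and \<rho>="R + 1"])
      show "\<bar>w y\<bar> \<le> Q 0" for y using w0[of y] by simp
      show "u' y = 0" if "y \<notin> cball c (R + 1)" for y using that by (simp add: u'_def)
      show "w y = 0" if "y \<notin> cball c (R + 1)" for y using that by (intro ws) auto
    qed (use bu' in measurable)
    also have "\<dots> / (s k)\<^sup>2 = (\<integral>y. w y * (bdiff u' (s k) y / (s k)\<^sup>2) \<partial>lborel)" by simp
    also have "\<dots> \<le> (\<integral>y. w y * max 0 (bdiff u' (s k) y / (s k)\<^sup>2) \<partial>lborel)"
    proof (rule integral_mono)
      let ?D = "2 * Bu * measure lborel (cball (0::'a) 1) / (s k)\<^sup>2"
      have D: "\<bar>bdiff u' (s k) y / (s k)\<^sup>2\<bar> \<le> ?D" for y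
        using bdd_abs[OF um' bu', of "s k" y] s(1)[of k] by (simp add: divide_right_mono)
      have wi: "w y = indicator (cball c R) y * w y" for y using ws[of y] by (auto simp: indicator_def)
      have *: "integrable lborel (\<lambda>y. w y * g y)"
        if "g \<in> borel_measurable borel" "\<And>y. \<bar>g y\<bar> \<le> ?D" for g
      proof -
        note [measurable] = that(1)
        have "integrable lborel (\<lambda>y. indicator (cball c R) y * (w y * g y))"
        proof (rule integrable_cball_bounded[where B="Q 0 * ?D"])
          show "\<bar>w z * g z\<bar> \<le> Q 0 * ?D" for z
            using w0[of z] that(2)[of z] unfolding abs_mult by (intro mult_mono) auto
        qed measurable
        moreover have "(\<lambda>y. indicator (cball c R) y * (w y * g y)) = (\<lambda>y. w y * g y)"
          using wi by (auto simp: fun_eq_iff mult.assoc[symmetric])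
        ultimately show ?thesis by simp
      qed
      show "integrable lborel (\<lambda>y. w y * (bdiff u' (s k) y / (s k)\<^sup>2))"
        by (rule *[OF _ D]) measurable
      show "integrable lborel (\<lambda>y. w y * max 0 (bdiff u' (s k) y / (s k)\<^sup>2))"
      proof (rule *)
        show "\<bar>max 0 (bdiff u' (s k) y / (s k)\<^sup>2)\<bar> \<le> ?D" for y
          using D[of y] by linarith
      qed measurable
      show "w y * (bdiff u' (s k) y / (s k)\<^sup>2) \<le> w y * max 0 (bdiff u' (s k) y / (s k)\<^sup>2)" for y
        using w0[of y] by (intro mult_left_mono) auto
    qed
    finally show ?thesis .
  qed
  have "(\<integral>y. u' y * T y \<partial>lborel) \<le> 0"
    using LIMSEQ_le[OF cv cv0] le0 by auto
  moreover have "(\<integral>y. u' y * T y \<partial>lborel) = \<kappa> * (?n / 2) *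
      ((\<integral>y. indicator (cball c R) y * u y \<partial>lborel) / R ^ DIM('a) - (\<integral>y. indicator (cball c r) y * u y \<partial>lborel) / r ^ DIM('a))"
  proof -
    have i: "integrable lborel (\<lambda>y. indicator (cball c x) y * u y)" for x
      using bu by (intro integrable_cball_bounded[where B=Bu]) auto
    have "u' y * T y = \<kappa> * (?n / 2) * (indicator (cball c R) y * u y / R ^ DIM('a) - indicator (cball c r) y * u y / r ^ DIM('a))" for y
      using rR by (auto simp: u'_def T_def indicator_def right_diff_distrib mult_ac)
    then have "(\<integral>y. u' y * T y \<partial>lborel) = \<kappa> * (?n / 2) *
       (\<integral>y. indicator (cball c R) y * u y / R ^ DIM('a) - indicator (cball c r) y * u y / r ^ DIM('a) \<partial>lborel)"
      by (simp only: integral_mult_right_zero)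
    also have "(\<integral>y. indicator (cball c R) y * u y / R ^ DIM('a) - indicator (cball c r) y * u y / r ^ DIM('a) \<partial>lborel)
       = (\<integral>y. indicator (cball c R) y * u y \<partial>lborel) / R ^ DIM('a) - (\<integral>y. indicator (cball c r) y * u y \<partial>lborel) / r ^ DIM('a)"
      using i by (subst Bochner_Integration.integral_diff) auto
    finally show ?thesis .
  qed
  moreover have "\<kappa> * (?n / 2) > 0" using \<kappa>(1) by simp
  ultimately show ?thesis using \<kappa>(1) by (simp add: mult_le_0_iff)
qed

section \<open>Bounded superharmonic functions\<close>

text \<open>Real bounded values let plain Bochner integrals express the mean value inequality,
  without shifting by a lower bound. \<open>W\<close> may be disconnected; extended-valued
  superharmonic functions enter through their truncations.\<close>

definition bsuperharmonic :: "'a::euclidean_space set \<Rightarrow> ('a \<Rightarrow> real) \<Rightarrow> bool" where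
  "bsuperharmonic W v \<longleftrightarrow> open W \<and> (\<exists>B. \<forall>y\<in>W. \<bar>v y\<bar> \<le> B) \<and> (\<forall>a. open {y\<in>W. a < v y}) \<and>
    (\<forall>x r. 0 < r \<and> cball x r \<subseteq> W \<longrightarrow>
      (\<integral>y. indicator (cball x r) y * v y \<partial>lborel) \<le> v x * measure lborel (cball x r))"

lemma bsuperharmonicI:
  assumes "open W" "\<And>y. y \<in> W \<Longrightarrow> \<bar>v y\<bar> \<le> B" "\<And>a. open {y\<in>W. a < v y}"
    "\<And>x r. 0 < r \<Longrightarrow> cball x r \<subseteq> W \<Longrightarrow>
      (\<integral>y. indicator (cball x r) y * v y \<partial>lborel) \<le> v x * measure lborel (cball x r)"
  shows "bsuperharmonic W v"
  using assms unfolding bsuperharmonic_def by blast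

lemma bsuperharmonicD:
  assumes "bsuperharmonic W v"
  shows "open W" "\<exists>B. \<forall>y\<in>W. \<bar>v y\<bar> \<le> B" "open {y\<in>W. a < v y}"
    "0 < r \<Longrightarrow> cball x r \<subseteq> W \<Longrightarrow>
      (\<integral>y. indicator (cball x r) y * v y \<partial>lborel) \<le> v x * measure lborel (cball x r)"
  using assms unfolding bsuperharmonic_def by blast+

lemma lsc_borel:
  fixes v :: "'a::euclidean_space \<Rightarrow> real"
  assumes "open W" "\<And>a. open {y\<in>W. a < v y}"
  shows "(\<lambda>y. indicator W y * v y) \<in> borel_measurable borel"
  unfolding borel_measurable_iff_greater
proof (intro allI)
  fix a
  have "{w \<in> space borel. a < indicator W w * v w} = {y\<in>W. a < v y} \<union> (if a < 0 then - W else {})"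
    by (auto simp: indicator_def split: if_splits)
  then show "{w \<in> space borel. a < indicator W w * v w} \<in> sets borel"
    using assms by (auto intro!: sets.Un borel_open borel_closed)
qed

lemma bsuperharmonic_integrable:
  fixes v :: "'a::euclidean_space \<Rightarrow> real"
  assumes "bsuperharmonic W v" "cball x r \<subseteq> W"
  shows "integrable lborel (\<lambda>y. indicator (cball x r) y * v y)"
proof -
  obtain B where B: "\<And>y. y \<in> W \<Longrightarrow> \<bar>v y\<bar> \<le> B" using bsuperharmonicD(2)[OF assms(1)] by blast
  have [measurable]: "(\<lambda>y. indicator W y * v y) \<in> borel_measurable borel"
    by (rule lsc_borel[OF bsuperharmonicD(1,3)[OF assms(1)]])
  have eq: "(\<lambda>y. indicator (cball x r) y * v y) = (\<lambda>y. indicator (cball x r) y * (indicator W y * v y))"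
    using assms(2) by (auto simp: fun_eq_iff indicator_def)
  show ?thesis
  proof (rule integrable_cball_bounded[where B=B])
    show "(\<lambda>y. indicator (cball x r) y * v y) \<in> borel_measurable borel" unfolding eq by measurable
  qed (use B assms in blast)
qed

lemma bsuperharmonic_subset: "bsuperharmonic W v \<Longrightarrow> open W' \<Longrightarrow> W' \<subseteq> W \<Longrightarrow> bsuperharmonic W' v"
proof -
  assume v: "bsuperharmonic W v" and W': "open W'" "W' \<subseteq> W"
  obtain B where B: "\<And>y. y \<in> W \<Longrightarrow> \<bar>v y\<bar> \<le> B" using bsuperharmonicD(2)[OF v] by blast
  show "bsuperharmonic W' v"
  proof (rule bsuperharmonicI[where B=B])
    fix a
    have "{y\<in>W'. a < v y} = W' \<inter> {y\<in>W. a < v y}" using W' by auto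
    then show "open {y\<in>W'. a < v y}" using W' bsuperharmonicD(3)[OF v] by auto
  qed (use W' B bsuperharmonicD(4)[OF v] in blast)+
qed

lemma bsuperharmonic_cong:
  assumes "bsuperharmonic W u" "\<And>y. y \<in> W \<Longrightarrow> u y = v y"
  shows "bsuperharmonic W v"
proof -
  obtain B where B: "\<And>y. y \<in> W \<Longrightarrow> \<bar>u y\<bar> \<le> B" using bsuperharmonicD(2)[OF assms(1)] by blast
  show ?thesis
  proof (rule bsuperharmonicI[where B=B])
    show "\<bar>v y\<bar> \<le> B" if "y \<in> W" for y using B[OF that] assms(2)[OF that] by simp
    have "{y\<in>W. a < v y} = {y\<in>W. a < u y}" for a using assms(2) by auto
    then show "open {y\<in>W. a < v y}" for a using bsuperharmonicD(3)[OF assms(1)] by simp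
    fix x r assume r: "0 < (r::real)" "cball x r \<subseteq> W"
    have "(\<integral>y. indicator (cball x r) y * v y \<partial>lborel) = (\<integral>y. indicator (cball x r) y * u y \<partial>lborel)"
      by (rule Bochner_Integration.integral_cong[OF refl]) (use r assms(2) in \<open>auto simp: indicator_def\<close>)
    moreover have "u x = v x" using r by (intro assms(2)) auto
    ultimately show "(\<integral>y. indicator (cball x r) y * v y \<partial>lborel) \<le> v x * measure lborel (cball x r)"
      using bsuperharmonicD(4)[OF assms(1) r] by simp
  qed (use bsuperharmonicD(1)[OF assms(1)] in simp)
qed

lemma bsuperharmonic_const: "open W \<Longrightarrow> bsuperharmonic W (\<lambda>_. c)"
proof (rule bsuperharmonicI[where B="\<bar>c\<bar>"])
  show "open {y\<in>W. a < c}" if "open W" for a using that by (cases "a < c") auto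
qed auto

lemma bsuperharmonic_add:
  assumes "bsuperharmonic W u" "bsuperharmonic W v"
  shows "bsuperharmonic W (\<lambda>y. u y + v y)"
proof -
  obtain B where B: "\<And>y. y \<in> W \<Longrightarrow> \<bar>u y\<bar> \<le> B" using bsuperharmonicD(2)[OF assms(1)] by blast
  obtain C where C: "\<And>y. y \<in> W \<Longrightarrow> \<bar>v y\<bar> \<le> C" using bsuperharmonicD(2)[OF assms(2)] by blast
  show ?thesis
  proof (rule bsuperharmonicI[where B="B + C"])
    show "\<bar>u y + v y\<bar> \<le> B + C" if "y \<in> W" for y using B[OF that] C[OF that] by linarith
    fix a
    have "{y\<in>W. a < u y + v y} = (\<Union>q. {y\<in>W. q < u y} \<inter> {y\<in>W. a - q < v y})"
    proof (intro set_eqI iffI)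
      fix y assume y: "y \<in> {y\<in>W. a < u y + v y}"
      then have "a - v y < u y" by auto
      then obtain q where "a - v y < q" "q < u y" using dense by blast
      with y show "y \<in> (\<Union>q. {y\<in>W. q < u y} \<inter> {y\<in>W. a - q < v y})" by (auto intro!: exI[of _ q])
    qed auto
    then show "open {y\<in>W. a < u y + v y}"
      using bsuperharmonicD(3)[OF assms(1)] bsuperharmonicD(3)[OF assms(2)] by (simp only:) (intro open_UN open_Int ballI; simp)
  next
    fix x r assume r: "0 < (r::real)" "cball x r \<subseteq> W"
    have "(\<integral>y. indicator (cball x r) y * (u y + v y) \<partial>lborel) =
        (\<integral>y. indicator (cball x r) y * u y \<partial>lborel) + (\<integral>y. indicator (cball x r) y * v y \<partial>lborel)"
      unfolding distrib_left by (intro Bochner_Integration.integral_add bsuperharmonic_integrable[OF _ r(2)] assms)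
    then show "(\<integral>y. indicator (cball x r) y * (u y + v y) \<partial>lborel) \<le> (u x + v x) * measure lborel (cball x r)"
      using bsuperharmonicD(4)[OF assms(1) r] bsuperharmonicD(4)[OF assms(2) r] by (simp add: distrib_right)
  qed (use bsuperharmonicD(1)[OF assms(1)] in simp)
qed

lemma bsuperharmonic_scale:
  assumes "bsuperharmonic W u" "0 \<le> c"
  shows "bsuperharmonic W (\<lambda>y. c * u y)"
proof (cases "c = 0")
  case True then show ?thesis using bsuperharmonic_const[OF bsuperharmonicD(1)[OF assms(1)], of 0] by simp
next
  case False
  then have c: "c > 0" using assms by simp
  obtain B where B: "\<And>y. y \<in> W \<Longrightarrow> \<bar>u y\<bar> \<le> B" using bsuperharmonicD(2)[OF assms(1)] by blast
  show ?thesis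
  proof (rule bsuperharmonicI[where B="c * B"])
    show "\<bar>c * u y\<bar> \<le> c * B" if "y \<in> W" for y using B[OF that] c by (simp add: abs_mult)
    have "{y\<in>W. a < c * u y} = {y\<in>W. a / c < u y}" for a using c by (auto simp: field_simps)
    then show "open {y\<in>W. a < c * u y}" for a using bsuperharmonicD(3)[OF assms(1)] by auto
    fix x r assume r: "0 < (r::real)" "cball x r \<subseteq> W"
    have "(\<integral>y. indicator (cball x r) y * (c * u y) \<partial>lborel) = (\<integral>y. c * (indicator (cball x r) y * u y) \<partial>lborel)"
      by (simp add: mult_ac)
    also have "\<dots> = c * (\<integral>y. indicator (cball x r) y * u y \<partial>lborel)" by (rule integral_mult_right_zero)
    also have "\<dots> \<le> c * (u x * measure lborel (cball x r))"
      using bsuperharmonicD(4)[OF assms(1) r] assms(2) by (rule mult_left_mono)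
    finally show "(\<integral>y. indicator (cball x r) y * (c * u y) \<partial>lborel) \<le> c * u x * measure lborel (cball x r)"
      by (simp add: mult.assoc)
  qed (use bsuperharmonicD(1)[OF assms(1)] in simp)
qed

lemma bsuperharmonic_min:
  assumes "bsuperharmonic W u" "bsuperharmonic W v"
  shows "bsuperharmonic W (\<lambda>y. min (u y) (v y))"
proof -
  obtain B where B: "\<And>y. y \<in> W \<Longrightarrow> \<bar>u y\<bar> \<le> B" using bsuperharmonicD(2)[OF assms(1)] by blast
  obtain C where C: "\<And>y. y \<in> W \<Longrightarrow> \<bar>v y\<bar> \<le> C" using bsuperharmonicD(2)[OF assms(2)] by blast
  show ?thesis
  proof (rule bsuperharmonicI[where B="max B C"])
    show "\<bar>min (u y) (v y)\<bar> \<le> max B C" if "y \<in> W" for y using B[OF that] C[OF that] by linarith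
    have "{y\<in>W. a < min (u y) (v y)} = {y\<in>W. a < u y} \<inter> {y\<in>W. a < v y}" for a by auto
    then show "open {y\<in>W. a < min (u y) (v y)}" for a
      using bsuperharmonicD(3)[OF assms(1)] bsuperharmonicD(3)[OF assms(2)] by auto
    fix x r assume r: "0 < (r::real)" "cball x r \<subseteq> W"
    let ?m = "\<integral>y. indicator (cball x r) y * min (u y) (v y) \<partial>lborel"
    have "min (u y) (v y) * indicator (cball x r) y = min (u y * indicator (cball x r) y) (v y * indicator (cball x r) y)" for y
      by (auto simp: indicator_def)
    then have i: "integrable lborel (\<lambda>y. indicator (cball x r) y * min (u y) (v y))"
      using bsuperharmonic_integrable[OF assms(1) r(2)] bsuperharmonic_integrable[OF assms(2) r(2)] by (simp add: mult.commute[of "indicator _ _"])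
    have "?m \<le> (\<integral>y. indicator (cball x r) y * u y \<partial>lborel)"
      by (rule integral_mono[OF i bsuperharmonic_integrable[OF assms(1) r(2)]]) (simp add: indicator_def)
    moreover have "?m \<le> (\<integral>y. indicator (cball x r) y * v y \<partial>lborel)"
      by (rule integral_mono[OF i bsuperharmonic_integrable[OF assms(2) r(2)]]) (simp add: indicator_def)
    ultimately show "?m \<le> min (u x) (v x) * measure lborel (cball x r)"
      using bsuperharmonicD(4)[OF assms(1) r] bsuperharmonicD(4)[OF assms(2) r] by (simp add: min_def)
  qed (use bsuperharmonicD(1)[OF assms(1)] in simp)
qed

section \<open>Gluing superharmonic functions on overlapping open sets\<close>

text \<open>Translates the super-mean value inequality on \<open>cball y s\<close> into
  \<open>bdiff u s y \<le> 0\<close>, by the substitution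
  \<open>x = y + s *\<^sub>R z\<close>.\<close>

lemma bdiff_eq_ball_average:
  fixes u :: "'a::euclidean_space \<Rightarrow> real"
  assumes [measurable]: "u \<in> borel_measurable borel" and bu: "\<And>y. \<bar>u y\<bar> \<le> B" and s: "s > 0"
  shows "s ^ DIM('a) * bdiff u s y = (\<integral>x. indicator (cball y s) x * u x \<partial>lborel) - u y * measure lborel (cball y s)"
proof -
  have "(\<integral>x. indicator (cball y s) x * (u x - u y) \<partial>lborel)
     = (\<integral>x. indicator (cball y s) x * (u x - u y) \<partial>density (distr lborel borel (\<lambda>z. y + s *\<^sub>R z)) (\<lambda>_. \<bar>s\<bar> ^ DIM('a)))"
    using lborel_affine[of s y] s by simp
  also have "\<dots> = (\<integral>x. \<bar>s\<bar> ^ DIM('a) * (indicator (cball y s) x * (u x - u y)) \<partial>distr lborel borel (\<lambda>z. y + s *\<^sub>R z))"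
    by (subst integral_density) auto
  also have "\<dots> = (\<integral>z. \<bar>s\<bar> ^ DIM('a) * (indicator (cball y s) (y + s *\<^sub>R z) * (u (y + s *\<^sub>R z) - u y)) \<partial>lborel)"
    by (subst integral_distr) auto
  also have "\<dots> = s ^ DIM('a) * (\<integral>z. indicator (cball y s) (y + s *\<^sub>R z) * (u (y + s *\<^sub>R z) - u y) \<partial>lborel)"
    using s by (simp only: integral_mult_right_zero abs_of_pos)
  also have "(\<lambda>z. indicator (cball y s) (y + s *\<^sub>R z) * (u (y + s *\<^sub>R z) - u y)) = (\<lambda>z. indicator (cball 0 1) z * (u (y + s *\<^sub>R z) - u y))"
    using s by (auto simp: fun_eq_iff indicator_def dist_norm)
  finally have "s ^ DIM('a) * bdiff u s y = (\<integral>x. indicator (cball y s) x * (u x - u y) \<partial>lborel)"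
    by (simp add: bdiff_def)
  also have "\<dots> = (\<integral>x. indicator (cball y s) x * u x - indicator (cball y s) x * u y \<partial>lborel)"
    by (simp only: right_diff_distrib)
  also have "\<dots> = (\<integral>x. indicator (cball y s) x * u x \<partial>lborel) - (\<integral>x. indicator (cball y s) x * u y \<partial>lborel)"
    by (rule Bochner_Integration.integral_diff; rule integrable_cball_bounded[where B=B]) (use bu in auto)
  also have "(\<integral>x. indicator (cball y s) x * u y \<partial>lborel) = u y * measure lborel (cball y s)"
    by simp
  finally show ?thesis .
qed

text \<open>A large ball may lie in neither \<open>W1\<close> nor \<open>W2\<close>, but by
  compactness every ball centred in it with radius below a Lebesgue number \<open>e\<close> lies in
  one of them. Hence second differences at small scale are nonpositive throughout the large ball, so
  its mean is at most the mean over a concentric ball of radius below \<open>e\<close>, where the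
  inequality is known.\<close>

lemma bsuperharmonic_Un:
  fixes v :: "'a::euclidean_space \<Rightarrow> real"
  assumes v1: "bsuperharmonic W1 v" and v2: "bsuperharmonic W2 v"
  shows "bsuperharmonic (W1 \<union> W2) v"
proof -
  obtain B1 where B1: "\<And>y. y \<in> W1 \<Longrightarrow> \<bar>v y\<bar> \<le> B1" using bsuperharmonicD(2)[OF v1] by blast
  obtain B2 where B2: "\<And>y. y \<in> W2 \<Longrightarrow> \<bar>v y\<bar> \<le> B2" using bsuperharmonicD(2)[OF v2] by blast
  define B where "B = max 0 (max B1 B2)"
  have op: "open (W1 \<union> W2)" using bsuperharmonicD(1)[OF v1] bsuperharmonicD(1)[OF v2] by auto
  \<comment> \<open>The 0 in \<open>B\<close> covers the points outside the union, where the
    extension \<open>u\<close> below vanishes.\<close>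
  have bv: "\<bar>v y\<bar> \<le> B" if "y \<in> W1 \<union> W2" for y
    using B1[of y] B2[of y] that unfolding B_def by fastforce
  have "{y\<in>W1 \<union> W2. a < v y} = {y\<in>W1. a < v y} \<union> {y\<in>W2. a < v y}" for a by auto
  then have lsc: "open {y\<in>W1 \<union> W2. a < v y}" for a
    using bsuperharmonicD(3)[OF v1] bsuperharmonicD(3)[OF v2] by auto
  define u where "u y = indicator (W1 \<union> W2) y * v y" for y
  have um [measurable]: "u \<in> borel_measurable borel" unfolding u_def by (rule lsc_borel[OF op lsc])
  have bu: "\<bar>u y\<bar> \<le> B" for y using bv[of y] by (auto simp: u_def indicator_def B_def)
  show ?thesis
  proof (rule bsuperharmonicI[OF op bv lsc])
    fix x and R :: real assume R: "0 < R" "cball x R \<subseteq> W1 \<union> W2"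
    obtain e where e: "e > 0" "\<And>y. y \<in> cball x R \<Longrightarrow> \<exists>G\<in>{W1, W2}. ball y e \<subseteq> G"
      using Heine_Borel_lemma[of "cball x R" "{W1, W2}"] R bsuperharmonicD(1)[OF v1] bsuperharmonicD(1)[OF v2] by auto
    have loc: "(\<integral>z. indicator (cball y s) z * u z \<partial>lborel) \<le> u y * measure lborel (cball y s)"
      if y: "y \<in> cball x R" and s: "0 < s" "s < e" for y s
    proof -
      obtain G where G: "G = W1 \<or> G = W2" "ball y e \<subseteq> G" using e(2)[OF y] by auto
      have sub: "cball y s \<subseteq> G" using G(2) s by (auto simp: subset_iff)
      have "bsuperharmonic G v" using G v1 v2 by auto
      moreover have "(\<integral>z. indicator (cball y s) z * u z \<partial>lborel) = (\<integral>z. indicator (cball y s) z * v z \<partial>lborel)"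
        using sub G by (intro Bochner_Integration.integral_cong refl) (auto simp: u_def indicator_def)
      moreover have "u y = v y" using sub G s by (auto simp: u_def subset_iff)
      ultimately show ?thesis using bsuperharmonicD(4)[of G v s y] s sub by simp
    qed
    \<comment> \<open>Every radius \<open>\<delta> / Suc k\<close> then stays below the Lebesgue
      number \<open>e\<close> and is at most 1.\<close>
    define \<delta> where "\<delta> = min 1 (e / 2)"
    have \<delta>: "0 < \<delta>" "\<delta> \<le> 1" "\<delta> < e" using e(1) by (auto simp: \<delta>_def min_def)
    define r where "r = min (R / 2) (e / 2)"
    have r: "0 < r" "r < R" "r < e" using e(1) R by (auto simp: r_def min_def)
    have neg: "bdiff u (\<delta> / Suc k) y / (\<delta> / Suc k)\<^sup>2 \<le> 0" if "y \<in> cball x R" for k y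
    proof -
      let ?s = "\<delta> / Suc k"
      have s: "0 < ?s" "?s < e"
      proof -
        show "0 < ?s" using \<delta> by simp
        have "?s \<le> \<delta>" using \<delta> by (simp add: divide_le_eq)
        then show "?s < e" using \<delta> by simp
      qed
      have "?s ^ DIM('a) * bdiff u ?s y \<le> 0"
        unfolding bdiff_eq_ball_average[OF um bu s(1)] using loc[OF that s] by simp
      then have "bdiff u ?s y \<le> 0" by (metis mult_pos_pos not_le s(1) zero_less_power)
      then show ?thesis by (intro divide_nonpos_nonneg) auto
    qed
    have "(\<integral>y. indicator (cball x R) y * u y \<partial>lborel) / R ^ DIM('a) \<le> (\<integral>y. indicator (cball x r) y * u y \<partial>lborel) / r ^ DIM('a)"
    proof (rule ball_average_decreasing[OF r(1,2) \<delta>(1,2) um bu, where C=0])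
      show "AE y in lborel. y \<in> cball x R \<longrightarrow> (\<lambda>k. max 0 (bdiff u (\<delta> / Suc k) y / (\<delta> / Suc k)\<^sup>2)) \<longlonglongrightarrow> 0"
        using neg by (intro AE_I2 impI) (simp add: max_absorb1)
    qed (rule neg)
    also have "\<dots> \<le> u x * measure lborel (cball x r) / r ^ DIM('a)"
      using loc[of x r] r R by (intro divide_right_mono) auto
    also have "\<dots> = u x * unit_ball_vol DIM('a)" using r by (simp add: content_cball)
    finally have "(\<integral>y. indicator (cball x R) y * u y \<partial>lborel) \<le> u x * measure lborel (cball x R)"
      using R by (simp add: content_cball divide_le_eq mult.assoc)
    moreover have "(\<integral>z. indicator (cball x R) z * u z \<partial>lborel) = (\<integral>z. indicator (cball x R) z * v z \<partial>lborel)"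
      using R by (intro Bochner_Integration.integral_cong refl) (auto simp: u_def indicator_def)
    moreover have "u x = v x" using R by (auto simp: u_def subset_iff)
    ultimately show "(\<integral>y. indicator (cball x R) y * v y \<partial>lborel) \<le> v x * measure lborel (cball x R)" by simp
  qed
qed

section \<open>Points are polar\<close>

text \<open>A nonpositive Laplacian controls second differences only in the limit, and on one sphere
  it may not even exist. This suffices for \<open>ball_average_decreasing\<close>: the positive
  parts tend to 0 almost everywhere and have a uniform upper bound. The mean over
  \<open>cball x R\<close> is thus compared with means over arbitrarily small balls, which tend to
  \<open>v x\<close> by continuity.\<close>

lemma radial_superharmonic:
  fixes p :: "'a::euclidean_space" and D \<rho> \<Lambda> B :: real
    and Q q :: "real \<Rightarrow> real"
  assumes prof: "radial_profile Q q \<Lambda> B" and D: "0 < D"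
    and mono: "\<And>a b. 0 \<le> a \<Longrightarrow> a \<le> b \<Longrightarrow> Q b \<le> Q a"
    and lap: "\<And>t::real. t \<ge> 0 \<Longrightarrow> t \<noteq> \<rho>\<^sup>2 \<Longrightarrow>
      \<exists>q'. (q has_real_derivative q') (at t) \<and> DIM('a) * q t + 2 * t * q' \<le> 0"
  shows "bsuperharmonic (ball p D) (\<lambda>y. Q ((y - p) \<bullet> (y - p)))"
proof -
  interpret P: radial_profile Q q \<Lambda> B by (rule prof)
  define v where "v y = Q ((y - p) \<bullet> (y - p))" for y
  have dist_sq: "(y - p) \<bullet> (y - p) = (dist p y)\<^sup>2" for y
    by (metis dist_norm dist_commute power2_norm_eq_inner)
  have cont: "continuous_on UNIV v"
    unfolding v_def by (rule continuous_on_compose2[OF P.continuous_radial]) (auto intro!: continuous_intros)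
  have vm [measurable]: "v \<in> borel_measurable borel" by (rule borel_measurable_continuous_onI[OF cont])
  \<comment> \<open>By monotonicity \<open>v\<close> is extremal at the centre and at distance
    \<open>D + 2\<close>; the extra room contains all balls of radius at most 1 centred in
    \<open>ball p D\<close>.\<close>
  define M where "M = \<bar>Q 0\<bar> + \<bar>Q ((D + 2)\<^sup>2)\<bar>"
  have vM: "\<bar>v y\<bar> \<le> M" if "dist p y \<le> D + 2" for y
  proof -
    have "(dist p y)\<^sup>2 \<le> (D + 2)\<^sup>2" using that by (intro power_mono) auto
    then have "Q ((D + 2)\<^sup>2) \<le> v y" "v y \<le> Q 0" unfolding v_def dist_sq by (intro mono; simp)+
    then show ?thesis unfolding M_def by linarith
  qed
  define u where "u y = indicator (cball p (D + 2)) y * v y" for y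
  have um [measurable]: "u \<in> borel_measurable borel" unfolding u_def by measurable
  have M0: "0 \<le> M" by (simp add: M_def)
  have bu: "\<bar>u y\<bar> \<le> M" for y using vM[of y] M0 by (auto simp: u_def indicator_def)
  show ?thesis
    unfolding v_def[symmetric]
  proof (rule bsuperharmonicI[where B=M])
    show "\<bar>v y\<bar> \<le> M" if "y \<in> ball p D" for y using vM[of y] that by simp
    have "{y \<in> ball p D. a < v y} = ball p D \<inter> v -` {a<..}" for a by auto
    then show "open {y \<in> ball p D. a < v y}" for a
      using continuous_open_vimage[OF _ , of "{a<..}" v] cont
      by (auto simp: continuous_on_eq_continuous_at intro!: open_Int open_vimage)
    fix x and R :: real assume R: "0 < R" "cball x R \<subseteq> ball p D"
    have uv: "u y = v y" if "y \<in> cball x R" for y using that R by (force simp: u_def)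
    have bd_eq: "bdiff u s y = bdiff (\<lambda>y. Q (y \<bullet> y)) s (y - p)" if "y \<in> cball x R" "0 \<le> s" "s \<le> 1" for s y
    proof -
      have "bdiff u s y = bdiff v s y"
      proof (rule bdiff_local)
        fix z assume "z \<in> cball y s"
        moreover have "dist p y < D" using R that by force
        ultimately have "dist p z \<le> D + 2"
          using dist_triangle[of p z y] that by (simp add: dist_commute)
        then show "u z = v z" by (simp add: u_def)
      qed (rule that)
      then show ?thesis unfolding v_def using bdiff_translate[of "\<lambda>y. Q (y \<bullet> y)" p s y] by simp
    qed
    have avg: "(\<integral>y. indicator (cball x R) y * u y \<partial>lborel) / R ^ DIM('a) \<le> (\<integral>y. indicator (cball x r) y * u y \<partial>lborel) / r ^ DIM('a)"
      if r: "0 < r" "r < R" for r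
    proof (rule ball_average_decreasing[OF r zero_less_one order_refl um bu,
          where C="(B + \<Lambda> * (2 * D + 1)\<^sup>2) * measure lborel (cball (0::'a) 1)"])
      fix k y assume y: "y \<in> cball x R"
      let ?s = "1 / real (Suc k)"
      have s: "0 < ?s" "?s \<le> 1" by auto
      have "norm (y - p) \<le> D" using y R by (force simp: dist_norm norm_minus_commute)
      then have "(2 * norm (y - p) + 1)\<^sup>2 \<le> (2 * D + 1)\<^sup>2" by (intro power_mono) auto
      have "bdiff u ?s y \<le> ?s\<^sup>2 * ((B + \<Lambda> * (2 * norm (y - p) + 1)\<^sup>2) * measure lborel (cball (0::'a) 1))"
        unfolding bd_eq[OF y less_imp_le[OF s(1)] s(2)] using P.bdiff_radial_bound[OF s, of "y - p"] by linarith
      also have "\<dots> \<le> ?s\<^sup>2 * ((B + \<Lambda> * (2 * D + 1)\<^sup>2) * measure lborel (cball (0::'a) 1))"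
        using \<open>(2 * norm (y - p) + 1)\<^sup>2 \<le> (2 * D + 1)\<^sup>2\<close> P.Lambda_nonneg
        by (intro mult_left_mono mult_right_mono add_left_mono) auto
      finally show "bdiff u ?s y / ?s\<^sup>2 \<le> (B + \<Lambda> * (2 * D + 1)\<^sup>2) * measure lborel (cball (0::'a) 1)"
        using s by (simp add: divide_le_eq mult.commute)
    next
      obtain \<kappa> :: real where \<kappa>: "\<kappa> > 0"
        "\<And>a::'a. (\<integral>z. indicator (cball 0 1) z * (a \<bullet> z)\<^sup>2 \<partial>lborel) = \<kappa> * (a \<bullet> a)"
        "(\<integral>z. indicator (cball (0::'a) 1) z * (z \<bullet> z) \<partial>lborel) = \<kappa> * DIM('a)"
        "\<And>a::'a. (\<integral>z. indicator (cball 0 1) z * (a \<bullet> z) \<partial>lborel) = 0"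
        by (rule second_moments_cball[where 'a='a]) (rule that)
      have s0: "(\<lambda>k. 1 / real (Suc k)) \<longlonglongrightarrow> 0" by real_asymp
      show "AE y in lborel. y \<in> cball x R \<longrightarrow> (\<lambda>k. max 0 (bdiff u (1 / real (Suc k)) y / (1 / real (Suc k))\<^sup>2)) \<longlonglongrightarrow> 0"
        using AE_lborel_sphere[of p "\<bar>\<rho>\<bar>"]
      proof eventually_elim
        case (elim y)
        show ?case
        proof
          assume y: "y \<in> cball x R"
          let ?t = "(y - p) \<bullet> (y - p)"
          have "?t \<noteq> \<rho>\<^sup>2"
          proof
            assume "?t = \<rho>\<^sup>2"
            then have "(dist p y)\<^sup>2 = \<bar>\<rho>\<bar>\<^sup>2" by (simp add: dist_sq)
            then have "dist p y = \<bar>\<rho>\<bar>" by (rule power2_eq_imp_eq) auto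
            with elim show False by simp
          qed
          then obtain q' where q': "(q has_real_derivative q') (at ?t)" "DIM('a) * q ?t + 2 * ?t * q' \<le> 0"
            using lap[of ?t] by auto
          have "(\<lambda>k. bdiff (\<lambda>y. Q (y \<bullet> y)) (1 / real (Suc k)) (y - p) / (1 / real (Suc k))\<^sup>2)
              \<longlonglongrightarrow> \<kappa> * (DIM('a) * q ?t + 2 * ?t * q')"
            by (rule P.bdiff_radial_limit[OF q'(1) \<kappa>(2,3) _ _ s0]) auto
          moreover have "bdiff u (1 / real (Suc k)) y = bdiff (\<lambda>y. Q (y \<bullet> y)) (1 / real (Suc k)) (y - p)" for k
            by (rule bd_eq[OF y]) auto
          ultimately have "(\<lambda>k. max 0 (bdiff u (1 / real (Suc k)) y / (1 / real (Suc k))\<^sup>2))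
              \<longlonglongrightarrow> max 0 (\<kappa> * (DIM('a) * q ?t + 2 * ?t * q'))"
            by (intro tendsto_max tendsto_const) simp
          moreover have "\<kappa> * (DIM('a) * q ?t + 2 * ?t * q') \<le> 0" using q'(2) \<kappa>(1) by (simp add: mult_le_0_iff)
          ultimately show "(\<lambda>k. max 0 (bdiff u (1 / real (Suc k)) y / (1 / real (Suc k))\<^sup>2)) \<longlonglongrightarrow> 0"
            by (simp only: max_absorb1)
        qed
      qed
    qed
    have "(\<integral>y. indicator (cball x R) y * u y \<partial>lborel) / R ^ DIM('a) \<le> v x * unit_ball_vol DIM('a)"
    proof (rule field_le_epsilon)
      fix e :: real assume e: "0 < e"
      define e' where "e' = e / unit_ball_vol DIM('a)"
      have ub: "unit_ball_vol DIM('a) > 0" by simp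
      have e': "e' > 0" using e ub by (simp add: e'_def)
      have "isCont v x" using cont by (simp add: continuous_on_eq_continuous_at)
      then obtain d where d: "d > 0" "\<And>y. dist y x < d \<Longrightarrow> dist (v y) (v x) < e'"
        using e' unfolding continuous_at_eps_delta by blast
      define r where "r = min (R / 2) (d / 2)"
      have r: "0 < r" "r < R" "r < d" using R d(1) by (auto simp: r_def min_def)
      have "(\<integral>y. indicator (cball x r) y * u y \<partial>lborel) \<le> (\<integral>y. indicator (cball x r) y * (v x + e') \<partial>lborel)"
      proof (rule integral_mono)
        show "integrable lborel (\<lambda>y. indicator (cball x r) y * u y)"
          using bu by (intro integrable_cball_bounded[where B=M]) auto
        show "integrable lborel (\<lambda>y. indicator (cball x r) y * (v x + e'))"
          by (rule integrable_cball_bounded[where B="\<bar>v x + e'\<bar>"]) auto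
        fix y
        show "indicator (cball x r) y * u y \<le> indicator (cball x r) y * (v x + e')"
        proof (cases "y \<in> cball x r")
          case True
          then have "dist y x < d" "u y = v y" using r by (auto simp: dist_commute intro!: uv)
          then show ?thesis using d(2)[of y] True by (simp add: dist_real_def)
        qed simp
      qed
      also have "\<dots> = (v x + e') * (unit_ball_vol DIM('a) * r ^ DIM('a))" using r by (simp add: content_cball)
      finally have "(\<integral>y. indicator (cball x r) y * u y \<partial>lborel) / r ^ DIM('a) \<le> (v x + e') * unit_ball_vol DIM('a)"
        using r by (simp add: divide_le_eq mult.assoc)
      also have "e' * unit_ball_vol DIM('a) = e" unfolding e'_def using less_imp_neq[OF ub] by (intro nonzero_eq_divide_eq[THEN iffD1] refl) simp
      then have "(v x + e') * unit_ball_vol DIM('a) = v x * unit_ball_vol DIM('a) + e" by (simp add: distrib_right)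
      finally show "(\<integral>y. indicator (cball x R) y * u y \<partial>lborel) / R ^ DIM('a) \<le> v x * unit_ball_vol DIM('a) + e"
        using avg[OF r(1,2)] by simp
    qed
    moreover have "(\<integral>y. indicator (cball x R) y * u y \<partial>lborel) = (\<integral>y. indicator (cball x R) y * v y \<partial>lborel)"
      by (rule Bochner_Integration.integral_cong[OF refl]) (auto simp: indicator_def uv)
    ultimately show "(\<integral>y. indicator (cball x R) y * v y \<partial>lborel) \<le> v x * measure lborel (cball x R)"
      using R by (simp add: content_cball divide_le_eq mult.assoc)
  qed simp
qed

text \<open>A multiple of the potential of a mass spread over a tiny ball about \<open>p\<close>,
  normalised to vanish at distance \<open>D\<close>. Its value at \<open>x\<close> is bounded
  independently of the radius \<open>r\<close> of that ball, while near \<open>p\<close> it exceeds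
  a multiple of \<open>ln (D\<^sup>2) - ln (r\<^sup>2)\<close>; so the factor \<open>m\<close> is
  fixed first and \<open>r\<close> afterwards. The logarithm is the right order in dimension two and
  a weaker but sufficient bound in higher dimensions.\<close>

lemma polar_function:
  fixes p x :: "'a::euclidean_space"
  assumes dim: "DIM('a) \<ge> 2" and xp: "x \<noteq> p" and D: "dist p x < D" and e: "\<epsilon> > 0"
  obtains v \<delta> where "\<delta> > 0" "bsuperharmonic (ball p D) v" "\<And>y. y \<in> ball p D \<Longrightarrow> 0 \<le> v y"
    "\<And>y. y \<in> ball p \<delta> \<Longrightarrow> L \<le> v y" "v x \<le> \<epsilon>"
proof -
  let ?n = "real DIM('a)"
  define d where "d = dist p x"
  have d: "0 < d" "d < D" using xp D by (auto simp: d_def)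
  have D0: "D > 0" using d by simp
  \<comment> \<open>Between \<open>d\<close> and \<open>D\<close> the slope of \<open>Q\<close> is
    at most \<open>1 / 2 * (d\<^sup>2) powr - (?n / 2)\<close> in absolute value, so
    \<open>Cd\<close> bounds \<open>Q (d\<^sup>2)\<close> whatever \<open>r < d\<close> is.\<close>
  define Cd where "Cd = 1 / 2 * (d\<^sup>2) powr - (?n / 2) * D\<^sup>2"
  have Cd: "Cd > 0" using d D0 by (simp add: Cd_def)
  define m where "m = \<epsilon> / Cd"
  have m: "m > 0" using e Cd by (simp add: m_def)
  \<comment> \<open>For \<open>t \<le> D\<^sup>2\<close> this gives
    \<open>c / t \<le> 1 / 2 * t powr - (?n / 2)\<close>. Dimension at least two enters here: the
    exponent \<open>1 - ?n / 2\<close> has to be nonpositive.\<close>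
  define c where "c = 1 / 2 * (D\<^sup>2) powr (1 - ?n / 2)"
  have c: "c > 0" using D0 by (simp add: c_def)
  \<comment> \<open>The second bound is
    \<open>L \<le> m * (c * (ln (D\<^sup>2) - ln (r\<^sup>2)))\<close> solved for \<open>r\<close>;
    the first keeps \<open>x\<close> outside the ball carrying the mass.\<close>
  define r where "r = min (d / 2) (sqrt (exp (ln (D\<^sup>2) - L / (m * c))))"
  have r: "0 < r" "r < d" using d by (auto simp: r_def min_def)
  have "r\<^sup>2 \<le> (sqrt (exp (ln (D\<^sup>2) - L / (m * c))))\<^sup>2"
    using r by (intro power_mono) (auto simp: r_def)
  then have "r\<^sup>2 \<le> exp (ln (D\<^sup>2) - L / (m * c))" by simp
  then have "ln (r\<^sup>2) \<le> ln (exp (ln (D\<^sup>2) - L / (m * c)))"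
    using zero_less_power[OF r(1), of 2] by (subst ln_le_cancel_iff) auto
  then have "L / (m * c) \<le> ln (D\<^sup>2) - ln (r\<^sup>2)" by simp
  then have "L \<le> (ln (D\<^sup>2) - ln (r\<^sup>2)) * (m * c)"
    using mult_pos_pos[OF m c] by (simp only: pos_divide_le_eq)
  then have lnr: "L \<le> m * (c * (ln (D\<^sup>2) - ln (r\<^sup>2)))" by (simp only: mult_ac)
  have sq: "0 < r\<^sup>2" "r\<^sup>2 < d\<^sup>2" "d\<^sup>2 < D\<^sup>2"
    using r d by (auto intro!: power_strict_mono)
  define \<eta> where "\<eta> = cut_powr r ?n"
  note \<eta> = cut_powr[OF r(1) of_nat_0_le_iff[of "DIM('a)"], folded \<eta>_def]
  have eta_eq: "\<eta> t = t powr - (?n / 2)" if "r\<^sup>2 \<le> t" for t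
    using that by (simp add: \<eta>_def cut_powr_def max_absorb2)
  define q where "q t = - (1 / 2) * \<eta> t" for t
  have contq: "continuous_on UNIV q" unfolding q_def by (intro continuous_intros \<eta>(1))
  obtain Q where Q: "\<And>t. t \<ge> 0 \<Longrightarrow> (Q has_real_derivative q t) (at t)" "Q (D\<^sup>2) = 0"
    using antiderivative_halfline[OF contq] by blast
  have prof: "radial_profile Q q (?n / 2 * (r\<^sup>2) powr (- (?n / 2) - 1)) ((r\<^sup>2) powr (- (?n / 2)))"
  proof
    fix s t
    have "q s - q t = - (1 / 2) * (\<eta> s - \<eta> t)" unfolding q_def by (simp only: right_diff_distrib)
    then have "\<bar>q s - q t\<bar> = 1 / 2 * \<bar>\<eta> s - \<eta> t\<bar>" by (simp add: abs_mult)
    then have "\<bar>q s - q t\<bar> \<le> \<bar>\<eta> s - \<eta> t\<bar>" by (simp only:) simp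
    then show "\<bar>q s - q t\<bar> \<le> ?n / 2 * (r\<^sup>2) powr (- (?n / 2) - 1) * \<bar>s - t\<bar>"
      using \<eta>(2)[of s t] by (rule order_trans)
    show "\<bar>q t\<bar> \<le> (r\<^sup>2) powr (- (?n / 2))" using \<eta>(3,4)[of t] by (simp add: q_def)
  qed (rule Q)
  have mono: "Q b \<le> Q a" if "0 \<le> a" "a \<le> b" for a b
    by (rule antiderivative_nonincreasing[OF Q(1) _ that]) (simp_all add: q_def \<eta>(3))
  have sh: "bsuperharmonic (ball p D) (\<lambda>y. Q ((y - p) \<bullet> (y - p)))"
  proof (rule radial_superharmonic[OF prof D0 mono, where \<rho>=r])
    fix t :: real assume t: "t \<ge> 0" "t \<noteq> r\<^sup>2"
    show "\<exists>q'. (q has_real_derivative q') (at t) \<and> DIM('a) * q t + 2 * t * q' \<le> 0"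
    proof (cases "t < r\<^sup>2")
      case True
      have "(q has_real_derivative 0) (at t)"
        unfolding q_def using \<eta>(5)[OF True] by (auto intro!: derivative_eq_intros)
      moreover have "DIM('a) * q t \<le> 0" using \<eta>(3)[of t] by (simp add: q_def mult_le_0_iff)
      ultimately show ?thesis by (intro exI[of _ 0]) simp
    next
      case False
      then have t: "r\<^sup>2 < t" "t > 0" using t sq by linarith+
      let ?q' = "?n / 4 * t powr (- (?n / 2) - 1)"
      have 1: "(q has_real_derivative ?q') (at t)"
        unfolding q_def using \<eta>(6)[OF t(1)] by (auto intro!: derivative_eq_intros)
      have "t * t powr (- (?n / 2) - 1) = t powr - (?n / 2)" using t(2) by (simp add: powr_diff)
      then have E: "2 * t * ?q' = ?n / 2 * t powr - (?n / 2)" by (simp add: algebra_simps)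
      have "DIM('a) * q t + 2 * t * ?q' = 0"
        unfolding E q_def eta_eq[OF less_imp_le[OF t(1)]] by simp
      then show ?thesis using 1 by (intro exI[of _ ?q']) simp
    qed
  qed
  have Qr: "Q (r\<^sup>2) \<ge> c * (ln (D\<^sup>2) - ln (r\<^sup>2))"
  proof -
    \<comment> \<open>\<open>c * ln t\<close> grows no faster than \<open>Q\<close> falls, so
      \<open>F\<close> is nonincreasing; comparing its values at the two ends bounds
      \<open>Q (r\<^sup>2)\<close> from below.\<close>
    define F where "F t = Q t + c * ln t" for t
    have "F (D\<^sup>2) \<le> F (r\<^sup>2)"
    proof (rule DERIV_nonpos_imp_nonincreasing[where a="r\<^sup>2" and b="D\<^sup>2" and f=F])
      show "r\<^sup>2 \<le> D\<^sup>2" using sq by simp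
      fix t assume t: "r\<^sup>2 \<le> t" "t \<le> D\<^sup>2"
      then have t0: "t > 0" using sq by linarith
      have "(F has_real_derivative (q t + c * (1 / t))) (at t)"
        unfolding F_def using Q(1)[of t] t0 by (auto intro!: derivative_eq_intros)
      moreover have "c * (1 / t) \<le> 1 / 2 * \<eta> t"
      proof -
        have "(D\<^sup>2) powr (1 - ?n / 2) \<le> t powr (1 - ?n / 2)"
          using dim t t0 by (intro powr_mono2') auto
        also have "\<dots> = t * t powr - (?n / 2)" using powr_mult_base[of t "- (?n / 2)"] t0 by simp
        finally have "(D\<^sup>2) powr (1 - ?n / 2) / t \<le> t powr - (?n / 2)"
          using t0 by (simp only: pos_divide_le_eq mult.commute)
        then show ?thesis unfolding c_def eta_eq[OF t(1)] by simp
      qed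
      ultimately show "\<exists>y. (F has_real_derivative y) (at t) \<and> y \<le> 0"
        by (intro exI[of _ "q t + c * (1 / t)"]) (simp add: q_def)
    qed
    then show ?thesis using Q(2) by (simp add: F_def algebra_simps)
  qed
  have Qd: "Q (d\<^sup>2) \<le> Cd"
  proof -
    define F where "F t = - Q t - 1 / 2 * (d\<^sup>2) powr - (?n / 2) * t" for t
    have "F (D\<^sup>2) \<le> F (d\<^sup>2)"
    proof (rule DERIV_nonpos_imp_nonincreasing[where a="d\<^sup>2" and b="D\<^sup>2" and f=F])
      show "d\<^sup>2 \<le> D\<^sup>2" using sq by simp
      fix t assume t: "d\<^sup>2 \<le> t" "t \<le> D\<^sup>2"
      then have t0: "t > 0" "r\<^sup>2 \<le> t" using sq by linarith+
      have "(F has_real_derivative (- q t - 1 / 2 * (d\<^sup>2) powr - (?n / 2))) (at t)"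
        unfolding F_def using Q(1)[of t] t0 by (auto intro!: derivative_eq_intros)
      moreover have "\<eta> t \<le> (d\<^sup>2) powr - (?n / 2)"
        unfolding eta_eq[OF t0(2)] using t d by (intro powr_mono2') auto
      ultimately show "\<exists>y. (F has_real_derivative y) (at t) \<and> y \<le> 0"
        by (intro exI[of _ "- q t - 1 / 2 * (d\<^sup>2) powr - (?n / 2)"]) (simp add: q_def)
    qed
    then have "Q (d\<^sup>2) \<le> 1 / 2 * (d\<^sup>2) powr - (?n / 2) * D\<^sup>2 - 1 / 2 * (d\<^sup>2) powr - (?n / 2) * d\<^sup>2"
      using Q(2) by (simp add: F_def)
    also have "\<dots> \<le> Cd" by (simp add: Cd_def)
    finally show ?thesis .
  qed
  have dist_sq: "(y - p) \<bullet> (y - p) = (dist p y)\<^sup>2" for y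
    by (metis dist_norm dist_commute power2_norm_eq_inner)
  show thesis
  proof (rule that[of r "\<lambda>y. m * Q ((y - p) \<bullet> (y - p))"])
    show "bsuperharmonic (ball p D) (\<lambda>y. m * Q ((y - p) \<bullet> (y - p)))" using bsuperharmonic_scale[OF sh] m by simp
    show "0 \<le> m * Q ((y - p) \<bullet> (y - p))" if "y \<in> ball p D" for y
    proof -
      have "(dist p y)\<^sup>2 \<le> D\<^sup>2" using that by (intro power_mono) auto
      then have "Q (D\<^sup>2) \<le> Q ((dist p y)\<^sup>2)" by (intro mono) auto
      then show ?thesis using m Q(2) by (simp add: dist_sq)
    qed
    show "L \<le> m * Q ((y - p) \<bullet> (y - p))" if "y \<in> ball p r" for y
    proof -
      have "(dist p y)\<^sup>2 \<le> r\<^sup>2" using that by (intro power_mono) auto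
      then have "Q (r\<^sup>2) \<le> Q ((dist p y)\<^sup>2)" by (intro mono) auto
      then have "c * (ln (D\<^sup>2) - ln (r\<^sup>2)) \<le> Q ((dist p y)\<^sup>2)" using Qr by linarith
      then have "m * (c * (ln (D\<^sup>2) - ln (r\<^sup>2))) \<le> m * Q ((dist p y)\<^sup>2)" using m by (intro mult_left_mono) auto
      then show ?thesis using lnr by (simp only: dist_sq)
    qed
    have "m * Q (d\<^sup>2) \<le> m * Cd" using Qd m by (intro mult_left_mono) auto
    also have "\<dots> = \<epsilon>" using Cd by (simp add: m_def)
    finally show "m * Q ((x - p) \<bullet> (x - p)) \<le> \<epsilon>" by (simp add: dist_sq d_def)
  qed (rule r)
qed

section \<open>Truncations and supports\<close>

lemma superharmonic_on_open:
  assumes "superharmonic_on U f"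
  shows "open U" "open {y\<in>U. a < f y}"
proof -
  show U: "open U" using assms by (simp add: superharmonic_on_def)
  have lsc: "\<forall>x\<in>U. \<forall>a. a < f x \<longrightarrow> (\<exists>e>0. \<forall>y\<in>ball x e. a < f y)"
    using assms by (simp add: superharmonic_on_def)
  show "open {y\<in>U. a < f y}"
  proof (rule openI)
    fix x assume x: "x \<in> {y\<in>U. a < f y}"
    then obtain e where e: "e > 0" "\<forall>y\<in>ball x e. a < f y"
      using lsc by blast
    obtain d where d: "d > 0" "ball x d \<subseteq> U" using U x openE by blast
    show "\<exists>e>0. ball x e \<subseteq> {y\<in>U. a < f y}"
    proof (intro exI conjI subsetI)
      fix y assume "y \<in> ball x (min d e)"
      then have "y \<in> ball x d" "y \<in> ball x e" by auto
      then show "y \<in> {y\<in>U. a < f y}" using e(2) d(2) by blast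
    qed (use d(1) e(1) in simp)
  qed
qed

lemma superharmonic_on_bounded_below:
  assumes f: "superharmonic_on U f" and C: "compact C" "C \<subseteq> U"
  obtains c :: real where "\<And>y. y \<in> C \<Longrightarrow> ereal c < f y"
proof -
  have cover: "C \<subseteq> (\<Union>n::nat. {y\<in>U. ereal (- real n) < f y})"
  proof
    fix y assume y: "y \<in> C"
    then have "f y \<noteq> - \<infinity>" using f C by (auto simp: superharmonic_on_def)
    then obtain a :: real where a: "ereal a < f y"
      using ereal_dense2[of "- \<infinity>" "f y"] by (auto simp: less_ereal.simps)
    obtain n :: nat where "- a \<le> real n" using real_arch_simple by blast
    then have "ereal (- real n) \<le> ereal a" by simp
    then have "ereal (- real n) < f y" using a by (rule le_less_trans)
    then show "y \<in> (\<Union>n::nat. {y\<in>U. ereal (- real n) < f y})" using y C by auto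
  qed
  obtain N where N: "N \<subseteq> UNIV" "finite N" "C \<subseteq> (\<Union>n\<in>N. {y\<in>U. ereal (- real n) < f y})"
    by (rule compactE_image[OF C(1) _ cover]) (rule superharmonic_on_open(2)[OF f], rule that)
  \<comment> \<open>\<open>insert 0\<close> keeps \<open>Max\<close> meaningful when the subcover is
    empty.\<close>
  have "ereal (- real (Max (insert 0 N))) < f y" if y: "y \<in> C" for y
  proof -
    obtain n where n: "n \<in> N" "ereal (- real n) < f y" using N(3) y by auto
    then have "n \<le> Max (insert 0 N)" using N(2) by simp
    then have "ereal (- real (Max (insert 0 N))) \<le> ereal (- real n)" by simp
    then show ?thesis using n(2) by (rule le_less_trans)
  qed
  then show thesis using that by blast
qed

lemma bsuperharmonic_imp_superharmonic_on:
  assumes v: "bsuperharmonic W v"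
  shows "superharmonic_on W (\<lambda>y. ereal (v y))"
  unfolding superharmonic_on_def
proof (intro conjI ballI allI impI)
  show W: "open W" by (rule bsuperharmonicD(1)[OF v])
  show "\<exists>x\<in>C. ereal (v x) \<noteq> \<infinity>" if "C \<in> components W" for C
    using in_components_nonempty[OF that] by auto
  show "\<exists>e>0. \<forall>y\<in>ball x e. a < ereal (v y)" if x: "x \<in> W" "a < ereal (v x)" for x a
  proof (cases a)
    case (real b)
    then have "x \<in> {y\<in>W. b < v y}" using x by simp
    then obtain e where "e > 0" "ball x e \<subseteq> {y\<in>W. b < v y}"
      using bsuperharmonicD(3)[OF v, of b] openE by blast
    then show ?thesis using real by (intro exI[of _ e]) auto
  qed (use x in \<open>auto intro: zero_less_one\<close>)
  fix x r c
  assume *: "0 < r \<and> cball x r \<subseteq> W \<and> (\<forall>y\<in>cball x r. ereal c \<le> ereal (v y))"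
  then have r: "0 < r" "cball x r \<subseteq> W" and c: "\<And>y. y \<in> cball x r \<Longrightarrow> c \<le> v y" by auto
  have i: "integrable lborel (\<lambda>y. indicator (cball x r) y * v y - indicator (cball x r) y * c)"
    by (intro Bochner_Integration.integrable_diff bsuperharmonic_integrable[OF v r(2)] integrable_cball_bounded[where B="\<bar>c\<bar>"]) auto
  have "(\<integral>\<^sup>+ y. e2ennreal (ereal (v y) - ereal c) * indicator (cball x r) y \<partial>lborel)
     = (\<integral>\<^sup>+ y. ennreal (indicator (cball x r) y * v y - indicator (cball x r) y * c) \<partial>lborel)"
    by (rule nn_integral_cong) (auto simp: indicator_def)
  also have "\<dots> = ennreal (\<integral>y. indicator (cball x r) y * v y - indicator (cball x r) y * c \<partial>lborel)"
    by (rule nn_integral_eq_integral[OF i]) (use c in \<open>auto simp: indicator_def\<close>)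
  also have "(\<integral>y. indicator (cball x r) y * v y - indicator (cball x r) y * c \<partial>lborel)
     = (\<integral>y. indicator (cball x r) y * v y \<partial>lborel) - (\<integral>y. indicator (cball x r) y * c \<partial>lborel)"
    by (intro Bochner_Integration.integral_diff bsuperharmonic_integrable[OF v r(2)] integrable_cball_bounded[where B="\<bar>c\<bar>"]) auto
  also have "\<dots> \<le> (v x - c) * measure lborel (cball x r)"
    using bsuperharmonicD(4)[OF v r] by (simp add: left_diff_distrib)
  also have "ennreal ((v x - c) * measure lborel (cball x r)) = e2ennreal (ereal (v x) - ereal c) * emeasure lborel (cball x r)"
  proof -
    have em: "emeasure lborel (cball x r) = ennreal (measure lborel (cball x r))"
      by (rule emeasure_eq_ennreal_measure) (use emeasure_lborel_cball_finite[of x r] in simp)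
    show ?thesis unfolding em using c[of x] r by (simp add: ennreal_mult)
  qed
  finally show "(\<integral>\<^sup>+ y. e2ennreal (ereal (v y) - ereal c) * indicator (cball x r) y \<partial>lborel)
     \<le> e2ennreal (ereal (v x) - ereal c) * emeasure lborel (cball x r)"
    by (simp add: ennreal_leI)
qed auto

text \<open>Real-valued so that the bounded theory applies. Since \<open>real_of_ereal\<close> sends
  minus infinity to 0, the facts about it assume a finite lower bound for \<open>f\<close>.\<close>

definition trunc :: "('a \<Rightarrow> ereal) \<Rightarrow> real \<Rightarrow> 'a \<Rightarrow> real" where
  "trunc f L y = real_of_ereal (min (f y) (ereal L))"

lemma ereal_trunc:
  assumes "ereal c \<le> f y"
  shows "ereal (trunc f L y) = min (f y) (ereal L)" "trunc f L y \<le> L" "ereal (trunc f L y) \<le> f y"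
    "min c L \<le> trunc f L y"
proof -
  show 1: "ereal (trunc f L y) = min (f y) (ereal L)"
    using assms by (cases "f y") (auto simp: trunc_def min_def)
  have "ereal (min c L) \<le> f y" using order_trans[OF _ assms, of "ereal (min c L)"] by simp
  then have "ereal (trunc f L y) \<le> ereal L" "ereal (min c L) \<le> ereal (trunc f L y)"
    unfolding 1 by simp_all
  then show "trunc f L y \<le> L" "min c L \<le> trunc f L y" by (simp_all only: ereal_less_eq)
  show "ereal (trunc f L y) \<le> f y" unfolding 1 by simp
qed

text \<open>Both \<open>f\<close> and the constant \<open>L\<close> satisfy the super-mean value
  inequality; whichever is the smaller at the centre \<open>x\<close> supplies the bound.\<close>

lemma bsuperharmonic_trunc:
  assumes f: "superharmonic_on U f" and W: "open W" "W \<subseteq> U" and c: "\<And>y. y \<in> W \<Longrightarrow> ereal c \<le> f y"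
  shows "bsuperharmonic W (trunc f L)"
proof (rule bsuperharmonicI[where B="\<bar>c\<bar> + \<bar>L\<bar>"])
  note t = ereal_trunc[where f=f, OF c]
  show "\<bar>trunc f L y\<bar> \<le> \<bar>c\<bar> + \<bar>L\<bar>" if "y \<in> W" for y
    using t(2,4)[OF that, of L] by linarith
  show lsc: "open {y\<in>W. a < trunc f L y}" for a
  proof (cases "a < L")
    case True
    have "a < trunc f L y \<longleftrightarrow> ereal a < f y" if "y \<in> W" for y
    proof -
      have "a < trunc f L y \<longleftrightarrow> ereal a < min (f y) (ereal L)"
        by (simp only: t(1)[OF that, symmetric] less_ereal.simps)
      then show ?thesis using True by simp
    qed
    then have "{y\<in>W. a < trunc f L y} = W \<inter> {y\<in>U. ereal a < f y}" using W by auto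
    then show ?thesis using W superharmonic_on_open(2)[OF f] by auto
  next
    case False
    then have "{y\<in>W. a < trunc f L y} = {}" using t(2)[of _ L] by force
    then show ?thesis by (simp only: open_empty)
  qed
  fix x r assume r: "0 < (r::real)" "cball x r \<subseteq> W"
  \<comment> \<open>A common lower bound for \<open>f\<close> and its truncation, so that both
    integrands can be shifted by the same constant and compared as nonnegative functions.\<close>
  define c' where "c' = min c L"
  have xW: "x \<in> W" using r by auto
  have c': "c' \<le> trunc f L y" "ereal c' \<le> f y" if "y \<in> W" for y
    using t(4)[OF that, of L] c[OF that] by (auto simp: c'_def intro: order_trans[OF _ c[OF that]])
  have bnd: "\<bar>trunc f L y\<bar> \<le> \<bar>c\<bar> + \<bar>L\<bar>" if "y \<in> W" for y
    using t(2,4)[OF that, of L] by linarith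
  have [measurable]: "(\<lambda>y. indicator W y * trunc f L y) \<in> borel_measurable borel"
    by (rule lsc_borel[OF W(1) lsc])
  have eq: "(\<lambda>y. indicator (cball x r) y * trunc f L y) = (\<lambda>y. indicator (cball x r) y * (indicator W y * trunc f L y))"
    using r by (auto simp: fun_eq_iff indicator_def)
  have i0: "integrable lborel (\<lambda>y. indicator (cball x r) y * trunc f L y)"
  proof (rule integrable_cball_bounded[where B="\<bar>c\<bar> + \<bar>L\<bar>"])
    show "(\<lambda>y. indicator (cball x r) y * trunc f L y) \<in> borel_measurable borel" unfolding eq by measurable
  qed (use bnd r in blast)
  have i1: "integrable lborel (\<lambda>y. indicator (cball x r) y * c')"
    by (rule integrable_cball_bounded[where B="\<bar>c'\<bar>"]) auto
  have i: "integrable lborel (\<lambda>y. indicator (cball x r) y * trunc f L y - indicator (cball x r) y * c')"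
    by (rule Bochner_Integration.integrable_diff[OF i0 i1])
  let ?m = "measure lborel (cball x r)"
  have em: "emeasure lborel (cball x r) = ennreal ?m"
    by (rule emeasure_eq_ennreal_measure) (use emeasure_lborel_cball_finite[of x r] in simp)
  let ?J = "\<integral>y. indicator (cball x r) y * trunc f L y - indicator (cball x r) y * c' \<partial>lborel"
  have J: "?J = (\<integral>y. indicator (cball x r) y * trunc f L y \<partial>lborel) - c' * ?m"
    using Bochner_Integration.integral_diff[OF i0 i1] by (simp add: mult.commute)
  have nn: "(\<integral>\<^sup>+ y. ennreal (indicator (cball x r) y * trunc f L y - indicator (cball x r) y * c') \<partial>lborel) = ennreal ?J"
    by (rule nn_integral_eq_integral[OF i], rule AE_I2) (use c' r in \<open>auto simp: indicator_def\<close>)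
  have le1: "ennreal (indicator (cball x r) y * trunc f L y - indicator (cball x r) y * c')
      \<le> e2ennreal (f y - ereal c') * indicator (cball x r) y" for y
  proof (cases "y \<in> cball x r")
    case True
    then have y: "y \<in> W" using r by auto
    have "ennreal (trunc f L y - c') = e2ennreal (ereal (trunc f L y) - ereal c')" by simp
    also have "\<dots> \<le> e2ennreal (f y - ereal c')"
      by (intro e2ennreal_mono ereal_minus_mono t(3)[OF y]) simp
    finally show ?thesis using True by simp
  qed simp
  have "ennreal ?J \<le> (\<integral>\<^sup>+ y. e2ennreal (f y - ereal c') * indicator (cball x r) y \<partial>lborel)"
    unfolding nn[symmetric] by (rule nn_integral_mono) (rule le1)
  also have "\<dots> \<le> e2ennreal (f x - ereal c') * emeasure lborel (cball x r)"
    using f r W c'(2) unfolding superharmonic_on_def by (meson order_trans subsetD)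
  finally have f1: "ennreal ?J \<le> e2ennreal (f x - ereal c') * ennreal ?m" unfolding em .
  have f2: "?J \<le> (L - c') * ?m"
  proof -
    have "(\<integral>y. indicator (cball x r) y * trunc f L y \<partial>lborel) \<le> (\<integral>y. indicator (cball x r) y * L \<partial>lborel)"
    proof (rule integral_mono[OF i0])
      show "integrable lborel (\<lambda>y. indicator (cball x r) y * L)"
        by (rule integrable_cball_bounded[where B="\<bar>L\<bar>"]) auto
      show "indicator (cball x r) y * trunc f L y \<le> indicator (cball x r) y * L" for y
        using t(2)[of y L] r by (auto simp: indicator_def)
    qed
    then show ?thesis unfolding J by (simp add: left_diff_distrib mult.commute)
  qed
  have "?J \<le> (trunc f L x - c') * ?m"
  proof (cases "f x \<le> ereal L")
    case True
    then have eq: "ereal (trunc f L x) = f x" using t(1)[OF xW, of L] by (simp add: min_def)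
    have "ennreal ?J \<le> ennreal ((trunc f L x - c') * ?m)"
      using f1 c'(1)[OF xW] unfolding eq[symmetric] by (simp add: ennreal_mult)
    then show ?thesis using c'(1)[OF xW] by (simp add: ennreal_le_iff)
  next
    case False
    then have "ereal (trunc f L x) = ereal L" using t(1)[OF xW, of L] by (simp add: min_def)
    then show ?thesis using f2 by simp
  qed
  then show "(\<integral>y. indicator (cball x r) y * trunc f L y \<partial>lborel) \<le> trunc f L x * ?m"
    unfolding J by (simp add: left_diff_distrib)
qed (rule W(1))

section \<open>Supports of Borel measures and Jensen's inequality for bounded functions\<close>

text \<open>The complement of the support is a union of open null balls, and by Lindelof countably
  many of them suffice.\<close>

lemma msupp_null:
  fixes M :: "'a::euclidean_space measure"
  assumes M: "sets M = sets borel"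
  shows "closed (msupp M)" "emeasure M (- msupp M) = 0"
proof -
  define F where "F = {ball x e | x e. emeasure M (ball x e) = 0}"
  have eq: "- msupp M = \<Union>F"
  proof (intro set_eqI iffI)
    fix x assume "x \<in> - msupp M"
    then obtain e where "e > 0" "emeasure M (ball x e) = 0"
      by (auto simp: msupp_def zero_less_iff_neq_zero)
    then show "x \<in> \<Union>F" unfolding F_def using centre_in_ball by blast
  next
    fix x assume "x \<in> \<Union>F"
    then obtain y e where ye: "x \<in> ball y e" "emeasure M (ball y e) = 0" unfolding F_def by blast
    then obtain d where d: "d > 0" "ball x d \<subseteq> ball y e" using openE[OF open_ball] by blast
    then have "emeasure M (ball x d) \<le> emeasure M (ball y e)"
      by (intro emeasure_mono) (auto simp: M)
    then have "emeasure M (ball x d) = 0" using ye(2) by simp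
    then show "x \<in> - msupp M" using d(1) by (auto simp: msupp_def zero_less_iff_neq_zero)
  qed
  have op: "\<And>S. S \<in> F \<Longrightarrow> open S" unfolding F_def by auto
  then have "open (- msupp M)" unfolding eq by auto
  then show "closed (msupp M)" by (simp add: closed_def)
  obtain F' where F': "F' \<subseteq> F" "countable F'" "\<Union>F' = \<Union>F" by (rule Lindelof[of F], erule op, rule that)
  have "\<Union>F' \<in> null_sets M"
  proof -
    have "(\<Union>S\<in>F'. S) \<in> null_sets M"
      using F'(1,2) by (intro null_sets_UN') (auto simp: F_def null_sets_def M)
    then show ?thesis by simp
  qed
  then show "emeasure M (- msupp M) = 0" unfolding eq F'(3) by (rule null_setsD1)
qed

lemma emeasure_msupp:
  fixes M :: "'a::euclidean_space measure"
  assumes M: "sets M = sets borel"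
  shows "emeasure M (msupp M) = emeasure M (space M)"
proof -
  have sp: "space M = UNIV" using sets_eq_imp_space_eq[OF M] by simp
  have "emeasure M (msupp M \<union> - msupp M) = emeasure M (msupp M)"
    using msupp_null[OF M] M by (intro emeasure_Un_null_set) (auto simp: null_sets_def)
  then show ?thesis by (simp add: sp)
qed

text \<open>\<open>integral_le\<close> speaks of a nonnegative integral shifted by a lower bound;
  for bounded integrands this converts it to a Bochner integral over the support.\<close>

lemma nn_integral_msupp:
  fixes M :: "'a::euclidean_space measure"
  assumes M: "sets M = sets borel" and fin: "emeasure M (space M) < \<infinity>"
    and gm: "(\<lambda>y. indicator (msupp M) y * g y) \<in> borel_measurable borel"
    and c: "\<And>y. y \<in> msupp M \<Longrightarrow> c \<le> g y" and B: "\<And>y. y \<in> msupp M \<Longrightarrow> \<bar>g y\<bar> \<le> B"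
  shows "(\<integral>\<^sup>+ y. ennreal (g y - c) * indicator (msupp M) y \<partial>M)
      = ennreal ((\<integral>y. indicator (msupp M) y * g y \<partial>M) - c * measure M (space M))"
    and "c * measure M (space M) \<le> (\<integral>y. indicator (msupp M) y * g y \<partial>M)"
    and "integrable M (\<lambda>y. indicator (msupp M) y * g y)"
proof -
  let ?S = "msupp M"
  have S: "?S \<in> sets M" using msupp_null(1)[OF M] M by simp
  have gM: "(\<lambda>y. indicator ?S y * g y) \<in> borel_measurable M" using gm measurable_cong_sets[OF M refl] by blast
  have finS: "emeasure M ?S < \<infinity>" using emeasure_msupp[OF M] fin by simp
  have i: "integrable M (\<lambda>y. indicator ?S y * h y)"
    if "(\<lambda>y. indicator ?S y * h y) \<in> borel_measurable M" "\<And>y. y \<in> ?S \<Longrightarrow> \<bar>h y\<bar> \<le> b" for h and b :: real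
  proof (rule Bochner_Integration.integrable_bound)
    show "integrable M (\<lambda>y. indicator ?S y * b)"
      by (intro integrable_mult_left integrable_real_indicator S finS)
    show "AE y in M. norm (indicator ?S y * h y) \<le> norm (indicator ?S y * b)"
    proof (rule AE_I2)
      fix y
      show "norm (indicator ?S y * h y) \<le> norm (indicator ?S y * b)"
        using that(2)[of y] by (cases "y \<in> ?S") auto
    qed
  qed (rule that(1))
  show ig: "integrable M (\<lambda>y. indicator ?S y * g y)" by (rule i[OF gM B])
  have ic: "integrable M (\<lambda>y. indicator ?S y * c)"
    by (intro integrable_mult_left integrable_real_indicator S finS)
  have cS: "(\<integral>y. indicator ?S y * c \<partial>M) = c * measure M (space M)"
    using emeasure_msupp[OF M] S by (simp add: measure_def mult.commute)
  have d: "(\<integral>y. indicator ?S y * g y - indicator ?S y * c \<partial>M) = (\<integral>y. indicator ?S y * g y \<partial>M) - c * measure M (space M)"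
    unfolding cS[symmetric] by (rule Bochner_Integration.integral_diff[OF ig ic])
  have nn: "0 \<le> indicator ?S y * g y - indicator ?S y * c" for y
    using c[of y] by (simp add: indicator_def)
  have "(\<integral>\<^sup>+ y. ennreal (g y - c) * indicator ?S y \<partial>M) = (\<integral>\<^sup>+ y. ennreal (indicator ?S y * g y - indicator ?S y * c) \<partial>M)"
    by (rule nn_integral_cong) (auto simp: indicator_def)
  also have "\<dots> = ennreal (\<integral>y. indicator ?S y * g y - indicator ?S y * c \<partial>M)"
    by (rule nn_integral_eq_integral[OF Bochner_Integration.integrable_diff[OF ig ic]]) (use nn in simp)
  finally show "(\<integral>\<^sup>+ y. ennreal (g y - c) * indicator ?S y \<partial>M)
      = ennreal ((\<integral>y. indicator ?S y * g y \<partial>M) - c * measure M (space M))" unfolding d .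
  have "0 \<le> (\<integral>y. indicator ?S y * g y - indicator ?S y * c \<partial>M)" by (rule integral_nonneg_AE) (use nn in simp)
  then show "c * measure M (space M) \<le> (\<integral>y. indicator ?S y * g y \<partial>M)" unfolding d by simp
qed

lemma integral_leD:
  fixes M :: "'a::euclidean_space measure"
  assumes M: "sets M = sets borel" and fin: "emeasure M (space M) < \<infinity>"
    and gm: "(\<lambda>y. indicator (msupp M) y * g y) \<in> borel_measurable borel"
    and B: "\<And>y. y \<in> msupp M \<Longrightarrow> \<bar>g y\<bar> \<le> B"
    and le: "integral_le M (\<lambda>y. ereal (g y)) (ereal v)"
  shows "(\<integral>y. indicator (msupp M) y * g y \<partial>M) \<le> v"
proof -
  obtain c where c: "\<And>y. y \<in> msupp M \<Longrightarrow> ereal c \<le> ereal (g y)"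
    "ereal c * ereal (measure M (space M))
        + enn2ereal (\<integral>\<^sup>+ y. e2ennreal (ereal (g y) - ereal c) * indicator (msupp M) y \<partial>M) \<le> ereal v"
    using le unfolding integral_le_def by blast
  have c1: "c \<le> g y" if "y \<in> msupp M" for y using c(1)[OF that] by simp
  note I = nn_integral_msupp[OF M fin gm c1 B]
  have "(\<integral>\<^sup>+ y. e2ennreal (ereal (g y) - ereal c) * indicator (msupp M) y \<partial>M)
     = ennreal ((\<integral>y. indicator (msupp M) y * g y \<partial>M) - c * measure M (space M))"
    using I(1) by simp
  then have "ereal (c * measure M (space M)) + ereal ((\<integral>y. indicator (msupp M) y * g y \<partial>M) - c * measure M (space M)) \<le> ereal v"
    using c(2) I(2) by (simp add: enn2ereal_ennreal)
  then show ?thesis by simp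
qed

text \<open>Monotone convergence along the truncation levels; since the mass is 1, shifting by
  \<open>c\<close> costs exactly \<open>c\<close>.\<close>

lemma integral_leI:
  fixes M :: "'a::euclidean_space measure"
  assumes M: "sets M = sets borel" and one: "emeasure M (space M) = 1"
    and c: "\<And>y. y \<in> msupp M \<Longrightarrow> ereal c \<le> f y" "ereal c \<le> v"
    and gm: "\<And>k::nat. (\<lambda>y. indicator (msupp M) y * trunc f k y) \<in> borel_measurable borel"
    and le: "\<And>k::nat. c \<le> k \<Longrightarrow> ereal (\<integral>y. indicator (msupp M) y * trunc f k y \<partial>M) \<le> v"
  shows "integral_le M f v"
  unfolding integral_le_def
proof (intro exI[of _ c] conjI ballI)
  show "ereal c \<le> f y" if "y \<in> msupp M" for y by (rule c(1)[OF that])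
  let ?S = "msupp M"
  have fin: "emeasure M (space M) < \<infinity>" using one by simp
  have one': "measure M (space M) = 1" using one by (simp add: measure_def)
  show "ereal c * ereal (measure M (space M)) + enn2ereal (\<integral>\<^sup>+ y. e2ennreal (f y - ereal c) * indicator ?S y \<partial>M) \<le> v"
  proof (cases v)
    case (real w)
    \<comment> \<open>Levels start above \<open>c\<close>, so that
      \<open>trunc f (N + k) y - c\<close> is nonnegative on the support and \<open>ennreal\<close>
      clips nothing.\<close>
    obtain N :: nat where N: "c \<le> real N" using real_arch_simple by blast
    have cw: "c \<le> w" using c(2) real by simp
    define u where "u k y = ennreal (trunc f (N + k) y - c) * indicator ?S y" for k y
    have um: "u k \<in> borel_measurable M" for k
    proof -
      have S [measurable]: "?S \<in> sets borel" using msupp_null(1)[OF M] by simp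
      note gm[measurable]
      have "u k = (\<lambda>y. ennreal (indicator ?S y * trunc f (N + k) y - c) * indicator ?S y)"
        by (auto simp: u_def fun_eq_iff indicator_def)
      also have "\<dots> \<in> borel_measurable borel" using gm[of "N + k"] by measurable
      finally show ?thesis using measurable_cong_sets[OF M refl] by blast
    qed
    have tr: "ereal (trunc f k y) = min (f y) (ereal k)" if "y \<in> ?S" for k :: real and y
      by (rule ereal_trunc(1)[where f=f, OF c(1)[OF that]])
    have inc: "incseq u"
    proof (rule incseq_SucI, rule le_funI)
      fix k y
      show "u k y \<le> u (Suc k) y"
      proof (cases "y \<in> ?S")
        case True
        have "ereal (trunc f (N + k) y) \<le> ereal (trunc f (N + Suc k) y)"
          unfolding tr[OF True] by (intro min.mono) auto
        then show ?thesis using True by (simp add: u_def ennreal_leI)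
      qed (simp add: u_def)
    qed
    have lim: "(\<lambda>k. u k y) \<longlonglongrightarrow> e2ennreal (f y - ereal c) * indicator ?S y" for y
    proof (cases "y \<in> ?S")
      case True
      show ?thesis
      proof (cases "f y")
        case (real a)
        obtain m :: nat where m: "a \<le> real m" using real_arch_simple by blast
        have "u k y = e2ennreal (f y - ereal c) * indicator ?S y" if "k \<ge> m" for k
        proof -
          have "ereal (trunc f (N + k) y) = ereal a"
            unfolding tr[OF True] real using m that by (simp add: min_def)
          then show ?thesis using True real by (simp add: u_def)
        qed
        then show ?thesis by (intro tendsto_eventually) (auto simp: eventually_sequentially)
      next
        case PInf
        have T: "trunc f (real N + real k) y = real N + real k" for k
          using tr[OF True, of "real N + real k"] PInf by simp
        have "u k y = ennreal (real N - c + real k)" for k using True by (simp add: u_def T diff_add_eq)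
        moreover have "(\<lambda>k. ennreal (real N - c + real k)) \<longlonglongrightarrow> \<infinity>"
        proof -
          have "filterlim (\<lambda>k. real N - c + real k) at_top sequentially" by real_asymp
          then show ?thesis by (simp add: ennreal_tendsto_top_eq_at_top)
        qed
        ultimately show ?thesis using True PInf by simp
      next
        case MInf
        then show ?thesis using c(1)[OF True] by simp
      qed
    qed (simp add: u_def)
    have int: "(\<integral>\<^sup>+ y. u k y \<partial>M) \<le> ennreal (w - c)" for k
    proof -
      have cN: "c \<le> real (N + k)" using N by simp
      have t: "c \<le> trunc f (N + k) y" "\<bar>trunc f (N + k) y\<bar> \<le> \<bar>c\<bar> + real (N + k)" if "y \<in> ?S" for y
        using ereal_trunc(2,4)[where f=f, OF c(1)[OF that], of "real (N + k)"] cN by auto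
      have "(\<integral>\<^sup>+ y. u k y \<partial>M) = ennreal ((\<integral>y. indicator ?S y * trunc f (N + k) y \<partial>M) - c * measure M (space M))"
        unfolding u_def by (rule nn_integral_msupp(1)[OF M fin gm t])
      also have "\<dots> \<le> ennreal (w - c)"
        using le[OF cN] real one' by (intro ennreal_leI) simp
      finally show ?thesis .
    qed
    have "(\<lambda>k. \<integral>\<^sup>+ y. u k y \<partial>M) \<longlonglongrightarrow> (\<integral>\<^sup>+ y. e2ennreal (f y - ereal c) * indicator ?S y \<partial>M)"
      by (rule nn_integral_LIMSEQ[OF inc um lim])
    then have "(\<integral>\<^sup>+ y. e2ennreal (f y - ereal c) * indicator ?S y \<partial>M) \<le> ennreal (w - c)"
      by (rule LIMSEQ_le_const2) (use int in auto)
    then have "enn2ereal (\<integral>\<^sup>+ y. e2ennreal (f y - ereal c) * indicator ?S y \<partial>M) \<le> ereal (w - c)"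
      using cw by (metis diff_ge_0_iff_ge enn2ereal_ennreal less_eq_ennreal.rep_eq)
    then have "ereal c + enn2ereal (\<integral>\<^sup>+ y. e2ennreal (f y - ereal c) * indicator ?S y \<partial>M) \<le> ereal c + ereal (w - c)"
      by (rule add_left_mono)
    then show ?thesis using one' real by simp
  qed (use c(2) in auto)
qed

lemma jensen_dom_facts:
  fixes M :: "'a::euclidean_space measure"
  assumes J: "M \<in> jensen_dom x W" and W: "domain_set W"
  shows "sets M = sets borel" "compact (msupp M)" "msupp M \<subseteq> W" "emeasure M (space M) = 1"
    "\<And>g. bsuperharmonic W g \<Longrightarrow> (\<integral>y. indicator (msupp M) y * g y \<partial>M) \<le> g x"
proof -
  show M: "sets M = sets borel" and cp: "compact (msupp M)" and sub: "msupp M \<subseteq> W"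
    using J by (auto simp: jensen_dom_def radon_cpt_in_def)
  have fin: "emeasure M (space M) < \<infinity>"
    using J cp unfolding emeasure_msupp[OF M, symmetric] jensen_dom_def radon_cpt_in_def by blast
  show main: "(\<integral>y. indicator (msupp M) y * g y \<partial>M) \<le> g x" if g: "bsuperharmonic W g" for g
  proof -
    obtain B where B: "\<And>y. y \<in> W \<Longrightarrow> \<bar>g y\<bar> \<le> B" using bsuperharmonicD(2)[OF g] by blast
    have [measurable]: "(\<lambda>y. indicator W y * g y) \<in> borel_measurable borel"
      by (rule lsc_borel[OF bsuperharmonicD(1,3)[OF g]])
    have S [measurable]: "msupp M \<in> sets borel" using cp by (simp add: compact_imp_closed)
    have eq: "(\<lambda>y. indicator (msupp M) y * g y) = (\<lambda>y. indicator (msupp M) y * (indicator W y * g y))"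
      using sub by (auto simp: fun_eq_iff indicator_def)
    have gm: "(\<lambda>y. indicator (msupp M) y * g y) \<in> borel_measurable borel" unfolding eq by measurable
    have "integral_le M (\<lambda>y. ereal (g y)) (ereal (g x))"
      using J bsuperharmonic_imp_superharmonic_on[OF g] by (auto simp: jensen_dom_def)
    then show ?thesis using sub by (intro integral_leD[OF M fin gm B]) auto
  qed
  have oW: "open W" using W by (simp add: domain_set_def)
  have S: "msupp M \<in> sets M" using cp M by (simp add: compact_imp_closed)
  have m: "(\<integral>y. indicator (msupp M) y * c \<partial>M) = measure M (space M) * c" for c :: real
    using S emeasure_msupp[OF M] by (simp add: measure_def)
  \<comment> \<open>The constants 1 and -1 are both superharmonic, which pins the total mass to
    1.\<close>
  have "measure M (space M) \<le> 1" using main[OF bsuperharmonic_const[OF oW, of 1]] m[of 1] by simp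
  moreover have "measure M (space M) \<ge> 1" using main[OF bsuperharmonic_const[OF oW, of "-1"]] m[of "-1"] by simp
  ultimately have "measure M (space M) = 1" by simp
  then show "emeasure M (space M) = 1"
    using fin by (simp add: emeasure_eq_ennreal_measure less_top)
qed

section \<open>A Hahn--Banach theorem on bounded functions\<close>

definition bdd_fun :: "('a \<Rightarrow> real) \<Rightarrow> bool" where
  "bdd_fun \<phi> \<longleftrightarrow> (\<exists>B. \<forall>y. \<bar>\<phi> y\<bar> \<le> B)"

lemma bdd_funI: "(\<And>y. \<bar>\<phi> y\<bar> \<le> B) \<Longrightarrow> bdd_fun \<phi>"
  by (auto simp: bdd_fun_def)

lemma bdd_fun_add: "bdd_fun \<phi> \<Longrightarrow> bdd_fun \<psi> \<Longrightarrow> bdd_fun (\<lambda>y. \<phi> y + \<psi> y)"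
proof -
  assume "bdd_fun \<phi>" "bdd_fun \<psi>"
  then obtain B C where "\<And>y. \<bar>\<phi> y\<bar> \<le> B" "\<And>y. \<bar>\<psi> y\<bar> \<le> C" unfolding bdd_fun_def by blast
  then have "\<bar>\<phi> y + \<psi> y\<bar> \<le> B + C" for y by (metis abs_triangle_ineq add_mono order_trans)
  then show ?thesis by (rule bdd_funI)
qed

lemma bdd_fun_scale: "bdd_fun \<phi> \<Longrightarrow> bdd_fun (\<lambda>y. c * \<phi> y)"
proof -
  assume "bdd_fun \<phi>"
  then obtain B where "\<And>y. \<bar>\<phi> y\<bar> \<le> B" unfolding bdd_fun_def by blast
  then have "\<bar>c * \<phi> y\<bar> \<le> \<bar>c\<bar> * B" for y by (simp add: abs_mult mult_left_mono)
  then show ?thesis by (rule bdd_funI)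
qed

lemma bdd_fun_const: "bdd_fun (\<lambda>_. c)"
  by (rule bdd_funI[of _ "\<bar>c\<bar>"]) simp

lemma bdd_fun_indicator: "bdd_fun (indicator S)"
  by (rule bdd_funI[of _ 1]) (simp add: indicator_def)

lemma bdd_fun_uminus: "bdd_fun \<phi> \<Longrightarrow> bdd_fun (\<lambda>y. - \<phi> y)"
  using bdd_fun_scale[of \<phi> "-1"] by simp

definition sublinear :: "(('a \<Rightarrow> real) \<Rightarrow> real) \<Rightarrow> bool" where
  "sublinear p \<longleftrightarrow> (\<forall>\<phi> \<psi>. bdd_fun \<phi> \<longrightarrow> bdd_fun \<psi> \<longrightarrow> p (\<lambda>y. \<phi> y + \<psi> y) \<le> p \<phi> + p \<psi>) \<and>
    (\<forall>\<phi> t. bdd_fun \<phi> \<longrightarrow> 0 < t \<longrightarrow> p (\<lambda>y. t * \<phi> y) = t * p \<phi>)"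

lemma sublinearD:
  assumes "sublinear p"
  shows "bdd_fun \<phi> \<Longrightarrow> bdd_fun \<psi> \<Longrightarrow> p (\<lambda>y. \<phi> y + \<psi> y) \<le> p \<phi> + p \<psi>"
    and "bdd_fun \<phi> \<Longrightarrow> 0 < t \<Longrightarrow> p (\<lambda>y. t * \<phi> y) = t * p \<phi>"
    and "p (\<lambda>_. 0) = 0"
    and "bdd_fun \<phi> \<Longrightarrow> - p (\<lambda>y. - \<phi> y) \<le> p \<phi>"
proof -
  show 1: "bdd_fun \<phi> \<Longrightarrow> bdd_fun \<psi> \<Longrightarrow> p (\<lambda>y. \<phi> y + \<psi> y) \<le> p \<phi> + p \<psi>" for \<phi> \<psi>
    using assms by (auto simp: sublinear_def)
  show 2: "bdd_fun \<phi> \<Longrightarrow> 0 < t \<Longrightarrow> p (\<lambda>y. t * \<phi> y) = t * p \<phi>" for \<phi> t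
    using assms by (auto simp: sublinear_def)
  show 3: "p (\<lambda>_. 0) = 0" using 2[OF bdd_fun_const, of 2 0] by simp
  show "- p (\<lambda>y. - \<phi> y) \<le> p \<phi>" if "bdd_fun \<phi>"
    using 1[OF that bdd_fun_uminus[OF that]] 3 by simp
qed

text \<open>A minimal sublinear functional equals its own reduction, hence is linear.\<close>

lemma sublinear_reduce:
  assumes q: "sublinear q" and \<phi>: "bdd_fun \<phi>"
  obtains q' where "sublinear q'" "\<forall>\<psi>. bdd_fun \<psi> \<longrightarrow> q' \<psi> \<le> q \<psi>" "q' (\<lambda>y. - \<phi> y) \<le> - q \<phi>"
proof -
  \<comment> \<open>In the infimum, \<open>t = 0\<close> gives
    \<open>q' \<psi> \<le> q \<psi>\<close>, and \<open>t = 1\<close> at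
    \<open>\<lambda>y. - \<phi> y\<close> gives at most \<open>- q \<phi>\<close>. It is finite
    because \<open>- q (\<lambda>y. - \<psi> y)\<close> is a lower bound.\<close>
  define S where "S \<psi> = (\<lambda>t. q (\<lambda>y. \<psi> y + t * \<phi> y) - t * q \<phi>) ` {0..}" for \<psi>
  define q' where "q' \<psi> = Inf (S \<psi>)" for \<psi>
  have low: "- q (\<lambda>y. - \<psi> y) \<le> s" if b\<psi>: "bdd_fun \<psi>" and sS: "s \<in> S \<psi>" for s \<psi>
  proof -
    obtain t where t: "t \<ge> 0" "s = q (\<lambda>y. \<psi> y + t * \<phi> y) - t * q \<phi>" using sS by (auto simp: S_def)
    have b: "bdd_fun (\<lambda>y. \<psi> y + t * \<phi> y)" using b\<psi> \<phi> by (intro bdd_fun_add bdd_fun_scale)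
    have "q (\<lambda>y. t * \<phi> y) = t * q \<phi>"
      using sublinearD(2)[OF q \<phi>] sublinearD(3)[OF q] t(1) by (cases "t = 0") auto
    moreover have "q (\<lambda>y. t * \<phi> y) \<le> q (\<lambda>y. \<psi> y + t * \<phi> y) + q (\<lambda>y. - \<psi> y)"
      using sublinearD(1)[OF q b bdd_fun_uminus[OF b\<psi>]] by simp
    ultimately show ?thesis using t(2) by simp
  qed
  have bb: "bdd_below (S \<psi>)" if "bdd_fun \<psi>" for \<psi>
    using low[OF that] by (intro bdd_belowI) auto
  have ne: "S \<psi> \<noteq> {}" for \<psi> by (auto simp: S_def)
  have le: "q' \<psi> \<le> q (\<lambda>y. \<psi> y + t * \<phi> y) - t * q \<phi>" if "bdd_fun \<psi>" "t \<ge> 0" for \<psi> t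
    unfolding q'_def using that by (intro cInf_lower bb) (auto simp: S_def)
  have app: "\<exists>t\<ge>0. q (\<lambda>y. \<psi> y + t * \<phi> y) - t * q \<phi> < q' \<psi> + e" if "bdd_fun \<psi>" "e > 0" for \<psi> e
  proof -
    have "\<exists>s\<in>S \<psi>. s < q' \<psi> + e" unfolding q'_def using that ne bb by (intro cInf_lessD) auto
    then show ?thesis by (auto simp: S_def)
  qed
  have add: "q' (\<lambda>y. \<psi> y + \<xi> y) \<le> q' \<psi> + q' \<xi>" if b: "bdd_fun \<psi>" "bdd_fun \<xi>" for \<psi> \<xi>
  proof (rule field_le_epsilon)
    fix e :: real assume e: "e > 0"
    obtain s where s: "s \<ge> 0" "q (\<lambda>y. \<psi> y + s * \<phi> y) - s * q \<phi> < q' \<psi> + e / 2"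
      using app[OF b(1), of "e / 2"] e by auto
    obtain t where t: "t \<ge> 0" "q (\<lambda>y. \<xi> y + t * \<phi> y) - t * q \<phi> < q' \<xi> + e / 2"
      using app[OF b(2), of "e / 2"] e by auto
    have "q' (\<lambda>y. \<psi> y + \<xi> y) \<le> q (\<lambda>y. (\<psi> y + \<xi> y) + (s + t) * \<phi> y) - (s + t) * q \<phi>"
      using b s t by (intro le bdd_fun_add) auto
    also have "(\<lambda>y. (\<psi> y + \<xi> y) + (s + t) * \<phi> y) = (\<lambda>y. (\<psi> y + s * \<phi> y) + (\<xi> y + t * \<phi> y))"
      by (auto simp: algebra_simps)
    also have "q \<dots> \<le> q (\<lambda>y. \<psi> y + s * \<phi> y) + q (\<lambda>y. \<xi> y + t * \<phi> y)"
      using b \<phi> by (intro sublinearD(1)[OF q] bdd_fun_add bdd_fun_scale)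
    finally show "q' (\<lambda>y. \<psi> y + \<xi> y) \<le> q' \<psi> + q' \<xi> + e"
      using s(2) t(2) by (simp add: distrib_right)
  qed
  have scale1: "q' (\<lambda>y. c * \<psi> y) \<le> c * q' \<psi>" if b: "bdd_fun \<psi>" and c: "c > 0" for \<psi> c
  proof (rule field_le_epsilon)
    fix e :: real assume e: "e > 0"
    obtain s where s: "s \<ge> 0" "q (\<lambda>y. \<psi> y + s * \<phi> y) - s * q \<phi> < q' \<psi> + e / c"
      using app[OF b, of "e / c"] e c by auto
    have "q' (\<lambda>y. c * \<psi> y) \<le> q (\<lambda>y. c * \<psi> y + (c * s) * \<phi> y) - (c * s) * q \<phi>"
      using b s c by (intro le bdd_fun_scale) auto
    also have "(\<lambda>y. c * \<psi> y + (c * s) * \<phi> y) = (\<lambda>y. c * (\<psi> y + s * \<phi> y))" by (auto simp: algebra_simps)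
    also have "q \<dots> = c * q (\<lambda>y. \<psi> y + s * \<phi> y)"
      using b \<phi> c by (intro sublinearD(2)[OF q] bdd_fun_add bdd_fun_scale)
    also have "c * q (\<lambda>y. \<psi> y + s * \<phi> y) - c * s * q \<phi> = c * (q (\<lambda>y. \<psi> y + s * \<phi> y) - s * q \<phi>)"
      by (simp add: algebra_simps)
    also have "\<dots> \<le> c * (q' \<psi> + e / c)" using s(2) c by (intro mult_left_mono) auto
    finally show "q' (\<lambda>y. c * \<psi> y) \<le> c * q' \<psi> + e" using c by (simp add: distrib_left)
  qed
  have scale: "q' (\<lambda>y. c * \<psi> y) = c * q' \<psi>" if b: "bdd_fun \<psi>" and c: "c > 0" for \<psi> c
  proof (rule antisym[OF scale1[OF b c]])
    have "q' (\<lambda>y. (1 / c) * (c * \<psi> y)) \<le> (1 / c) * q' (\<lambda>y. c * \<psi> y)"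
      using c by (intro scale1 bdd_fun_scale b) auto
    then show "c * q' \<psi> \<le> q' (\<lambda>y. c * \<psi> y)" using c by (simp add: field_simps)
  qed
  show thesis
  proof (rule that[of q'])
    show "sublinear q'" unfolding sublinear_def using add scale by blast
    show "\<forall>\<psi>. bdd_fun \<psi> \<longrightarrow> q' \<psi> \<le> q \<psi>" using le[of _ 0] by simp
    show "q' (\<lambda>y. - \<phi> y) \<le> - q \<phi>" using le[OF bdd_fun_uminus[OF \<phi>], of 1] sublinearD(3)[OF q] by simp
  qed
qed

text \<open>Zorn's lemma below \<open>p\<close>. The pointwise infimum of a chain is finite because
  \<open>- p (\<lambda>y. - \<psi> y)\<close> lies below every member, and subadditive because any
  two members are comparable.\<close>

lemma minimal_sublinear:
  fixes p :: "('a \<Rightarrow> real) \<Rightarrow> real"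
  assumes p: "sublinear p"
  obtains q where "sublinear q" "\<forall>\<psi>. bdd_fun \<psi> \<longrightarrow> q \<psi> \<le> p \<psi>"
    "\<forall>q'. sublinear q' \<longrightarrow> (\<forall>\<psi>. bdd_fun \<psi> \<longrightarrow> q' \<psi> \<le> q \<psi>) \<longrightarrow> (\<forall>\<psi>. bdd_fun \<psi> \<longrightarrow> q' \<psi> = q \<psi>)"
proof -
  \<comment> \<open>The order compares functionals on bounded functions only; setting the other
    values to 0 makes it antisymmetric.\<close>
  define norml where "norml q = (\<lambda>\<psi>. if bdd_fun \<psi> then q \<psi> else 0)" for q :: "('a \<Rightarrow> real) \<Rightarrow> real"
  have norml_sub: "sublinear (norml q)" if "sublinear q" for q
    using that by (auto simp: sublinear_def norml_def bdd_fun_add bdd_fun_scale)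
  define A where "A = {q. sublinear q \<and> (\<forall>\<psi>. bdd_fun \<psi> \<longrightarrow> q \<psi> \<le> p \<psi>) \<and> norml q = q}"
  \<comment> \<open>The order is reversed, since Zorn's lemma delivers a maximal element.\<close>
  define P where "P a b \<longleftrightarrow> (\<forall>\<psi>. bdd_fun \<psi> \<longrightarrow> b \<psi> \<le> a \<psi>)" for a b :: "('a \<Rightarrow> real) \<Rightarrow> real"
  have eqI: "a = b" if "norml a = a" "norml b = b" "\<And>\<psi>. bdd_fun \<psi> \<Longrightarrow> a \<psi> = b \<psi>" for a b
  proof
    fix \<psi> show "a \<psi> = b \<psi>"
      using that(3)[of \<psi>] fun_cong[OF that(1), of \<psi>] fun_cong[OF that(2), of \<psi>]
      by (cases "bdd_fun \<psi>") (auto simp: norml_def)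
  qed
  have "\<exists>m\<in>A. \<forall>a\<in>A. P m a \<longrightarrow> a = m"
  proof (rule predicate_Zorn)
    show "partial_order_on A (relation_of P A)"
    proof (rule partial_order_on_relation_ofI)
      show "P a a" for a by (simp add: P_def)
      show "P a c" if "P a b" "P b c" for a b c using that unfolding P_def by (meson order_trans)
      show "a = b" if "a \<in> A" "b \<in> A" "P a b" "P b a" for a b
      proof (rule eqI)
        show "norml a = a" "norml b = b" using that(1,2) unfolding A_def by blast+
        show "a \<psi> = b \<psi>" if "bdd_fun \<psi>" for \<psi>
          using \<open>P a b\<close> \<open>P b a\<close> that unfolding P_def by (blast intro: order_antisym)
      qed
    qed
  next
    fix C assume C: "C \<in> Chains (relation_of P A)"
    have CA: "C \<subseteq> A" using C unfolding Chains_def relation_of_def by blast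
    have lin: "P a b \<or> P b a" if "a \<in> C" "b \<in> C" for a b
      using C that unfolding Chains_def relation_of_def by blast
    have npA: "norml p \<in> A" using norml_sub[OF p] unfolding A_def by (simp add: norml_def fun_eq_iff)
    show "\<exists>u\<in>A. \<forall>a\<in>C. P a u"
    proof (cases "C = {}")
      case True then show ?thesis using npA by auto
    next
      case False
      define u where "u = norml (\<lambda>\<psi>. Inf ((\<lambda>q. q \<psi>) ` C))"
      have low: "- p (\<lambda>y. - \<psi> y) \<le> q \<psi>" if "bdd_fun \<psi>" "q \<in> C" for \<psi> q
      proof -
        have q: "sublinear q" "q (\<lambda>y. - \<psi> y) \<le> p (\<lambda>y. - \<psi> y)"
          using that CA bdd_fun_uminus unfolding A_def by blast+
        then show ?thesis using sublinearD(4)[OF q(1) that(1)] by simp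
      qed
      have bb: "bdd_below ((\<lambda>q. q \<psi>) ` C)" if "bdd_fun \<psi>" for \<psi>
        using low[OF that] by (intro bdd_belowI2) auto
      have le: "u \<psi> \<le> q \<psi>" if "bdd_fun \<psi>" "q \<in> C" for \<psi> q
        unfolding u_def norml_def using that by (auto intro!: cInf_lower bb)
      have app: "\<exists>q\<in>C. q \<psi> < u \<psi> + e" if "bdd_fun \<psi>" "e > 0" for \<psi> e
      proof -
        have "\<exists>s\<in>(\<lambda>q. q \<psi>) ` C. s < u \<psi> + e"
          using that False bb[OF that(1)] by (intro cInf_lessD) (auto simp: u_def norml_def)
        then show ?thesis by auto
      qed
      have sC: "sublinear q" if "q \<in> C" for q using that CA unfolding A_def by blast
      have scale1: "u (\<lambda>y. c * \<psi> y) \<le> c * u \<psi>" if b: "bdd_fun \<psi>" and c: "c > 0" for \<psi> c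
      proof (rule field_le_epsilon)
        fix e :: real assume e: "e > 0"
        obtain q where q: "q \<in> C" "q \<psi> < u \<psi> + e / c" using app[OF b, of "e / c"] e c by auto
        have "u (\<lambda>y. c * \<psi> y) \<le> q (\<lambda>y. c * \<psi> y)" using b q by (intro le bdd_fun_scale)
        also have "\<dots> = c * q \<psi>" by (rule sublinearD(2)[OF sC[OF q(1)] b c])
        also have "\<dots> \<le> c * (u \<psi> + e / c)" using q c by (intro mult_left_mono) auto
        finally show "u (\<lambda>y. c * \<psi> y) \<le> c * u \<psi> + e" using c by (simp add: distrib_left)
      qed
      have "sublinear u" unfolding sublinear_def
      proof (intro conjI allI impI)
        fix \<phi> \<psi> :: "'a \<Rightarrow> real" assume b: "bdd_fun \<phi>" "bdd_fun \<psi>"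
        show "u (\<lambda>y. \<phi> y + \<psi> y) \<le> u \<phi> + u \<psi>"
        proof (rule field_le_epsilon)
          fix e :: real assume e: "e > 0"
          obtain q1 where q1: "q1 \<in> C" "q1 \<phi> < u \<phi> + e / 2" using app[OF b(1), of "e / 2"] e by auto
          obtain q2 where q2: "q2 \<in> C" "q2 \<psi> < u \<psi> + e / 2" using app[OF b(2), of "e / 2"] e by auto
          obtain q where q: "q \<in> C" "q \<phi> \<le> q1 \<phi>" "q \<psi> \<le> q2 \<psi>"
            using lin[OF q1(1) q2(1)] q1(1) q2(1) b unfolding P_def by blast
          have "u (\<lambda>y. \<phi> y + \<psi> y) \<le> q (\<lambda>y. \<phi> y + \<psi> y)" using b q by (intro le bdd_fun_add)
          also have "\<dots> \<le> q \<phi> + q \<psi>" by (rule sublinearD(1)[OF sC[OF q(1)] b])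
          finally show "u (\<lambda>y. \<phi> y + \<psi> y) \<le> u \<phi> + u \<psi> + e" using q q1 q2 by linarith
        qed
      next
        fix \<psi> :: "'a \<Rightarrow> real" and c :: real assume b: "bdd_fun \<psi>" and c: "0 < c"
        show "u (\<lambda>y. c * \<psi> y) = c * u \<psi>"
        proof (rule antisym[OF scale1[OF b c]])
          have "u (\<lambda>y. (1 / c) * (c * \<psi> y)) \<le> (1 / c) * u (\<lambda>y. c * \<psi> y)"
            using c by (intro scale1 bdd_fun_scale b) auto
          then show "c * u \<psi> \<le> u (\<lambda>y. c * \<psi> y)" using c by (simp add: field_simps)
        qed
      qed
      moreover have "u \<psi> \<le> p \<psi>" if "bdd_fun \<psi>" for \<psi>
      proof -
        obtain q where "q \<in> C" using False by blast
        moreover from this have "q \<psi> \<le> p \<psi>" using CA that unfolding A_def by blast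
        ultimately show ?thesis using le[OF that] order_trans by blast
      qed
      moreover have "norml u = u" by (simp add: u_def norml_def fun_eq_iff)
      ultimately have "u \<in> A" unfolding A_def by blast
      then show ?thesis using le by (auto simp: P_def)
    qed
  qed
  then obtain m where m: "m \<in> A" "\<And>a. a \<in> A \<Longrightarrow> P m a \<Longrightarrow> a = m" by blast
  show thesis
  proof (rule that[of m])
    show "sublinear m" "\<forall>\<psi>. bdd_fun \<psi> \<longrightarrow> m \<psi> \<le> p \<psi>" using m(1) unfolding A_def by blast+
    show "\<forall>q'. sublinear q' \<longrightarrow> (\<forall>\<psi>. bdd_fun \<psi> \<longrightarrow> q' \<psi> \<le> m \<psi>) \<longrightarrow> (\<forall>\<psi>. bdd_fun \<psi> \<longrightarrow> q' \<psi> = m \<psi>)"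
    proof (intro allI impI)
      fix q' and \<psi> :: "'a \<Rightarrow> real"
      assume q': "sublinear q'" "\<forall>\<psi>. bdd_fun \<psi> \<longrightarrow> q' \<psi> \<le> m \<psi>" and \<psi>: "bdd_fun \<psi>"
      have "norml q' \<psi> \<le> p \<psi>" if "bdd_fun \<psi>" for \<psi>
        proof -
        have "m \<psi> \<le> p \<psi>" using m(1) that unfolding A_def by blast
        then show ?thesis using q'(2) that order_trans[of "q' \<psi>" "m \<psi>" "p \<psi>"] by (simp add: norml_def)
      qed
      moreover have "norml (norml q') = norml q'" by (simp add: norml_def fun_eq_iff)
      ultimately have "norml q' \<in> A" using norml_sub[OF q'(1)] unfolding A_def by blast
      moreover have "P m (norml q')" using q'(2) by (simp add: P_def norml_def)
      ultimately have "norml q' = m" by (rule m(2))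
      then show "q' \<psi> = m \<psi>" using \<psi> by (auto simp: norml_def)
    qed
  qed
qed

text \<open>Reducing \<open>p\<close> at \<open>\<phi>0\<close> first forces every linear functional
  below the reduction to agree with \<open>p\<close> at \<open>\<phi>0\<close>. Reducing a minimal
  functional at any \<open>\<phi>\<close> must return it, which makes it odd; an odd sublinear
  functional is linear.\<close>

lemma hahn_banach_bdd_fun:
  assumes p: "sublinear p" and \<phi>0: "bdd_fun \<phi>0"
  obtains L where "\<And>\<phi> \<psi>. bdd_fun \<phi> \<Longrightarrow> bdd_fun \<psi> \<Longrightarrow> L (\<lambda>y. \<phi> y + \<psi> y) = L \<phi> + L \<psi>"
    "\<And>\<phi> c. bdd_fun \<phi> \<Longrightarrow> L (\<lambda>y. c * \<phi> y) = c * L \<phi>"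
    "\<And>\<phi>. bdd_fun \<phi> \<Longrightarrow> L \<phi> \<le> p \<phi>" "L \<phi>0 = p \<phi>0"
proof -
  obtain p' where p': "sublinear p'" "\<forall>\<psi>. bdd_fun \<psi> \<longrightarrow> p' \<psi> \<le> p \<psi>" "p' (\<lambda>y. - \<phi>0 y) \<le> - p \<phi>0"
    by (rule sublinear_reduce[OF p \<phi>0]) (rule that)
  obtain L where L: "sublinear L" "\<forall>\<psi>. bdd_fun \<psi> \<longrightarrow> L \<psi> \<le> p' \<psi>"
    "\<forall>q'. sublinear q' \<longrightarrow> (\<forall>\<psi>. bdd_fun \<psi> \<longrightarrow> q' \<psi> \<le> L \<psi>) \<longrightarrow> (\<forall>\<psi>. bdd_fun \<psi> \<longrightarrow> q' \<psi> = L \<psi>)"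
    by (rule minimal_sublinear[OF p'(1)]) (rule that)
  have neg: "L (\<lambda>y. - \<phi> y) = - L \<phi>" if b: "bdd_fun \<phi>" for \<phi>
  proof -
    obtain q' where q': "sublinear q'" "\<forall>\<psi>. bdd_fun \<psi> \<longrightarrow> q' \<psi> \<le> L \<psi>" "q' (\<lambda>y. - \<phi> y) \<le> - L \<phi>"
      by (rule sublinear_reduce[OF L(1) b]) (rule that)
    have "q' (\<lambda>y. - \<phi> y) = L (\<lambda>y. - \<phi> y)" using L(3) q'(1,2) bdd_fun_uminus[OF b] by simp
    then show ?thesis using q'(3) sublinearD(4)[OF L(1) b] by simp
  qed
  have add: "L (\<lambda>y. \<phi> y + \<psi> y) = L \<phi> + L \<psi>" if b: "bdd_fun \<phi>" "bdd_fun \<psi>" for \<phi> \<psi>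
  proof (rule antisym[OF sublinearD(1)[OF L(1) b]])
    have "L (\<lambda>y. - (\<phi> y + \<psi> y)) \<le> L (\<lambda>y. - \<phi> y) + L (\<lambda>y. - \<psi> y)"
      using sublinearD(1)[OF L(1) bdd_fun_uminus[OF b(1)] bdd_fun_uminus[OF b(2)]] by simp
    then show "L \<phi> + L \<psi> \<le> L (\<lambda>y. \<phi> y + \<psi> y)"
      unfolding neg[OF b(1)] neg[OF b(2)] neg[OF bdd_fun_add[OF b]] by simp
  qed
  have scale: "L (\<lambda>y. c * \<phi> y) = c * L \<phi>" if b: "bdd_fun \<phi>" for \<phi> c
  proof (cases c "0::real" rule: linorder_cases)
    case less
    have "L (\<lambda>y. - ((- c) * \<phi> y)) = - L (\<lambda>y. (- c) * \<phi> y)" by (rule neg[OF bdd_fun_scale[OF b]])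
    then show ?thesis using sublinearD(2)[OF L(1) b, of "- c"] less by simp
  next
    case equal then show ?thesis using sublinearD(3)[OF L(1)] by simp
  next
    case greater then show ?thesis using sublinearD(2)[OF L(1) b] by simp
  qed
  have le: "L \<phi> \<le> p \<phi>" if "bdd_fun \<phi>" for \<phi> using L(2) p'(2) that order_trans[of "L \<phi>" "p' \<phi>"] by simp
  have "L (\<lambda>y. - \<phi>0 y) \<le> - p \<phi>0" using L(2) bdd_fun_uminus[OF \<phi>0] p'(3) order_trans by blast
  then have "L \<phi>0 = p \<phi>0" using neg[OF \<phi>0] le[OF \<phi>0] by simp
  with add scale le that show thesis by blast
qed

section \<open>Measures representing functionals\<close>

text \<open>Each level refines the previous cells by a finite net. The label \<open>N k y\<close> is
  the mixed-radix number whose digits are the indices of \<open>y\<close> in the first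
  \<open>k\<close> nets, so \<open>div\<close> drops the last digit and the cells refining cell
  \<open>i\<close> have labels in one contiguous block. This order is what turns nested cells into
  nested intervals later.\<close>

lemma nested_partitions:
  fixes K :: "'a::metric_space set"
  assumes K: "compact K"
  obtains N :: "nat \<Rightarrow> 'a \<Rightarrow> nat" and b P :: "nat \<Rightarrow> nat" where
    "\<And>k. b k > 0" "\<And>k y. N (Suc k) y div b k = N k y" "\<And>k y. N k y < P k"
    "\<forall>k. \<forall>y\<in>K. \<forall>z\<in>K. N (Suc k) y = N (Suc k) z \<longrightarrow> dist y z < 2 * (1 / 2) ^ k"
proof -
  have "\<exists>n i. (\<forall>y. i y < Suc n) \<and> (\<forall>y\<in>K. \<forall>z\<in>K. i y = i z \<longrightarrow> dist y z < 2 * (1 / 2) ^ k)" for k :: nat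
  proof -
    have e: "(1 / 2 :: real) ^ k > 0" by simp
    obtain F where F: "finite F" "K \<subseteq> (\<Union>x\<in>F. ball x ((1 / 2) ^ k))"
      using K e unfolding compact_eq_totally_bounded by blast
    then have "\<forall>y\<in>K. \<exists>x\<in>F. y \<in> ball x ((1 / 2) ^ k)" by blast
    then obtain p where p: "\<And>y. y \<in> K \<Longrightarrow> p y \<in> F \<and> y \<in> ball (p y) ((1 / 2) ^ k)" by metis
    obtain h :: "'a \<Rightarrow> nat" and n where h: "h ` F = {i. i < n}" "inj_on h F"
      using finite_imp_inj_to_nat_seg[OF F(1)] by blast
    \<comment> \<open>Points outside \<open>K\<close> get the arbitrary index 0; distances are
      claimed on \<open>K\<close> alone.\<close>
    define i where "i y = (if y \<in> K then h (p y) else 0)" for y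
    have "i y < Suc n" for y
    proof (cases "y \<in> K")
      case True
      then have "h (p y) \<in> h ` F" using p by blast
      then show ?thesis using True h(1) by (simp add: i_def)
    qed (simp add: i_def)
    moreover have "dist y z < 2 * (1 / 2) ^ k" if "y \<in> K" "z \<in> K" "i y = i z" for y z
    proof -
      have "p y = p z" using that p h(2) by (auto simp: i_def inj_on_def)
      then have "dist (p y) y < (1 / 2) ^ k" "dist (p y) z < (1 / 2) ^ k" using p that by force+
      then show ?thesis using dist_triangle2[of y z "p y"] by (simp add: dist_commute)
    qed
    ultimately show ?thesis by blast
  qed
  then obtain n i where ni: "\<And>k y. i k y < Suc (n k)"
    "\<And>k y z. y \<in> K \<Longrightarrow> z \<in> K \<Longrightarrow> i k y = i k z \<Longrightarrow> dist y z < 2 * (1 / 2) ^ k"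
    by metis
  define N where "N = rec_nat (\<lambda>_. 0) (\<lambda>k Nk y. Nk y * Suc (n k) + i k y)"
  have N0: "N 0 y = 0" and NS: "N (Suc k) y = N k y * Suc (n k) + i k y" for k y
    by (simp_all add: N_def)
  define P where "P k = (\<Prod>j<k. Suc (n j))" for k
  show thesis
  proof (rule that[of "\<lambda>k. Suc (n k)" N P])
    show "N (Suc k) y div Suc (n k) = N k y" for k y
      unfolding NS using ni(1)[of k y] by (simp add: div_mult_self3 del: mult_Suc_right)
    show "N k y < P k" for k y
    proof (induction k)
      case (Suc k)
      have "N (Suc k) y < (N k y + 1) * Suc (n k)" unfolding NS using ni(1)[of k y] by (simp add: algebra_simps)
      also have "\<dots> \<le> P k * Suc (n k)" using Suc by (intro mult_right_mono) auto
      finally show ?case by (simp add: P_def mult.commute)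
    qed (simp add: N0 P_def)
    show "\<forall>k. \<forall>y\<in>K. \<forall>z\<in>K. N (Suc k) y = N (Suc k) z \<longrightarrow> dist y z < 2 * (1 / 2) ^ k"
    proof (intro allI ballI impI)
      fix k y z assume yz: "y \<in> K" "z \<in> K" "N (Suc k) y = N (Suc k) z"
      have "N (Suc k) y mod Suc (n k) = i k y" for y
        unfolding NS using ni(1)[of k y] by (simp del: mult_Suc_right)
      then have "i k y = i k z" using yz(3) by metis
      then show "dist y z < 2 * (1 / 2) ^ k" by (rule ni(2)[OF yz(1,2)])
    qed
  qed simp
qed

text \<open>Such a functional may fail to be countably additive, so a measure can be expected to
  match it on continuous functions and, on lower semicontinuous ones, only to stay below it.\<close>

locale bdd_functional =
  fixes K :: "'a::euclidean_space set" and L :: "('a \<Rightarrow> real) \<Rightarrow> real"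
  assumes K: "compact K" "K \<noteq> {}"
    and add: "\<And>\<phi> \<psi>. bdd_fun \<phi> \<Longrightarrow> bdd_fun \<psi> \<Longrightarrow> L (\<lambda>y. \<phi> y + \<psi> y) = L \<phi> + L \<psi>"
    and scale: "\<And>\<phi> c. bdd_fun \<phi> \<Longrightarrow> L (\<lambda>y. c * \<phi> y) = c * L \<phi>"
    and mono: "\<And>\<phi> \<psi>. bdd_fun \<phi> \<Longrightarrow> bdd_fun \<psi> \<Longrightarrow> (\<And>y. y \<in> K \<Longrightarrow> \<phi> y \<le> \<psi> y) \<Longrightarrow> L \<phi> \<le> L \<psi>"
    and one: "L (\<lambda>_. 1) = 1"
begin

lemma const: "L (\<lambda>_. c) = c"
  using scale[OF bdd_fun_const, of c 1] one by simp

lemma cong: "bdd_fun \<phi> \<Longrightarrow> bdd_fun \<psi> \<Longrightarrow> (\<And>y. y \<in> K \<Longrightarrow> \<phi> y = \<psi> y) \<Longrightarrow> L \<phi> = L \<psi>"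
  by (intro antisym mono) auto

lemma bdd_fun_sum:
  "finite I \<Longrightarrow> (\<And>i. i \<in> I \<Longrightarrow> bdd_fun (\<phi> i)) \<Longrightarrow> bdd_fun (\<lambda>y. \<Sum>i\<in>I. a i * \<phi> i y :: real)"
  by (induction I rule: finite_induct) (auto intro!: bdd_fun_add bdd_fun_scale bdd_fun_const)

lemma sum:
  "finite I \<Longrightarrow> (\<And>i. i \<in> I \<Longrightarrow> bdd_fun (\<phi> i)) \<Longrightarrow> L (\<lambda>y. \<Sum>i\<in>I. a i * \<phi> i y) = (\<Sum>i\<in>I. a i * L (\<phi> i))"
proof (induction I rule: finite_induct)
  case (insert i I)
  have "L (\<lambda>y. a i * \<phi> i y + (\<Sum>i\<in>I. a i * \<phi> i y)) = L (\<lambda>y. a i * \<phi> i y) + L (\<lambda>y. \<Sum>i\<in>I. a i * \<phi> i y)"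
    using insert by (intro add bdd_fun_scale bdd_fun_sum) auto
  then show ?case using insert scale[of "\<phi> i" "a i"] by simp
qed (simp add: const)

text \<open>The measure is the image of Lebesgue measure on the unit interval under a quantile-type map:
  the cells of nested finite partitions correspond to nested intervals whose lengths are
  the values of the functional on the cells.\<close>

lemma representing_measure:
  obtains \<nu> :: "'a measure" where "sets \<nu> = sets borel" "emeasure \<nu> (space \<nu>) = 1" "emeasure \<nu> (- K) = 0"
    "\<And>f B. f \<in> borel_measurable borel \<Longrightarrow> (\<And>y. \<bar>f y\<bar> \<le> B) \<Longrightarrow>
      (\<And>y a. y \<in> K \<Longrightarrow> a < f y \<Longrightarrow> \<exists>e>0. \<forall>z\<in>K. dist y z < e \<longrightarrow> a < f z) \<Longrightarrow> (\<integral>y. f y \<partial>\<nu>) \<le> L f"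
proof -
  obtain N :: "nat \<Rightarrow> 'a \<Rightarrow> nat" and b P :: "nat \<Rightarrow> nat" where
    b: "\<And>k. b k > 0" and Ndiv: "\<And>k y. N (Suc k) y div b k = N k y" and NP: "\<And>k y. N k y < P k"
    and Ndist0: "\<forall>k. \<forall>y\<in>K. \<forall>z\<in>K. N (Suc k) y = N (Suc k) z \<longrightarrow> dist y z < 2 * (1 / 2) ^ k"
    by (rule nested_partitions[OF K(1)]) (rule that)
  have Ndist: "dist y z < 2 * (1 / 2) ^ k" if "y \<in> K" "z \<in> K" "N (Suc k) y = N (Suc k) z" for k y z
    using Ndist0 that by blast
  obtain x0 where x0: "x0 \<in> K" using K(2) by blast
  \<comment> \<open>The cumulative mass of the cells with label below \<open>i\<close>; cell
    \<open>i\<close> of level \<open>k\<close> corresponds to the interval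
    \<open>{F k i..<F k (Suc i)}\<close>.\<close>
  define F where "F k i = L (indicator {y\<in>K. N k y < i})" for k i
  define m where "m k i = L (indicator {y\<in>K. N k y = i})" for k i
  have F0: "F k 0 = 0" for k
    unfolding F_def using cong[OF bdd_fun_indicator bdd_fun_const, of _ 0] const[of 0] by simp
  have FP: "F k (P k) = 1" for k
    unfolding F_def using cong[OF bdd_fun_indicator bdd_fun_const, of _ 1] const[of 1] NP by simp
  have Fmono: "F k i \<le> F k i'" if "i \<le> i'" for k i i'
    unfolding F_def using that by (intro mono bdd_fun_indicator) (auto simp: indicator_def)
  have Fm: "F k (Suc i) = F k i + m k i" for k i
  proof -
    have "indicator {y\<in>K. N k y < Suc i} = (\<lambda>y. indicator {y\<in>K. N k y < i} y + indicator {y\<in>K. N k y = i} y :: real)"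
      by (auto simp: fun_eq_iff indicator_def)
    then show ?thesis unfolding F_def m_def by (simp only: add[OF bdd_fun_indicator bdd_fun_indicator])
  qed
  have m0: "0 \<le> m k i" for k i using Fmono[of i "Suc i" k] Fm[of k i] by simp
  have F1: "F k i \<le> 1" for k i
  proof -
    have "F k i \<le> L (\<lambda>_. 1)"
      unfolding F_def by (intro mono bdd_fun_indicator bdd_fun_const) (auto simp: indicator_def)
    then show ?thesis by (simp only: one)
  qed
  have Fge0: "0 \<le> F k i" for k i using Fmono[of 0 i k] F0 by simp
  \<comment> \<open>Because refining labels are contiguous, the end points of level \<open>k\<close>
    occur among those of level \<open>Suc k\<close>, so the intervals are nested.\<close>
  have Fref: "F (Suc k) (i * b k) = F k i" for k i
  proof -
    have "N (Suc k) y < i * b k \<longleftrightarrow> N k y < i" for y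
      using div_less_iff_less_mult[OF b, of "N (Suc k) y" k i] Ndiv by simp
    then show ?thesis unfolding F_def by simp
  qed
  define j where "j k \<omega> = (LEAST i. \<omega> < F k (Suc i))" for k and \<omega> :: real
  have j1: "\<omega> < F k (Suc (j k \<omega>))" and j2: "F k (j k \<omega>) \<le> \<omega>" and j3: "j k \<omega> < P k"
    if \<omega>: "0 \<le> \<omega>" "\<omega> < 1" for k \<omega>
  proof -
    have P: "P k > 0" using NP[of k x0] by simp
    have ex: "\<omega> < F k (Suc (P k - 1))" using P FP \<omega> by simp
    show "\<omega> < F k (Suc (j k \<omega>))" unfolding j_def by (rule LeastI[of "\<lambda>i. \<omega> < F k (Suc i)", OF ex])
    show "j k \<omega> < P k" using Least_le[of "\<lambda>i. \<omega> < F k (Suc i)", OF ex] P unfolding j_def by simp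
    show "F k (j k \<omega>) \<le> \<omega>"
    proof (cases "j k \<omega>")
      case (Suc i)
      then have "i < (LEAST i. \<omega> < F k (Suc i))" unfolding j_def by simp
      then show ?thesis using not_less_Least[of i "\<lambda>i. \<omega> < F k (Suc i)"] Suc by simp
    qed (simp add: F0 \<omega>)
  qed
  have juniq: "j k \<omega> = i" if "F k i \<le> \<omega>" "\<omega> < F k (Suc i)" for k \<omega> i
  proof (rule antisym)
    show "j k \<omega> \<le> i" unfolding j_def by (rule Least_le) (rule that(2))
    show "i \<le> j k \<omega>"
    proof (rule ccontr)
      assume "\<not> i \<le> j k \<omega>"
      then have "F k (Suc (j k \<omega>)) \<le> F k i" by (intro Fmono) simp
      moreover have "\<omega> < F k (Suc (j k \<omega>))" unfolding j_def by (rule LeastI[of "\<lambda>i. \<omega> < F k (Suc i)", OF that(2)])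
      ultimately show False using that(1) by simp
    qed
  qed
  have jdiv: "j (Suc k) \<omega> div b k = j k \<omega>" if \<omega>: "0 \<le> \<omega>" "\<omega> < 1" for k \<omega>
  proof (rule juniq[symmetric])
    let ?j = "j (Suc k) \<omega>"
    have "?j div b k * b k \<le> ?j" by simp
    then show "F k (?j div b k) \<le> \<omega>"
      using Fmono[of "?j div b k * b k" ?j "Suc k"] Fref[of k "?j div b k"] j2[OF \<omega>, of "Suc k"] by simp
    have "?j < Suc (?j div b k) * b k"
      using div_less_iff_less_mult[OF b[of k], of ?j "Suc (?j div b k)"] by blast
    then have "Suc ?j \<le> Suc (?j div b k) * b k" by simp
    then show "\<omega> < F k (Suc (?j div b k))"
      using Fmono[of "Suc ?j" "Suc (?j div b k) * b k" "Suc k"] Fref[of k "Suc (?j div b k)"] j1[OF \<omega>, of "Suc k"] by linarith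
  qed
  \<comment> \<open>An empty cell has an interval of length 0, so the interval containing
    \<open>\<omega>\<close> belongs to a nonempty cell.\<close>
  have cell: "\<exists>y. y \<in> K \<and> N k y = j k \<omega>" if \<omega>: "0 \<le> \<omega>" "\<omega> < 1" for k \<omega>
  proof (rule ccontr)
    assume "\<nexists>y. y \<in> K \<and> N k y = j k \<omega>"
    then have "m k (j k \<omega>) = 0"
      unfolding m_def using cong[OF bdd_fun_indicator bdd_fun_const, of _ 0] const[of 0] by simp
    then show False using Fm[of k "j k \<omega>"] j1[OF \<omega>, of k] j2[OF \<omega>, of k] by simp
  qed
  define c where "c k i = (SOME y. y \<in> K \<and> N k y = i)" for k i
  define X where "X k \<omega> = (if \<omega> \<in> {0..<1} then c k (j k \<omega>) else x0)" for k and \<omega> :: real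
  have c: "c k (j k \<omega>) \<in> K \<and> N k (c k (j k \<omega>)) = j k \<omega>" if \<omega>: "0 \<le> \<omega>" "\<omega> < 1" for k \<omega>
    unfolding c_def by (rule someI_ex[OF cell[OF \<omega>]])
  have XK: "X k \<omega> \<in> K" for k \<omega> using c[of \<omega> k] x0 by (auto simp: X_def)
  have NX: "N k (X k \<omega>) = j k \<omega>" if \<omega>: "0 \<le> \<omega>" "\<omega> < 1" for k \<omega> using c[OF \<omega>, of k] \<omega> by (simp add: X_def)
  have coarse: "N n y = j n \<omega> \<longrightarrow> N k y = j k \<omega>" if "k \<le> n" "0 \<le> \<omega>" "\<omega> < 1" for n k y \<omega>
    using that(1)
  proof (induction n rule: dec_induct)
    case (step n)
    then show ?case using Ndiv[of n y] jdiv[OF that(2,3), of n] by metis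
  qed simp
  \<comment> \<open>By nesting, the sample point of level \<open>n\<close> still lies in the cell of
    \<open>\<omega>\<close> at every earlier level, and those cells shrink.\<close>
  have Xdist: "dist (X (Suc k) \<omega>) (X n \<omega>) < 2 * (1 / 2) ^ k" if "Suc k \<le> n" for k n \<omega>
  proof (cases "\<omega> \<in> {0..<1}")
    case True
    then have \<omega>: "0 \<le> \<omega>" "\<omega> < 1" by auto
    have "N (Suc k) (X n \<omega>) = j (Suc k) \<omega>" using coarse[OF that \<omega>] NX[OF \<omega>] by simp
    then show ?thesis using NX[OF \<omega>] by (intro Ndist XK) simp
  next
    case False
    then have "X i \<omega> = x0" for i by (simp only: X_def if_False)
    then show ?thesis by simp
  qed
  have conv: "\<exists>l\<in>K. (\<lambda>k. X k \<omega>) \<longlonglongrightarrow> l" for \<omega>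
  proof -
    have "Cauchy (\<lambda>k. X k \<omega>)"
    proof (rule metric_CauchyI)
      fix e :: real assume e: "0 < e"
      have "(\<lambda>k. 4 * (1 / 2) ^ k) \<longlonglongrightarrow> (0::real)" by real_asymp
      then have "\<forall>\<^sub>F k in sequentially. 4 * (1 / 2) ^ k < e" by (rule order_tendstoD(2)[OF _ e])
      then obtain k where k: "4 * (1 / 2) ^ k < e" unfolding eventually_sequentially by blast
      have "dist (X p \<omega>) (X q \<omega>) < e" if "Suc k \<le> p" "Suc k \<le> q" for p q
        using Xdist[OF that(1), of \<omega>] Xdist[OF that(2), of \<omega>] dist_triangle3[of "X p \<omega>" "X q \<omega>" "X (Suc k) \<omega>"] k
        by linarith
      then show "\<exists>M. \<forall>m\<ge>M. \<forall>n\<ge>M. dist (X m \<omega>) (X n \<omega>) < e" by blast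
    qed
    moreover have "complete K" using K(1) by (simp add: compact_imp_complete)
    ultimately obtain l where "l \<in> K" "(\<lambda>k. X k \<omega>) \<longlonglongrightarrow> l"
      using completeE[of K "\<lambda>k. X k \<omega>"] XK by metis
    then show ?thesis by blast
  qed
  define Y where "Y \<omega> = (SOME l. l \<in> K \<and> (\<lambda>k. X k \<omega>) \<longlonglongrightarrow> l)" for \<omega>
  have Y: "Y \<omega> \<in> K" "(\<lambda>k. X k \<omega>) \<longlonglongrightarrow> Y \<omega>" for \<omega>
  proof -
    have "\<exists>l. l \<in> K \<and> (\<lambda>k. X k \<omega>) \<longlonglongrightarrow> l" using conv[of \<omega>] by blast
    from someI_ex[OF this] show "Y \<omega> \<in> K" "(\<lambda>k. X k \<omega>) \<longlonglongrightarrow> Y \<omega>" by (simp_all add: Y_def)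
  qed
  have XY: "dist (X (Suc k) \<omega>) (Y \<omega>) \<le> 2 * (1 / 2) ^ k" for k \<omega>
  proof (rule LIMSEQ_le_const2[OF tendsto_dist[OF tendsto_const Y(2)]])
    show "\<exists>M. \<forall>n\<ge>M. dist (X (Suc k) \<omega>) (X n \<omega>) \<le> 2 * (1 / 2) ^ k"
      using Xdist[of k _ \<omega>] by (intro exI[of _ "Suc k"]) (auto intro: less_imp_le)
  qed
  have jm [measurable]: "j k \<in> borel \<rightarrow>\<^sub>M count_space UNIV" for k
    unfolding j_def[abs_def] by measurable
  have Xm [measurable]: "X k \<in> borel_measurable borel" for k
  proof -
    have "(\<lambda>\<omega>. c k (j k \<omega>)) \<in> borel_measurable borel"
      by (rule measurable_compose[OF jm]) simp
    then show ?thesis unfolding X_def[abs_def] by measurable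
  qed
  have Ym [measurable]: "Y \<in> borel_measurable borel"
    by (rule borel_measurable_LIMSEQ_metric[OF Xm Y(2)])
  define M0 where "M0 = density lborel (\<lambda>\<omega>. indicator {0..<1::real} \<omega> :: ennreal)"
  have [measurable_cong, simp]: "sets M0 = sets borel" by (simp add: M0_def)
  define \<nu> where "\<nu> = distr M0 borel Y"
  have YM0 [measurable]: "Y \<in> M0 \<rightarrow>\<^sub>M borel" by measurable
  have sets: "sets \<nu> = sets borel" by (simp add: \<nu>_def)
  have mass: "emeasure \<nu> (space \<nu>) = 1"
    by (simp add: \<nu>_def emeasure_distr M0_def emeasure_density)
  have null: "emeasure \<nu> (- K) = 0"
  proof -
    have "Y -` (- K) = {}" using Y(1) by auto
    then show ?thesis using K(1) by (simp add: \<nu>_def emeasure_distr compact_imp_closed)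
  qed
  have main: "(\<integral>y. f y \<partial>\<nu>) \<le> L f"
    if fm [measurable]: "f \<in> borel_measurable borel" and B: "\<And>y. \<bar>f y\<bar> \<le> B"
      and lsc: "\<And>y a. y \<in> K \<Longrightarrow> a < f y \<Longrightarrow> \<exists>e>0. \<forall>z\<in>K. dist y z < e \<longrightarrow> a < f z" for f B
  proof -
    define S where "S k i = {y\<in>K. N k y = i}" for k i
    \<comment> \<open>Infima over the cells give a step function below \<open>f\<close> on
      \<open>K\<close>. Empty cells, which have mass 0, get the value 0.\<close>
    define g where "g k i = (if S k i = {} then 0 else Inf (f ` S k i))" for k i
    have B': "- B \<le> f y" "f y \<le> B" for y using B[of y] by auto
    have bb: "bdd_below (f ` T)" for T using B' by (intro bdd_belowI2[of _ "- B"]) auto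
    have gf: "g k (N k y) \<le> f y" if "y \<in> K" for k y
      using that bb by (auto simp: g_def S_def intro!: cInf_lower)
    have B0: "0 \<le> B" using B[of x0] by linarith
    have gB: "- B \<le> g k i" for k i
      using B0 B' by (auto simp: g_def intro!: cInf_greatest)
    have gp: "0 \<le> g k i + B" for k i using gB[of k i] by linarith
    \<comment> \<open>This step function carried over to the unit interval and shifted by
      \<open>B\<close> to be nonnegative.\<close>
    define u where "u k \<omega> = (\<Sum>i<P k. ennreal (g k i + B) * indicator {F k i..<F k (Suc i)} \<omega>)" for k and \<omega> :: real
    have u_in: "u k \<omega> = ennreal (g k (j k \<omega>) + B)" if \<omega>: "0 \<le> \<omega>" "\<omega> < 1" for k \<omega>
    proof -
      have "indicator {F k i..<F k (Suc i)} \<omega> = (if i = j k \<omega> then 1 else 0 :: ennreal)" for i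
      proof (cases "i = j k \<omega>")
        case True then show ?thesis using j1[OF \<omega>, of k] j2[OF \<omega>, of k] by simp
      next
        case False
        then have "\<omega> \<notin> {F k i..<F k (Suc i)}" using juniq[of k i \<omega>] by fastforce
        then show ?thesis using False by simp
      qed
      then have "u k \<omega> = (\<Sum>i<P k. if i = j k \<omega> then ennreal (g k i + B) else 0)"
        unfolding u_def by (intro sum.cong refl) simp
      then show ?thesis using j3[OF \<omega>, of k] by simp
    qed
    have u_int: "(\<integral>\<^sup>+ \<omega>. u k \<omega> \<partial>lborel) \<le> ennreal (L f + B)" for k
    proof -
      have "(\<integral>\<^sup>+ \<omega>. u k \<omega> \<partial>lborel) = (\<Sum>i<P k. ennreal (g k i + B) * ennreal (m k i))"
      proof -
        have "(\<integral>\<^sup>+ \<omega>. u k \<omega> \<partial>lborel) = (\<Sum>i<P k. \<integral>\<^sup>+ \<omega>. ennreal (g k i + B) * indicator {F k i..<F k (Suc i)} \<omega> \<partial>lborel)"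
          unfolding u_def by (rule nn_integral_sum) measurable
        also have "\<dots> = (\<Sum>i<P k. ennreal (g k i + B) * ennreal (m k i))"
        proof (rule sum.cong[OF refl])
          fix i
          have "emeasure lborel {F k i..<F k (Suc i)} = ennreal (F k (Suc i) - F k i)"
            by (rule emeasure_lborel_Ico) (rule Fmono, simp)
          also have "F k (Suc i) - F k i = m k i" using Fm[of k i] by simp
          finally show "(\<integral>\<^sup>+ \<omega>. ennreal (g k i + B) * indicator {F k i..<F k (Suc i)} \<omega> \<partial>lborel)
              = ennreal (g k i + B) * ennreal (m k i)"
            by (subst nn_integral_cmult_indicator) simp_all
        qed
        finally show ?thesis .
      qed
      also have "\<dots> = (\<Sum>i<P k. ennreal ((g k i + B) * m k i))"
        by (intro sum.cong refl ennreal_mult[symmetric] gp m0)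
      also have "\<dots> = ennreal (\<Sum>i<P k. (g k i + B) * m k i)"
        by (intro sum_ennreal mult_nonneg_nonneg gp m0)
      also have "(\<Sum>i<P k. (g k i + B) * m k i) = L (\<lambda>y. \<Sum>i<P k. (g k i + B) * indicator (S k i) y)"
        unfolding m_def S_def by (rule sum[symmetric]) (auto intro: bdd_fun_indicator)
      also have "\<dots> \<le> L (\<lambda>y. f y + B)"
      proof (rule mono)
        show "bdd_fun (\<lambda>y. \<Sum>i<P k. (g k i + B) * indicator (S k i) y)"
          by (rule bdd_fun_sum) (auto intro: bdd_fun_indicator)
        show "bdd_fun (\<lambda>y. f y + B)" by (intro bdd_fun_add bdd_fun_const bdd_funI[OF B])
        fix y assume y: "y \<in> K"
        have "(\<Sum>i<P k. (g k i + B) * indicator (S k i) y) = (\<Sum>i<P k. if i = N k y then g k i + B else 0)"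
          using y by (intro sum.cong refl) (auto simp: S_def indicator_def)
        also have "\<dots> = g k (N k y) + B" using NP[of k y] by simp
        finally show "(\<Sum>i<P k. (g k i + B) * indicator (S k i) y) \<le> f y + B" using gf[OF y] by simp
      qed
      also have "\<dots> = L f + B"
        using add[OF bdd_funI[OF B] bdd_fun_const] const by simp
      finally show ?thesis by (simp add: ennreal_leI)
    qed
    \<comment> \<open>The limit \<open>Y \<omega>\<close> need not lie in any of the cells of
      \<open>\<omega>\<close>, but they shrink towards it, so lower semicontinuity keeps their
      infima eventually above each \<open>a < f (Y \<omega>)\<close>. Fatou's lemma then gives the
      inequality for the integrals.\<close>
    have lower: "ennreal (f (Y \<omega>) + B) \<le> liminf (\<lambda>k. u k \<omega>)" if \<omega>: "0 \<le> \<omega>" "\<omega> < 1" for \<omega>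
      unfolding le_Liminf_iff
    proof (intro allI impI)
      fix t assume t: "t < ennreal (f (Y \<omega>) + B)"
      define s where "s = enn2real t"
      have "t < top" using t by (rule order_less_le_trans) simp
      then have ts: "t = ennreal s" "s \<ge> 0" by (simp_all add: s_def)
      have "s - B < f (Y \<omega>)" using t ts by (simp add: ennreal_less_iff)
      then obtain a where a: "s - B < a" "a < f (Y \<omega>)" using dense by blast
      obtain e where e: "e > 0" "\<And>z. z \<in> K \<Longrightarrow> dist (Y \<omega>) z < e \<Longrightarrow> a < f z"
        using lsc[OF Y(1) a(2)] by blast
      have "(\<lambda>k. 4 * (1 / 2) ^ k) \<longlonglongrightarrow> (0::real)" by real_asymp
      then have "\<forall>\<^sub>F k in sequentially. 4 * (1 / 2) ^ k < e" by (rule order_tendstoD(2)[OF _ e(1)])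
      then have "\<forall>\<^sub>F k in sequentially. t < u (Suc k) \<omega>"
      proof eventually_elim
        case (elim k)
        have ne: "S (Suc k) (j (Suc k) \<omega>) \<noteq> {}" using cell[OF \<omega>, of "Suc k"] by (auto simp: S_def)
        have "a \<le> f z" if z: "z \<in> S (Suc k) (j (Suc k) \<omega>)" for z
        proof -
          have zK: "z \<in> K" "N (Suc k) z = N (Suc k) (X (Suc k) \<omega>)" using z NX[OF \<omega>] by (auto simp: S_def)
          have "dist z (X (Suc k) \<omega>) < 2 * (1 / 2) ^ k" by (rule Ndist[OF zK(1) XK zK(2)])
          then have "dist (Y \<omega>) z < e"
            using XY[of k \<omega>] elim dist_triangle3[of "Y \<omega>" z "X (Suc k) \<omega>"] by (simp add: dist_commute)
          then show ?thesis using e(2)[OF zK(1)] by simp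
        qed
        then have "a \<le> g (Suc k) (j (Suc k) \<omega>)" using ne by (auto simp: g_def intro!: cInf_greatest)
        then have "s < g (Suc k) (j (Suc k) \<omega>) + B" using a(1) by simp
        then show ?case unfolding u_in[OF \<omega>] ts(1) using ts(2) by (simp add: ennreal_less_iff)
      qed
      then show "\<forall>\<^sub>F k in sequentially. t < u k \<omega>" by (subst (asm) eventually_sequentially_Suc)
    qed
    have "(\<integral>\<^sup>+ y. ennreal (f y + B) \<partial>\<nu>) = (\<integral>\<^sup>+ \<omega>. ennreal (f (Y \<omega>) + B) * indicator {0..<1} \<omega> \<partial>lborel)"
      unfolding \<nu>_def by (subst nn_integral_distr) (auto simp: M0_def nn_integral_density mult.commute)
    also have "\<dots> \<le> (\<integral>\<^sup>+ \<omega>. liminf (\<lambda>k. u k \<omega>) \<partial>lborel)"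
      by (rule nn_integral_mono) (use lower in \<open>auto simp: indicator_def\<close>)
    also have "\<dots> \<le> liminf (\<lambda>k. \<integral>\<^sup>+ \<omega>. u k \<omega> \<partial>lborel)"
      by (rule nn_integral_liminf) (unfold u_def, measurable)
    also have "\<dots> \<le> liminf (\<lambda>k::nat. ennreal (L f + B))"
      by (rule Liminf_mono) (simp add: u_int)
    also have "\<dots> = ennreal (L f + B)" by (simp add: Liminf_const)
    finally have le: "(\<integral>\<^sup>+ y. ennreal (f y + B) \<partial>\<nu>) \<le> ennreal (L f + B)" .
    have LB: "0 \<le> L f + B"
    proof -
      have "L (\<lambda>_. - B) \<le> L f" by (rule mono[OF bdd_fun_const bdd_funI[OF B]]) (rule B')
      then show ?thesis using const[of "- B"] by simp
    qed
    interpret finite_measure \<nu> by (rule finite_measureI) (simp add: mass)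
    have f\<nu>: "f \<in> borel_measurable \<nu>" using fm measurable_cong_sets[OF sets refl] by blast
    have fi: "integrable \<nu> f"
      by (rule integrable_const_bound[where B=B]) (use B f\<nu> in auto)
    have "(\<integral>\<^sup>+ y. ennreal (f y + B) \<partial>\<nu>) = ennreal (\<integral>y. f y + B \<partial>\<nu>)"
    proof (rule nn_integral_eq_integral)
      show "integrable \<nu> (\<lambda>y. f y + B)" using fi by simp
      show "AE y in \<nu>. 0 \<le> f y + B"
      proof (rule AE_I2)
        show "0 \<le> f y + B" for y using B'(1)[of y] by linarith
      qed
    qed
    also have "(\<integral>y. f y + B \<partial>\<nu>) = (\<integral>y. f y \<partial>\<nu>) + B"
      using fi mass by (simp add: measure_def)
    finally show ?thesis using le LB by (simp add: ennreal_le_iff)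
  qed
  show thesis by (rule that[OF sets mass null main])
qed

end

section \<open>From open neighbourhoods to domains\<close>

text \<open>One component is joined to the others by a tube around a shortest segment, which meets the
  open set only near its end points.\<close>

lemma enlarge_to_domain:
  fixes x :: "'a::euclidean_space" and L :: real
  assumes dim: "DIM('a) \<ge> 2"
  shows "finite F \<Longrightarrow> (\<forall>C\<in>F. open C \<and> connected C \<and> C \<noteq> {} \<and> bounded C) \<Longrightarrow> x \<in> \<Union>F \<Longrightarrow> bsuperharmonic (\<Union>F) g \<Longrightarrow>
    (\<forall>y\<in>\<Union>F. 0 \<le> g y \<and> g y \<le> L) \<Longrightarrow> \<epsilon> > 0 \<Longrightarrow>
    \<exists>W g'. domain_set W \<and> \<Union>F \<subseteq> W \<and> bsuperharmonic W g' \<and> (\<forall>y\<in>\<Union>F. g y \<le> g' y) \<and> g' x \<le> g x + \<epsilon>"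
proof (induction "card F" arbitrary: F g \<epsilon> rule: less_induct)
  case less
  note fin = less.prems(1) and FC = less.prems(2) and xF = less.prems(3) and g = less.prems(4)
    and gL = less.prems(5) and e = less.prems(6)
  obtain C1 where C1: "C1 \<in> F" using xF by blast
  define F' where "F' = F - {C1}"
  define R where "R = \<Union>F'"
  have UF: "\<Union>F = C1 \<union> R" using C1 by (auto simp: F'_def R_def)
  have finF': "finite F'" using fin by (simp add: F'_def)
  have cardF': "card F = Suc (card F')" using card_Suc_Diff1[OF fin C1] by (simp add: F'_def)
  show ?case
  proof (cases "F' = {}")
    case True
    then have "\<Union>F = C1" using UF by (simp add: R_def)
    moreover have "domain_set C1" using FC C1 by (simp add: domain_set_def)
    ultimately show ?thesis using g e by (intro exI[of _ C1] exI[of _ g]) auto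
  next
    case F'ne: False
    have reduce: "card (insert D (F' - {C2})) < card F" if "C2 \<in> F'" for D C2
    proof -
      have "card (insert D (F' - {C2})) \<le> Suc (card (F' - {C2}))" by (rule card_insert_le_m1) auto
      also have "\<dots> = card F'" using card_Suc_Diff1[OF finF' that] by simp
      finally show ?thesis using cardF' by simp
    qed
    have good': "open C \<and> connected C \<and> C \<noteq> {} \<and> bounded C" if "C \<in> F'" for C
      using FC that by (simp add: F'_def)
    have goodC1: "open C1" "connected C1" "C1 \<noteq> {}" "bounded C1" using FC C1 by blast+
    have oR: "open R" using good' by (auto simp: R_def)
    show ?thesis
    \<comment> \<open>Overlapping members are merged at no cost; a tube is needed only when
      \<open>C1\<close> is disjoint from all the others.\<close>
    proof (cases "C1 \<inter> R = {}")
      case False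
      then obtain C2 where C2: "C2 \<in> F'" "C1 \<inter> C2 \<noteq> {}" by (auto simp: R_def)
      define F2 where "F2 = insert (C1 \<union> C2) (F' - {C2})"
      have U2: "\<Union>F2 = \<Union>F" using C2(1) unfolding UF R_def F2_def by blast
      have "\<forall>C\<in>F2. open C \<and> connected C \<and> C \<noteq> {} \<and> bounded C"
        using good' good'[OF C2(1)] goodC1 C2(2) by (auto simp: F2_def connected_Un)
      moreover have "finite F2" using finF' by (simp add: F2_def)
      ultimately show ?thesis
        using less.hyps[of F2 g \<epsilon>] reduce[OF C2(1)] xF g gL e unfolding U2 by (simp add: F2_def)
    next
      case disj: True
      define X where "X = closure C1"
      define Y where "Y = closure R"
      have bR: "bounded R" using finF' good' by (auto simp: R_def intro: bounded_Union)
      have cX: "compact X" and cY: "compact Y"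
        using goodC1(4) bR by (auto simp: X_def Y_def compact_closure)
      have Rne: "R \<noteq> {}" using F'ne good' by (auto simp: R_def)
      have "X \<times> Y \<noteq> {}" using goodC1(3) Rne closure_subset by (auto simp: X_def Y_def)
      moreover have "continuous_on (X \<times> Y) (\<lambda>z. dist (fst z) (snd z))" by (intro continuous_intros)
      \<comment> \<open>A nearest pair of the two closures: by minimality the segment between them
        meets \<open>X\<close> only at \<open>p\<close> and \<open>Y\<close> only at
        \<open>q\<close>. Touching closures, with \<open>p = q\<close>, are included.\<close>
      ultimately obtain pq where pq: "pq \<in> X \<times> Y" "\<forall>z\<in>X \<times> Y. dist (fst pq) (snd pq) \<le> dist (fst z) (snd z)"
        using continuous_attains_inf[OF compact_Times[OF cX cY]] by blast
      define p where "p = fst pq"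
      define q where "q = snd pq"
      have p: "p \<in> X" and q: "q \<in> Y" using pq(1) by (auto simp: p_def q_def)
      have min: "dist p q \<le> dist a c" if "a \<in> X" "c \<in> Y" for a c
        using bspec[OF pq(2), of "(a, c)"] that by (simp add: p_def q_def)
      have segX: "z = p" if "z \<in> closed_segment p q" "z \<in> X" for z
      proof -
        have "dist p q = dist p z + dist z q"
          using that(1) unfolding between_mem_segment[symmetric] between by simp
        then show ?thesis using min[OF that(2) q] by simp
      qed
      have segY: "z = q" if "z \<in> closed_segment p q" "z \<in> Y" for z
      proof -
        have "dist p q = dist p z + dist z q"
          using that(1) unfolding between_mem_segment[symmetric] between by simp
        then show ?thesis using min[OF p that(2)] by simp
      qed
      have C1Y: "C1 \<inter> Y = {}" using disj goodC1(1) unfolding Y_def by (simp add: open_Int_closure_eq_empty)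
      have RX: "R \<inter> X = {}" using disj oR unfolding X_def by (simp add: open_Int_closure_eq_empty Int_commute)
      have near: "\<exists>z\<in>closed_segment a c. z \<noteq> a \<and> z \<in> G" if Ga: "open G" "a \<in> G" and ac: "a \<noteq> c" for a c :: 'a and G
      proof -
        obtain r where r: "r > 0" "ball a r \<subseteq> G" by (rule openE[OF Ga])
        define t where "t = min 1 (r / (2 * dist a c))"
        have d: "dist a c > 0" using ac by simp
        have t: "0 < t" "t \<le> 1" "t * dist a c < r"
        proof -
          show "0 < t" "t \<le> 1" using r d by (auto simp: t_def)
          have "t * dist a c \<le> r / (2 * dist a c) * dist a c" using d by (intro mult_right_mono) (auto simp: t_def)
          also have "\<dots> < r" using d r by simp
          finally show "t * dist a c < r" .
        qed
        let ?z = "(1 - t) *\<^sub>R a + t *\<^sub>R c"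
        have za: "?z - a = t *\<^sub>R (c - a)" by (simp add: algebra_simps)
        have "dist a ?z = norm (?z - a)" unfolding dist_norm by (rule norm_minus_commute)
        also have "\<dots> = t * norm (c - a)" unfolding za using t by simp
        also have "norm (c - a) = dist a c" unfolding dist_norm by (rule norm_minus_commute)
        finally have dz: "dist a ?z = t * dist a c" .
        have "?z \<in> closed_segment a c" using t(1,2) unfolding in_segment by (intro exI[of _ t]) simp
        moreover have "?z \<noteq> a" using dz t d by auto
        moreover have "?z \<in> G" using dz t r by auto
        ultimately show ?thesis by blast
      qed
      \<comment> \<open>An end point inside the open set could be moved along the segment, against
        minimality. Hence \<open>p\<close> and \<open>q\<close> differ from \<open>x\<close>, and
        polar functions at them can be small at \<open>x\<close>.\<close>
      have pF: "p \<notin> \<Union>F"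
      proof
        assume "p \<in> \<Union>F"
        then have "p \<in> C1" using p RX UF by auto
        then have "p \<noteq> q" using q C1Y by auto
        then obtain z where "z \<in> closed_segment p q" "z \<noteq> p" "z \<in> C1"
          using near[OF goodC1(1) \<open>p \<in> C1\<close>] by blast
        then show False using segX closure_subset by (auto simp: X_def)
      qed
      have qF: "q \<notin> \<Union>F"
      proof
        assume "q \<in> \<Union>F"
        then have "q \<in> R" using q C1Y UF by auto
        then have "q \<noteq> p" using p RX by auto
        then obtain z where "z \<in> closed_segment q p" "z \<noteq> q" "z \<in> R"
          using near[OF oR \<open>q \<in> R\<close>] by blast
        then show False using segY closure_subset by (auto simp: Y_def closed_segment_commute)
      qed
      have bF: "bounded (\<Union>F)" using UF goodC1(4) bR by simp
      obtain D1 where D1: "\<And>y. y \<in> \<Union>F \<Longrightarrow> dist p y \<le> D1" using bF bounded_any_center by metis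
      obtain D2 where D2: "\<And>y. y \<in> \<Union>F \<Longrightarrow> dist q y \<le> D2" using bF bounded_any_center by metis
      define D where "D = max D1 D2 + 1"
      have sub: "\<Union>F \<subseteq> ball p D" "\<Union>F \<subseteq> ball q D" using D1 D2 by (force simp: D_def)+
      have xp: "x \<noteq> p" "x \<noteq> q" using pF qF xF by auto
      have xD: "dist p x < D" "dist q x < D" using xF sub by auto
      \<comment> \<open>The two polar functions cost at most half of \<open>\<epsilon>\<close>; the
        other half is left to the induction.\<close>
      have e4: "\<epsilon> / 4 > 0" using e by simp
      have polar: "\<exists>v \<delta>. \<delta> > 0 \<and> bsuperharmonic (ball c D) v \<and> (\<forall>y\<in>ball c D. 0 \<le> v y) \<and> (\<forall>y\<in>ball c \<delta>. L \<le> v y) \<and> v x \<le> \<epsilon> / 4"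
        if "x \<noteq> c" "dist c x < D" for c
        by (rule polar_function[OF dim that e4, of L]) blast
      obtain vp \<delta>p where vp: "\<delta>p > 0" "bsuperharmonic (ball p D) vp" "\<forall>y\<in>ball p D. 0 \<le> vp y"
          "\<forall>y\<in>ball p \<delta>p. L \<le> vp y" "vp x \<le> \<epsilon> / 4"
        using polar[OF xp(1) xD(1)] by blast
      obtain vq \<delta>q where vq: "\<delta>q > 0" "bsuperharmonic (ball q D) vq" "\<forall>y\<in>ball q D. 0 \<le> vq y"
          "\<forall>y\<in>ball q \<delta>q. L \<le> vq y" "vq x \<le> \<epsilon> / 4"
        using polar[OF xp(2) xD(2)] by blast
      define \<delta> where "\<delta> = min \<delta>p \<delta>q"
      have \<delta>: "\<delta> > 0" "\<delta> \<le> \<delta>p" "\<delta> \<le> \<delta>q" using vp(1) vq(1) by (auto simp: \<delta>_def)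
      define S where "S = closed_segment p q"
      \<comment> \<open>Away from its ends the segment has positive distance from both closures, so
        a thin enough tube meets the open set only within \<open>\<delta>\<close> of
        \<open>p\<close> or \<open>q\<close>.\<close>
      define S' where "S' = S - (ball p (\<delta> / 2) \<union> ball q (\<delta> / 2))"
      have "compact S'" unfolding S'_def S_def by (intro compact_diff compact_segment open_Un open_ball)
      moreover have "closed (X \<union> Y)" unfolding X_def Y_def by (intro closed_Un closed_closure)
      moreover have "S' \<inter> (X \<union> Y) = {}"
        using segX segY \<delta>(1) unfolding S'_def S_def by fastforce
      ultimately obtain \<eta>0 where \<eta>0: "\<eta>0 > 0" "\<forall>a\<in>S'. \<forall>c\<in>X \<union> Y. \<eta>0 \<le> dist a c"
        using separate_compact_closed by metis
      define \<eta> where "\<eta> = min \<eta>0 (\<delta> / 2)"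
      have \<eta>: "\<eta> > 0" "\<eta> \<le> \<eta>0" "\<eta> \<le> \<delta> / 2" using \<eta>0(1) \<delta>(1) by (auto simp: \<eta>_def)
      \<comment> \<open>The \<open>\<eta>\<close>-neighbourhood of \<open>S\<close>; adding all of
        \<open>S\<close> to each ball gives the pieces a common point, so that connectedness is
        immediate.\<close>
      define T where "T = (\<Union>z\<in>S. S \<union> ball z \<eta>)"
      have pqS: "p \<in> S" "q \<in> S" by (auto simp: S_def)
      have T_eq: "T = (\<Union>z\<in>S. ball z \<eta>)" using \<eta>(1) pqS by (auto simp: T_def)
      have oT: "open T" unfolding T_eq by auto
      have pqT: "p \<in> T" "q \<in> T" using pqS by (auto simp: T_def)
      have conT: "connected T" unfolding T_def
      proof (rule connected_Union)
        show "connected s" if s: "s \<in> (\<lambda>z. S \<union> ball z \<eta>) ` S" for s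
        proof -
          obtain z where z: "z \<in> S" "s = S \<union> ball z \<eta>" using s by blast
          then show ?thesis using \<eta>(1)
            by (auto simp: S_def intro!: connected_Un)
        qed
        show "\<Inter> ((\<lambda>z. S \<union> ball z \<eta>) ` S) \<noteq> {}" using pqS by blast
      qed
      have bT: "bounded T"
      proof -
        have "bounded S" by (simp add: S_def bounded_closed_segment)
        then obtain b where b: "\<And>z. z \<in> S \<Longrightarrow> dist p z \<le> b" using bounded_any_center by metis
        have "dist p y \<le> b + \<eta>" if "y \<in> T" for y
        proof -
          obtain z where z: "z \<in> S" "dist z y < \<eta>" using \<open>y \<in> T\<close> by (auto simp: T_eq)
          then show ?thesis using b[OF z(1)] dist_triangle[of p y z] by linarith
        qed
        then show ?thesis unfolding bounded_def by blast
      qed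
      have TF: "y \<in> ball p \<delta> \<or> y \<in> ball q \<delta>" if y: "y \<in> T" "y \<in> \<Union>F" for y
      proof -
        obtain z where z: "z \<in> S" "dist z y < \<eta>" using y(1) by (auto simp: T_eq)
        have "y \<in> X \<union> Y" using y(2) UF closure_subset unfolding X_def Y_def by blast
        then have "z \<notin> S'" using \<eta>0(2) z(2) \<eta>(2) by force
        then have "dist p z < \<delta> / 2 \<or> dist q z < \<delta> / 2" using z(1) by (auto simp: S'_def)
        then show ?thesis using z(2) \<eta>(3) dist_triangle[of p y z] dist_triangle[of q y z] by auto
      qed
      \<comment> \<open>Where the tube meets the old set, one of the polar functions is at least
        \<open>L\<close>, so the minimum equals \<open>L\<close> and continues the constant on the
        tube.\<close>
      define g1 where "g1 y = (if y \<in> \<Union>F then min (g y + (vp y + vq y)) L else L)" for y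
      have oF: "open (\<Union>F)" using UF goodC1(1) oR by auto
      have v0: "0 \<le> vp y" "0 \<le> vq y" if "y \<in> \<Union>F" for y using vp(3) vq(3) sub that by blast+
      have "bsuperharmonic (\<Union>F) (\<lambda>y. min (g y + (vp y + vq y)) L)"
        by (intro bsuperharmonic_min bsuperharmonic_add g bsuperharmonic_const oF bsuperharmonic_subset[OF vp(2)] bsuperharmonic_subset[OF vq(2)] sub)
      then have g1F: "bsuperharmonic (\<Union>F) g1" by (rule bsuperharmonic_cong) (simp only: g1_def if_True)
      have g1T: "g1 y = L" if "y \<in> T" for y
      proof (cases "y \<in> \<Union>F")
        case True
        have "L \<le> vp y \<or> L \<le> vq y"
          using TF[OF that True] vp(4) vq(4) \<delta> by auto
        then have "L \<le> g y + (vp y + vq y)" using v0[OF True] gL True by fastforce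
        then show ?thesis by (simp add: g1_def)
      next
        case False then show ?thesis by (simp only: g1_def if_False)
      qed
      have "bsuperharmonic T g1" by (rule bsuperharmonic_cong[OF bsuperharmonic_const[OF oT, of L]]) (simp add: g1T)
      then have g1: "bsuperharmonic (\<Union>F \<union> T) g1" by (rule bsuperharmonic_Un[OF g1F])
      \<comment> \<open>\<open>q\<close> is in the closure of a finite union, hence in the closure
        of a single member \<open>C2\<close>, which the tube then meets.\<close>
      have "Y \<subseteq> \<Union>(closure ` F')" unfolding Y_def
      proof (rule closure_minimal)
        show "R \<subseteq> \<Union>(closure ` F')" unfolding R_def using closure_subset by blast
        show "closed (\<Union>(closure ` F'))" using finF' by (intro closed_Union) auto
      qed
      then obtain C2 where C2: "C2 \<in> F'" "q \<in> closure C2" using q by blast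
      define F2 where "F2 = insert (C1 \<union> T \<union> C2) (F' - {C2})"
      have U2: "\<Union>F2 = \<Union>F \<union> T" using C2(1) unfolding UF R_def F2_def by blast
      have m1: "C1 \<inter> T \<noteq> {}"
        using p pqT oT unfolding X_def by (metis Int_commute closure_iff_nhds_not_empty disjoint_iff open_Int_closure_eq_empty)
      have m2: "T \<inter> C2 \<noteq> {}"
        using C2(2) pqT oT by (metis disjoint_iff open_Int_closure_eq_empty)
      have con: "connected (C1 \<union> T \<union> C2)"
        using goodC1(2) good'[OF C2(1)] conT m1 m2 by (intro connected_Un) auto
      have good2: "\<forall>C\<in>F2. open C \<and> connected C \<and> C \<noteq> {} \<and> bounded C"
        using good' good'[OF C2(1)] goodC1 oT bT con by (auto simp: F2_def)
      have fin2: "finite F2" using finF' by (simp add: F2_def)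
      have g1L: "\<forall>y\<in>\<Union>F2. 0 \<le> g1 y \<and> g1 y \<le> L"
      proof
        fix y assume "y \<in> \<Union>F2"
        have L0: "0 \<le> L" using gL xF by force
        then show "0 \<le> g1 y \<and> g1 y \<le> L"
          using v0[of y] gL by (cases "y \<in> \<Union>F") (auto simp only: g1_def if_True if_False min_def, auto)
      qed
      have "\<exists>W g'. domain_set W \<and> \<Union>F2 \<subseteq> W \<and> bsuperharmonic W g' \<and> (\<forall>y\<in>\<Union>F2. g1 y \<le> g' y) \<and> g' x \<le> g1 x + \<epsilon> / 2"
      proof (rule less.hyps[OF _ fin2 good2 _ _ g1L])
        show "card F2 < card F" unfolding F2_def by (rule reduce[OF C2(1)])
        show "x \<in> \<Union>F2" using xF U2 by auto
        show "bsuperharmonic (\<Union>F2) g1" unfolding U2 by (rule g1)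
      qed (use e in simp)
      then obtain W g' where W: "domain_set W" "\<Union>F2 \<subseteq> W" "bsuperharmonic W g'" "\<And>y. y \<in> \<Union>F2 \<Longrightarrow> g1 y \<le> g' y"
        "g' x \<le> g1 x + \<epsilon> / 2" by blast
      have "g y \<le> g' y" if y: "y \<in> \<Union>F" for y
      proof -
        have "g1 y = min (g y + (vp y + vq y)) L" using y by (simp only: g1_def if_True)
        then have "g y \<le> g1 y" using v0[OF y] gL y by auto
        then show ?thesis using W(4)[of y] y U2 by auto
      qed
      moreover have "g' x \<le> g x + \<epsilon>"
      proof -
        have "g1 x = min (g x + (vp x + vq x)) L" using xF by (simp only: g1_def if_True)
        then show ?thesis using W(5) vp(5) vq(5) by linarith
      qed
      ultimately show ?thesis using W(1-3) U2 by (intro exI[of _ W] exI[of _ g']) auto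
    qed
  qed
qed

text \<open>\<open>jensen_cpt\<close> tests domains only, whereas the glued functions live on open
  neighbourhoods that may be disconnected. Finitely many balls covering \<open>K\<close> replace
  \<open>W\<close>, the constant \<open>B\<close> makes the function nonnegative, and
  \<open>enlarge_to_domain\<close> gives a majorant on a domain that is larger at \<open>x\<close>
  by at most \<open>e\<close>.\<close>

lemma jensen_cpt_bsh:
  fixes x :: "'a::euclidean_space"
  assumes dim: "DIM('a) \<ge> 2" and K: "compact K" "x \<in> K" and M: "M \<in> jensen_cpt x K" "msupp M \<subseteq> K"
    and W: "K \<subseteq> W" and g: "bsuperharmonic W g"
  shows "(\<integral>y. indicator (msupp M) y * g y \<partial>M) \<le> g x"
proof (rule field_le_epsilon)
  fix e :: real assume e: "e > 0"
  obtain B where B: "\<And>y. y \<in> W \<Longrightarrow> \<bar>g y\<bar> \<le> B" using bsuperharmonicD(2)[OF g] by blast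
  have oW: "open W" by (rule bsuperharmonicD(1)[OF g])
  have "\<forall>y\<in>K. \<exists>r>0. ball y r \<subseteq> W" using oW W openE by (metis subsetD)
  then obtain r where r: "\<And>y. y \<in> K \<Longrightarrow> r y > 0 \<and> ball y (r y) \<subseteq> W" by metis
  have "K \<subseteq> (\<Union>y\<in>K. ball y (r y))" using r by (meson UN_I centre_in_ball subsetI)
  then obtain K' where K': "K' \<subseteq> K" "finite K'" "K \<subseteq> (\<Union>y\<in>K'. ball y (r y))"
    using compactE_image[OF K(1), of K "\<lambda>y. ball y (r y)"] by (metis open_ball)
  define F where "F = (\<lambda>y. ball y (r y)) ` K'"
  have UW: "\<Union>F \<subseteq> W" using r K'(1) by (auto simp: F_def subset_iff)
  have KF: "K \<subseteq> \<Union>F" using K'(3) by (simp add: F_def)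
  have oF: "open (\<Union>F)" by (auto simp: F_def)
  have 1: "finite F" using K'(2) by (simp add: F_def)
  have 2: "\<forall>C\<in>F. open C \<and> connected C \<and> C \<noteq> {} \<and> bounded C"
  proof
    fix C assume "C \<in> F"
    then obtain y where "y \<in> K" "C = ball y (r y)" using K'(1) by (auto simp: F_def)
    then show "open C \<and> connected C \<and> C \<noteq> {} \<and> bounded C" using r[of y] by (simp add: not_le)
  qed
  have 3: "x \<in> \<Union>F" using KF K(2) by blast
  have 4: "bsuperharmonic (\<Union>F) (\<lambda>y. g y + B)" by (intro bsuperharmonic_add bsuperharmonic_const oF bsuperharmonic_subset[OF g oF UW])
  have 5: "\<forall>y\<in>\<Union>F. 0 \<le> g y + B \<and> g y + B \<le> 2 * B"
  proof
    fix y assume "y \<in> \<Union>F"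
    then have "\<bar>g y\<bar> \<le> B" using B UW by blast
    then show "0 \<le> g y + B \<and> g y + B \<le> 2 * B" by linarith
  qed
  obtain W' g' where W': "domain_set W'" "\<Union>F \<subseteq> W'" "bsuperharmonic W' g'" "\<And>y. y \<in> \<Union>F \<Longrightarrow> g y + B \<le> g' y"
    "g' x \<le> g x + B + e"
    using enlarge_to_domain[OF dim 1 2 3 4 5 e] by blast
  have J: "M \<in> jensen_dom x W'" using M(1) W' KF by (auto simp: jensen_cpt_def)
  note facts = jensen_dom_facts[OF J W'(1)]
  have fin: "emeasure M (space M) < \<infinity>" using facts(4) by simp
  have int: "integrable M (\<lambda>y. indicator (msupp M) y * h y)" if h: "bsuperharmonic V h" "msupp M \<subseteq> V" for h V
  proof -
    obtain b where b: "\<And>y. y \<in> V \<Longrightarrow> \<bar>h y\<bar> \<le> b" using bsuperharmonicD(2)[OF h(1)] by blast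
    have [measurable]: "(\<lambda>y. indicator V y * h y) \<in> borel_measurable borel"
      by (rule lsc_borel[OF bsuperharmonicD(1,3)[OF h(1)]])
    have [measurable]: "msupp M \<in> sets borel" using facts(2) by (simp add: compact_imp_closed)
    have eq: "(\<lambda>y. indicator (msupp M) y * h y) = (\<lambda>y. indicator (msupp M) y * (indicator V y * h y))"
      using h(2) by (auto simp: fun_eq_iff indicator_def)
    have "(\<lambda>y. indicator (msupp M) y * h y) \<in> borel_measurable borel" unfolding eq by measurable
    then show ?thesis
      by (rule nn_integral_msupp(3)[OF facts(1) fin, where c="- b" and B=b])
         (use b h(2) in \<open>force+\<close>)
  qed
  have i1: "integrable M (\<lambda>y. indicator (msupp M) y * (g y + B))"
    by (rule int[OF 4]) (use M(2) KF in blast)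
  have "(\<integral>y. indicator (msupp M) y * (g y + B) \<partial>M) \<le> (\<integral>y. indicator (msupp M) y * g' y \<partial>M)"
  proof (rule integral_mono[OF i1 int[OF W'(3)]])
    show "msupp M \<subseteq> W'" using M(2) KF W'(2) by blast
    fix y
    show "indicator (msupp M) y * (g y + B) \<le> indicator (msupp M) y * g' y"
      using W'(4)[of y] M(2) KF by (cases "y \<in> msupp M") auto
  qed
  also have "\<dots> \<le> g' x" by (rule facts(5)[OF W'(3)])
  also have "(\<integral>y. indicator (msupp M) y * (g y + B) \<partial>M) = (\<integral>y. indicator (msupp M) y * g y \<partial>M) + B"
  proof -
    have ig: "integrable M (\<lambda>y. indicator (msupp M) y * g y)"
      by (rule int[OF g]) (use M(2) W in blast)
    have iB: "integrable M (\<lambda>y. indicator (msupp M) y * B)"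
      by (rule int[OF bsuperharmonic_const[OF open_UNIV]]) simp
    have "(\<integral>y. indicator (msupp M) y * B \<partial>M) = B"
      using facts(1,2,4) emeasure_msupp[OF facts(1)] by (simp add: measure_def compact_imp_closed)
    then show ?thesis unfolding distrib_left Bochner_Integration.integral_add[OF ig iB] by simp
  qed
  finally show "(\<integral>y. indicator (msupp M) y * g y \<partial>M) \<le> g x + e" using W'(5) by simp
qed

section \<open>The main theorem\<close>

text \<open>A linear functional below this envelope satisfies Jensen's inequality at
  \<open>x\<close> for every function that is bounded superharmonic near \<open>K\<close>. The
  infimum is finite since \<open>\<phi> x\<close> is a lower bound for \<open>x\<close> in
  \<open>K\<close>; majorants are added on the intersection of their neighbourhoods.\<close>

lemma sublinear_superharmonic_envelope:
  fixes K :: "'a::euclidean_space set"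
  assumes x: "x \<in> K"
  defines "maj \<phi> \<equiv> {u x | W u. K \<subseteq> W \<and> bsuperharmonic W u \<and> (\<forall>y\<in>K. \<phi> y \<le> u y)}"
  shows "sublinear (\<lambda>\<phi>. Inf (maj \<phi>))"
    and "\<And>\<phi> W u. bdd_fun \<phi> \<Longrightarrow> K \<subseteq> W \<Longrightarrow> bsuperharmonic W u \<Longrightarrow> (\<And>y. y \<in> K \<Longrightarrow> \<phi> y \<le> u y) \<Longrightarrow> Inf (maj \<phi>) \<le> u x"
    and "\<And>\<phi> e. bdd_fun \<phi> \<Longrightarrow> (\<And>W u. K \<subseteq> W \<Longrightarrow> bsuperharmonic W u \<Longrightarrow> (\<And>y. y \<in> K \<Longrightarrow> \<phi> y \<le> u y) \<Longrightarrow> e \<le> u x) \<Longrightarrow> e \<le> Inf (maj \<phi>)"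
proof -
  have bb: "bdd_below (maj \<phi>)" for \<phi>
    using x by (intro bdd_belowI[of _ "\<phi> x"]) (auto simp: maj_def)
  have ne: "maj \<phi> \<noteq> {}" if b: "bdd_fun \<phi>" for \<phi>
  proof -
    obtain B where "\<And>y. \<bar>\<phi> y\<bar> \<le> B" using b by (auto simp: bdd_fun_def)
    then have "\<forall>y\<in>K. \<phi> y \<le> B" by (meson abs_le_D1)
    then have "B \<in> maj \<phi>"
      unfolding maj_def using bsuperharmonic_const[OF open_UNIV, of B]
      by (intro CollectI exI[of _ UNIV] exI[of _ "\<lambda>_. B"]) auto
    then show ?thesis by blast
  qed
  show le: "Inf (maj \<phi>) \<le> u x"
    if "bdd_fun \<phi>" "K \<subseteq> W" "bsuperharmonic W u" "\<And>y. y \<in> K \<Longrightarrow> \<phi> y \<le> u y" for \<phi> W u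
    by (rule cInf_lower[OF _ bb]) (use that in \<open>auto simp: maj_def\<close>)
  show ge: "e \<le> Inf (maj \<phi>)"
    if "bdd_fun \<phi>" "\<And>W u. K \<subseteq> W \<Longrightarrow> bsuperharmonic W u \<Longrightarrow> (\<And>y. y \<in> K \<Longrightarrow> \<phi> y \<le> u y) \<Longrightarrow> e \<le> u x" for \<phi> e
    by (rule cInf_greatest[OF ne[OF that(1)]]) (use that(2) in \<open>auto simp: maj_def\<close>)
  have app: "\<exists>W u. K \<subseteq> W \<and> bsuperharmonic W u \<and> (\<forall>y\<in>K. \<phi> y \<le> u y) \<and> u x < Inf (maj \<phi>) + e"
    if b: "bdd_fun \<phi>" and e: "e > 0" for \<phi> e
  proof -
    have "\<exists>s\<in>maj \<phi>. s < Inf (maj \<phi>) + e" using e by (intro cInf_lessD[OF ne[OF b]]) simp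
    then show ?thesis unfolding maj_def by blast
  qed
  have scale1: "Inf (maj (\<lambda>y. c * \<phi> y)) \<le> c * Inf (maj \<phi>)" if b: "bdd_fun \<phi>" and c: "c > 0" for \<phi> c
  proof (rule field_le_epsilon)
    fix e :: real assume e: "e > 0"
    obtain W u where u: "K \<subseteq> W" "bsuperharmonic W u" "\<forall>y\<in>K. \<phi> y \<le> u y" "u x < Inf (maj \<phi>) + e / c"
      using app[OF b, of "e / c"] e c by auto
    have "Inf (maj (\<lambda>y. c * \<phi> y)) \<le> c * u x"
      using u c by (intro le[OF bdd_fun_scale[OF b] u(1) bsuperharmonic_scale[OF u(2)]]) (auto intro: mult_left_mono)
    also have "\<dots> \<le> c * (Inf (maj \<phi>) + e / c)" using u(4) c by (intro mult_left_mono) auto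
    finally show "Inf (maj (\<lambda>y. c * \<phi> y)) \<le> c * Inf (maj \<phi>) + e" using c by (simp add: distrib_left)
  qed
  show "sublinear (\<lambda>\<phi>. Inf (maj \<phi>))" unfolding sublinear_def
  proof (intro conjI allI impI)
    fix \<phi> \<psi> :: "'a \<Rightarrow> real" assume b: "bdd_fun \<phi>" "bdd_fun \<psi>"
    show "Inf (maj (\<lambda>y. \<phi> y + \<psi> y)) \<le> Inf (maj \<phi>) + Inf (maj \<psi>)"
    proof (rule field_le_epsilon)
      fix e :: real assume e: "e > 0"
      obtain W1 u1 where u1: "K \<subseteq> W1" "bsuperharmonic W1 u1" "\<forall>y\<in>K. \<phi> y \<le> u1 y" "u1 x < Inf (maj \<phi>) + e / 2"
        using app[OF b(1), of "e / 2"] e by auto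
      obtain W2 u2 where u2: "K \<subseteq> W2" "bsuperharmonic W2 u2" "\<forall>y\<in>K. \<psi> y \<le> u2 y" "u2 x < Inf (maj \<psi>) + e / 2"
        using app[OF b(2), of "e / 2"] e by auto
      have op: "open (W1 \<inter> W2)" using bsuperharmonicD(1)[OF u1(2)] bsuperharmonicD(1)[OF u2(2)] by auto
      have "bsuperharmonic (W1 \<inter> W2) (\<lambda>y. u1 y + u2 y)"
        by (intro bsuperharmonic_add bsuperharmonic_subset[OF u1(2) op] bsuperharmonic_subset[OF u2(2) op]) auto
      then have "Inf (maj (\<lambda>y. \<phi> y + \<psi> y)) \<le> u1 x + u2 x"
        by (rule le[OF bdd_fun_add[OF b], rotated]) (use u1 u2 in \<open>auto intro: add_mono\<close>)
      then show "Inf (maj (\<lambda>y. \<phi> y + \<psi> y)) \<le> Inf (maj \<phi>) + Inf (maj \<psi>) + e" using u1(4) u2(4) by linarith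
    qed
  next
    fix \<phi> :: "'a \<Rightarrow> real" and c :: real assume b: "bdd_fun \<phi>" and c: "0 < c"
    show "Inf (maj (\<lambda>y. c * \<phi> y)) = c * Inf (maj \<phi>)"
    proof (rule antisym[OF scale1[OF b c]])
      have "Inf (maj (\<lambda>y. (1 / c) * (c * \<phi> y))) \<le> (1 / c) * Inf (maj (\<lambda>y. c * \<phi> y))"
        using c by (intro scale1 bdd_fun_scale b) auto
      then show "c * Inf (maj \<phi>) \<le> Inf (maj (\<lambda>y. c * \<phi> y))" using c by (simp add: field_simps)
    qed
  qed
qed

text \<open>If every majorant of the indicator of \<open>E\<close> were at least \<open>e\<close> at
  \<open>x\<close>, some linear functional below the envelope would be at least \<open>e\<close> on
  this indicator. Its representing measure belongs to \<open>jensen_cpt x K\<close> and gives the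
  closed set \<open>E\<close> mass at least \<open>e\<close>, against the assumption on
  supports.\<close>

lemma small_superharmonic_majorant:
  fixes K E :: "'a::euclidean_space set"
  assumes K: "compact K" "x \<in> K" and E: "closed E"
    and supp: "\<And>\<nu>. \<nu> \<in> jensen_cpt x K \<Longrightarrow> msupp \<nu> \<inter> E = {}" and e: "e > 0"
  obtains W u where "K \<subseteq> W" "bsuperharmonic W u" "\<forall>y\<in>K. indicator E y \<le> u y" "u x < e"
proof (rule ccontr)
  assume "\<not> thesis"
  then have no: "e \<le> u x" if "K \<subseteq> W" "bsuperharmonic W u" "\<And>y. y \<in> K \<Longrightarrow> indicator E y \<le> u y" for W u
    using that \<open>\<not> thesis\<close> \<open>\<And>W u. K \<subseteq> W \<Longrightarrow> bsuperharmonic W u \<Longrightarrow> \<forall>y\<in>K. indicator E y \<le> u y \<Longrightarrow> u x < e \<Longrightarrow> thesis\<close>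
    by (meson not_le)
  define p where "p \<phi> = Inf {u x | W u. K \<subseteq> W \<and> bsuperharmonic W u \<and> (\<forall>y\<in>K. \<phi> y \<le> u y)}" for \<phi>
  note env = sublinear_superharmonic_envelope[OF K(2), folded p_def]
  have pe: "e \<le> p (indicator E)"
  proof (rule env(3)[OF bdd_fun_indicator])
    fix W u assume "K \<subseteq> W" "bsuperharmonic W u" "\<And>y. y \<in> K \<Longrightarrow> indicator E y \<le> u y"
    then show "e \<le> u x" by (rule no)
  qed
  have sp: "sublinear p" using env(1) by (simp add: p_def[abs_def])
  have ple: "p \<phi> \<le> u x" if "bdd_fun \<phi>" "K \<subseteq> W" "bsuperharmonic W u" "\<And>y. y \<in> K \<Longrightarrow> \<phi> y \<le> u y" for \<phi> W u
    by (rule env(2)[OF that])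
  have pc: "p \<phi> \<le> c" if "bdd_fun \<phi>" "\<And>y. y \<in> K \<Longrightarrow> \<phi> y \<le> c" for \<phi> c
    using ple[OF that(1) _ bsuperharmonic_const[OF open_UNIV], of c] that(2) by simp
  obtain L where L: "\<And>\<phi> \<psi>. bdd_fun \<phi> \<Longrightarrow> bdd_fun \<psi> \<Longrightarrow> L (\<lambda>y. \<phi> y + \<psi> y) = L \<phi> + L \<psi>"
    "\<And>\<phi> c. bdd_fun \<phi> \<Longrightarrow> L (\<lambda>y. c * \<phi> y) = c * L \<phi>"
    "\<And>\<phi>. bdd_fun \<phi> \<Longrightarrow> L \<phi> \<le> p \<phi>" "L (indicator E) = p (indicator E)"
    by (rule hahn_banach_bdd_fun[OF sp bdd_fun_indicator[of E]]) blast
  have L1: "L (\<lambda>_. 1) = 1"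
  proof (rule antisym)
    show "L (\<lambda>_. 1) \<le> 1" by (rule order_trans[OF L(3) pc]) (simp_all add: bdd_fun_const)
    have "L (\<lambda>_. - 1) \<le> - 1" by (rule order_trans[OF L(3) pc]) (simp_all add: bdd_fun_const)
    then show "1 \<le> L (\<lambda>_. 1)" using L(2)[OF bdd_fun_const, of "- 1" 1] by simp
  qed
  interpret F: bdd_functional K L
  proof
    show "K \<noteq> {}" using K(2) by blast
    show "L \<phi> \<le> L \<psi>" if b: "bdd_fun \<phi>" "bdd_fun \<psi>" and le: "\<And>y. y \<in> K \<Longrightarrow> \<phi> y \<le> \<psi> y" for \<phi> \<psi>
    proof -
      have bd: "bdd_fun (\<lambda>y. \<phi> y + (- 1) * \<psi> y)" using b by (intro bdd_fun_add bdd_fun_scale)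
      have "L (\<lambda>y. \<phi> y + (- 1) * \<psi> y) \<le> 0" by (rule order_trans[OF L(3)[OF bd] pc[OF bd]]) (use le in simp)
      then show ?thesis using L(1)[OF b(1) bdd_fun_scale[OF b(2)], of "- 1"] L(2)[OF b(2), of "- 1"] by simp
    qed
  qed (fact K L L1)+
  obtain \<nu> :: "'a measure" where \<nu>: "sets \<nu> = sets borel" "emeasure \<nu> (space \<nu>) = 1" "emeasure \<nu> (- K) = 0"
    and \<nu>L: "\<And>f B. f \<in> borel_measurable borel \<Longrightarrow> (\<And>y. \<bar>f y\<bar> \<le> B) \<Longrightarrow>
      (\<And>y a. y \<in> K \<Longrightarrow> a < f y \<Longrightarrow> \<exists>e>0. \<forall>z\<in>K. dist y z < e \<longrightarrow> a < f z) \<Longrightarrow> (\<integral>y. f y \<partial>\<nu>) \<le> L f"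
    by (rule F.representing_measure) blast
  have sub: "msupp \<nu> \<subseteq> K"
  proof
    fix y assume y: "y \<in> msupp \<nu>"
    show "y \<in> K"
    proof (rule ccontr)
      assume "y \<notin> K"
      then obtain r where r: "r > 0" "ball y r \<subseteq> - K"
        using K(1) openE[of "- K" y] by (auto simp: compact_imp_closed open_Compl)
      have "emeasure \<nu> (ball y r) \<le> emeasure \<nu> (- K)"
        using r(2) \<nu>(1) K(1) by (intro emeasure_mono) (auto simp: compact_imp_closed)
      then show False using y r(1) \<nu>(3) by (auto simp: msupp_def)
    qed
  qed
  have cl: "closed (msupp \<nu>)" and nul: "emeasure \<nu> (- msupp \<nu>) = 0" using msupp_null[OF \<nu>(1)] by auto
  have cpt: "compact (msupp \<nu>)" using cl sub K(1) by (metis compact_Int_closed inf.absorb2)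
  have "\<nu> \<in> jensen_dom x U" if U: "domain_set U" "K \<subseteq> U" for U
    unfolding jensen_dom_def radon_cpt_in_def
  proof (intro CollectI conjI allI impI)
    show "emeasure \<nu> C < \<infinity>" for C
    proof -
      have "emeasure \<nu> C \<le> emeasure \<nu> (space \<nu>)" by (rule emeasure_space)
      then show ?thesis using \<nu>(2) by (auto simp: less_top[symmetric] top_unique)
    qed
    fix f assume f: "superharmonic_on U f"
    obtain c where c: "\<And>y. y \<in> K \<Longrightarrow> ereal c < f y"
      by (rule superharmonic_on_bounded_below[OF f K(1) U(2)]) blast
    \<comment> \<open>An open neighbourhood of \<open>K\<close> on which the truncations of
      \<open>f\<close> are bounded. It need not be connected, which the envelope permits.\<close>
    define W where "W = {y\<in>U. ereal c < f y}"
    have W: "open W" "W \<subseteq> U" "K \<subseteq> W" using superharmonic_on_open(2)[OF f] c U(2) by (auto simp: W_def)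
    have cW: "ereal c \<le> f y" if "y \<in> W" for y using that by (simp add: W_def less_imp_le)
    have tr: "bsuperharmonic W (trunc f k)" for k by (rule bsuperharmonic_trunc[OF f W(1,2) cW])
    have [measurable]: "(\<lambda>y. indicator W y * trunc f k y) \<in> borel_measurable borel" for k
      by (rule lsc_borel[OF bsuperharmonicD(1,3)[OF tr]])
    have [measurable]: "msupp \<nu> \<in> sets borel" using cl by simp
    have eq: "(\<lambda>y. indicator (msupp \<nu>) y * trunc f k y) = (\<lambda>y. indicator (msupp \<nu>) y * (indicator W y * trunc f k y))" for k
      using sub W(3) by (auto simp: fun_eq_iff indicator_def)
    show "integral_le \<nu> f (f x)"
    proof (rule integral_leI[OF \<nu>(1,2), where c=c])
      show "ereal c \<le> f y" if "y \<in> msupp \<nu>" for y using c[of y] sub that by (auto intro: less_imp_le)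
      show "ereal c \<le> f x" using c[OF K(2)] by simp
      show "(\<lambda>y. indicator (msupp \<nu>) y * trunc f (real k) y) \<in> borel_measurable borel" for k
        unfolding eq by measurable
      fix k :: nat
      obtain B where B: "\<And>y. y \<in> W \<Longrightarrow> \<bar>trunc f k y\<bar> \<le> B" using bsuperharmonicD(2)[OF tr] by blast
      \<comment> \<open>Extension by 0 makes the truncation a bounded function on the whole space
        without changing it on \<open>K\<close>.\<close>
      define h where "h y = indicator W y * trunc f k y" for y
      have hB: "\<bar>h y\<bar> \<le> \<bar>B\<bar>" for y using B[of y] by (auto simp: h_def indicator_def)
      have hm: "h \<in> borel_measurable borel" unfolding h_def by measurable
      have "(\<integral>y. indicator (msupp \<nu>) y * trunc f k y \<partial>\<nu>) = (\<integral>y. h y \<partial>\<nu>)"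
      proof (rule integral_cong_AE)
        show "(\<lambda>y. indicator (msupp \<nu>) y * trunc f k y) \<in> borel_measurable \<nu>"
          unfolding eq measurable_cong_sets[OF \<nu>(1) refl] by measurable
        show "h \<in> borel_measurable \<nu>" using hm measurable_cong_sets[OF \<nu>(1) refl] by blast
        have "- msupp \<nu> \<in> null_sets \<nu>" using nul cl \<nu>(1) by (simp add: null_sets_def)
        then have "AE y in \<nu>. y \<notin> - msupp \<nu>" by (rule AE_not_in)
        then show "AE y in \<nu>. indicator (msupp \<nu>) y * trunc f k y = h y"
          by eventually_elim (use sub W(3) in \<open>auto simp: h_def indicator_def\<close>)
      qed
      also have "\<dots> \<le> L h"
      proof (rule \<nu>L[OF hm hB])
        fix y a assume y: "y \<in> K" "a < h y"
        then have "y \<in> {z\<in>W. a < trunc f k z}" using W(3) by (auto simp: h_def)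
        then obtain r where r: "r > 0" "ball y r \<subseteq> {z\<in>W. a < trunc f k z}"
          using openE[OF bsuperharmonicD(3)[OF tr]] by metis
        have "a < h z" if "z \<in> K" "dist y z < r" for z
        proof -
          have "z \<in> {z\<in>W. a < trunc f k z}" using r(2) that(2) by auto
          then show ?thesis by (simp add: h_def)
        qed
        then show "\<exists>e>0. \<forall>z\<in>K. dist y z < e \<longrightarrow> a < h z" using r(1) by blast
      qed
      also have "\<dots> \<le> p h" by (rule L(3)[OF bdd_funI[OF hB]])
      also have "\<dots> \<le> trunc f k x"
        by (rule ple[OF bdd_funI[OF hB] W(3) tr]) (use W(3) in \<open>auto simp: h_def indicator_def\<close>)
      finally have "ereal (\<integral>y. indicator (msupp \<nu>) y * trunc f k y \<partial>\<nu>) \<le> ereal (trunc f k x)" by simp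
      also have "\<dots> \<le> f x" by (rule ereal_trunc(3)[where f=f, OF cW]) (use K(2) W(3) in blast)
      finally show "ereal (\<integral>y. indicator (msupp \<nu>) y * trunc f (real k) y \<partial>\<nu>) \<le> f x" .
    qed
  qed (use \<nu>(1) cpt sub U(2) in auto)
  then have "\<nu> \<in> jensen_cpt x K" by (simp add: jensen_cpt_def)
  then have "msupp \<nu> \<inter> E = {}" by (rule supp)
  then have "emeasure \<nu> E \<le> emeasure \<nu> (- msupp \<nu>)"
    using cl \<nu>(1) by (intro emeasure_mono) auto
  then have "emeasure \<nu> E = 0" using nul by simp
  then have "measure \<nu> E = 0" by (simp add: measure_def)
  \<comment> \<open>As \<open>E\<close> is closed, minus its indicator is lower semicontinuous, and
    the representation inequality reads
    \<open>L (indicator E) \<le> measure \<nu> E\<close>.\<close>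
  moreover have "(\<integral>y. - indicator E y \<partial>\<nu>) \<le> L (\<lambda>y. - indicator E y)"
  proof (rule \<nu>L[where B=1])
    show "(\<lambda>y. - indicator E y :: real) \<in> borel_measurable borel" using E by simp
    fix y :: 'a show "\<bar>- indicator E y :: real\<bar> \<le> 1" by (simp add: indicator_def)
  next
    fix y and a :: real assume y: "y \<in> K" "a < - indicator E y"
    show "\<exists>e>0. \<forall>z\<in>K. dist y z < e \<longrightarrow> a < - indicator E z"
    proof (cases "y \<in> E")
      case True
      then have "a < - 1" using y by simp
      then show ?thesis by (intro exI[of _ 1]) (auto simp: indicator_def)
    next
      case False
      then obtain r where r: "r > 0" "ball y r \<subseteq> - E" using E openE[of "- E" y] by (auto simp: open_Compl)
      have "z \<notin> E" if "dist y z < r" for z using r(2) that by auto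
      then show ?thesis using y False r(1) by (intro exI[of _ r]) auto
    qed
  qed
  moreover have "L (\<lambda>y. - indicator E y) = - p (indicator E)"
    using L(2)[OF bdd_fun_indicator, of "- 1" E] L(4) by simp
  moreover have "(\<integral>y. - indicator E y \<partial>\<nu>) = - measure \<nu> E"
    using E \<nu>(1) sets_eq_imp_space_eq[OF \<nu>(1)] by simp
  ultimately show False using pe e by simp
qed

section \<open>Passing from \<open>K\<close> to the smaller compact set\<close>

lemma jensen_cpt_subset_of_support:
  fixes K C :: "'a::euclidean_space set"
  assumes dim: "DIM('a) \<ge> 2" and K: "compact K" and C: "closed C" "C \<subseteq> K" and x: "x \<in> C"
    and supp: "\<And>\<nu>. \<nu> \<in> jensen_cpt x K \<Longrightarrow> msupp \<nu> \<subseteq> C"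
  shows "jensen_cpt x K \<subseteq> jensen_cpt x C"
proof
  fix M assume M: "M \<in> jensen_cpt x K"
  have MC: "msupp M \<subseteq> C" by (rule supp[OF M])
  have cC: "compact C" using C K by (metis compact_Int_closed inf.absorb2)
  have dU: "domain_set (UNIV :: 'a set)" by (simp add: domain_set_def convex_connected)
  have "M \<in> jensen_dom x UNIV" using M dU by (simp add: jensen_cpt_def)
  note facts = jensen_dom_facts[OF this dU]
  have fin: "emeasure M (space M) < \<infinity>" using facts(4) by simp
  have xK: "x \<in> K" using x C by blast
  have SB [measurable]: "msupp M \<in> sets borel" using facts(2) by (simp add: compact_imp_closed)
  have "M \<in> jensen_dom x U" if U: "domain_set U" "C \<subseteq> U" for U
    unfolding jensen_dom_def
  proof (intro CollectI conjI allI impI)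
    show "radon_cpt_in M U"
      using \<open>M \<in> jensen_dom x UNIV\<close> MC U(2) by (auto simp: jensen_dom_def radon_cpt_in_def)
    fix f assume f: "superharmonic_on U f"
    have oU: "open U" using U(1) by (simp add: domain_set_def)
    obtain d0 where d0: "d0 > 0" "(\<Union>y\<in>C. cball y d0) \<subseteq> U"
      using compact_subset_open_imp_cball_epsilon_subset[OF cC oU U(2)] by metis
    \<comment> \<open>Points within \<open>2 * d\<close> of \<open>C\<close> lie in
      \<open>U\<close>, and \<open>V\<close> and \<open>V'\<close> overlap where the distance to
      \<open>C\<close> is strictly between \<open>d\<close> and \<open>2 * d\<close>; the gluing
      takes place there.\<close>
    define d where "d = d0 / 4"
    have d: "d > 0" using d0(1) by (simp add: d_def)
    have Cne: "C \<noteq> {}" using x by blast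
    have cD: "compact {y. infdist y C \<le> 2 * d}" using d by (intro compact_infdist_le Cne cC) simp
    have DU: "{y. infdist y C \<le> 2 * d} \<subseteq> U"
    proof
      fix y assume "y \<in> {y. infdist y C \<le> 2 * d}"
      moreover obtain z where "z \<in> C" "infdist y C = dist y z"
        using infdist_attains_inf[OF C(1) Cne] by metis
      ultimately have "z \<in> C" "y \<in> cball z d0" using d by (auto simp: d_def dist_commute)
      then show "y \<in> U" using d0(2) by blast
    qed
    obtain c where c: "\<And>y. y \<in> {y. infdist y C \<le> 2 * d} \<Longrightarrow> ereal c < f y"
      by (rule superharmonic_on_bounded_below[OF f cD DU]) blast
    define V where "V = {y. infdist y C < 2 * d}"
    define V' where "V' = {y. d < infdist y C}"
    define V1 where "V1 = {y. infdist y C < d}"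
    define E where "E = {y. d \<le> infdist y C}"
    have cont: "continuous_on UNIV (\<lambda>y. infdist y C)" by (intro continuous_intros)
    have oV: "open V" "open V'" "open V1" and cE: "closed E"
      unfolding V_def V'_def V1_def E_def
      by (intro open_Collect_less closed_Collect_le continuous_on_const cont)+
    have VU: "V \<subseteq> U" using DU by (auto simp: V_def)
    have cV: "ereal c \<le> f y" if "y \<in> V" for y using c[of y] that by (simp add: V_def less_imp_le)
    have CV: "C \<subseteq> V" using d by (auto simp: V_def)
    have tr: "bsuperharmonic V (trunc f k)" for k by (rule bsuperharmonic_trunc[OF f oV(1) VU cV])
    have [measurable]: "(\<lambda>y. indicator V y * trunc f k y) \<in> borel_measurable borel" for k
      by (rule lsc_borel[OF bsuperharmonicD(1,3)[OF tr]])
    have eq: "(\<lambda>y. indicator (msupp M) y * trunc f k y) = (\<lambda>y. indicator (msupp M) y * (indicator V y * trunc f k y))" for k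
      using MC CV by (auto simp: fun_eq_iff indicator_def)
    have tm: "(\<lambda>y. indicator (msupp M) y * trunc f k y) \<in> borel_measurable borel" for k
      unfolding eq by measurable
    show "integral_le M f (f x)"
    proof (rule integral_leI[OF facts(1,4) _ _ tm])
      show "ereal c \<le> f y" if "y \<in> msupp M" for y using cV MC CV that by blast
      show "ereal c \<le> f x" using cV CV x by blast
      fix k :: nat assume ck: "c \<le> real k"
      \<comment> \<open>The height of the truncation after \<open>f\<close> is shifted by its lower
        bound \<open>c\<close>.\<close>
      define L where "L = real k - c"
      have L0: "0 \<le> L" using ck by (simp add: L_def)
      have v: "0 \<le> trunc f k y - c" "trunc f k y - c \<le> L" if "y \<in> V" for y
        using ereal_trunc(2,4)[where f=f, OF cV[OF that], of k] ck by (auto simp: L_def)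
      have sE: "msupp \<nu> \<inter> E = {}" if "\<nu> \<in> jensen_cpt x K" for \<nu>
        using supp[OF that] d by (force simp: E_def)
      have main: "(\<integral>y. indicator (msupp M) y * trunc f k y \<partial>M) \<le> trunc f k x + 2 * L * e" if e: "e > 0" for e
      proof -
        obtain W u where u: "K \<subseteq> W" "bsuperharmonic W u" "\<forall>y\<in>K. indicator E y \<le> u y" "u x < e"
          by (rule small_superharmonic_majorant[OF K xK cE sE e]) blast
        \<comment> \<open>The bounds 0 on \<open>K\<close> and 1 on \<open>K \<inter> E\<close> for
          \<open>u\<close> persist near \<open>K\<close> up to a loss of \<open>e\<close>; points of
          \<open>V1\<close>, near \<open>C\<close>, are exempt from the second.\<close>
        define W' where "W' = {y\<in>W. - e < u y} \<inter> (V1 \<union> {y\<in>W. 1 - e < u y})"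
        have oW': "open W'" unfolding W'_def by (intro open_Int open_Un oV bsuperharmonicD(3)[OF u(2)])
        have W'W: "W' \<subseteq> W" by (auto simp: W'_def)
        have KW': "K \<subseteq> W'"
        proof
          fix y assume y: "y \<in> K"
          have "indicator E y \<le> u y" using u(3) y by blast
          then show "y \<in> W'" using u(1) y e by (cases "y \<in> E") (auto simp: W'_def V1_def E_def)
        qed
        \<comment> \<open>On \<open>W' \<inter> V'\<close> the term \<open>L * (u y + e)\<close> is
          at least \<open>L\<close>, so both branches equal \<open>L\<close> there. On the support
          of \<open>M\<close> the term is nonnegative, so \<open>g\<close> dominates the shifted
          truncation; at \<open>x\<close> it adds at most \<open>2 * L * e\<close>.\<close>
        define g where "g y = (if y \<in> V then min ((trunc f k y - c) + L * (u y + e)) L else L)" for y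
        have gV: "bsuperharmonic (W' \<inter> V) g"
        proof (rule bsuperharmonic_cong)
          have op: "open (W' \<inter> V)" using oW' oV(1) by blast
          have "bsuperharmonic (W' \<inter> V) (\<lambda>y. (trunc f k y + - c) + L * (u y + e))"
            by (intro bsuperharmonic_add bsuperharmonic_scale bsuperharmonic_const op bsuperharmonic_subset[OF tr op] bsuperharmonic_subset[OF u(2) op] L0) (use W'W in auto)
          then show "bsuperharmonic (W' \<inter> V) (\<lambda>y. min ((trunc f k y + - c) + L * (u y + e)) L)"
            by (rule bsuperharmonic_min[OF _ bsuperharmonic_const[OF op]])
        qed (simp add: g_def)
        have gV': "bsuperharmonic (W' \<inter> V') g"
        proof (rule bsuperharmonic_cong[OF bsuperharmonic_const[of _ L]])
          show "open (W' \<inter> V')" using oW' oV(2) by blast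
          fix y assume y: "y \<in> W' \<inter> V'"
          then have "1 \<le> u y + e" by (auto simp: W'_def V1_def V'_def)
          then have "L * 1 \<le> L * (u y + e)" using L0 by (intro mult_left_mono)
          then show "L = g y" using v(1)[of y] by (auto simp: g_def)
        qed
        have "W' \<inter> V \<union> W' \<inter> V' = W'" using d by (auto simp: V_def V'_def)
        then have g: "bsuperharmonic W' g" using bsuperharmonic_Un[OF gV gV'] by simp
        have le: "(\<integral>y. indicator (msupp M) y * g y \<partial>M) \<le> g x"
          by (rule jensen_cpt_bsh[OF dim K xK M _ KW' g]) (use MC C in blast)
        have gx: "g x \<le> trunc f k x - c + 2 * L * e"
        proof -
          have "L * (u x + e) \<le> L * (2 * e)" using u(4) L0 by (intro mult_left_mono) auto
          then show ?thesis using x CV by (auto simp: g_def min_def)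
        qed
        have gge: "trunc f k y - c \<le> g y" if y: "y \<in> msupp M" for y
        proof -
          have yV: "y \<in> V" using y MC CV by blast
          have "y \<in> W'" using y MC C KW' by blast
          then have "0 \<le> L * (u y + e)" using L0 by (auto simp: W'_def)
          then show ?thesis using v[OF yV] yV by (simp add: g_def)
        qed
        have gm: "(\<lambda>y. indicator (msupp M) y * g y) \<in> borel_measurable borel"
        proof -
          have [measurable]: "(\<lambda>y. indicator W' y * g y) \<in> borel_measurable borel"
            by (rule lsc_borel[OF bsuperharmonicD(1,3)[OF g]])
          have "(\<lambda>y. indicator (msupp M) y * g y) = (\<lambda>y. indicator (msupp M) y * (indicator W' y * g y))"
            using MC C KW' by (auto simp: fun_eq_iff indicator_def)
          then show ?thesis by simp
        qed
        have gB: "- 0 \<le> g y" "\<bar>g y\<bar> \<le> L" if y: "y \<in> msupp M" for y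
          using gge[OF y] v(1)[of y] y MC CV L0 by (auto simp: g_def min_def)
        have ig: "integrable M (\<lambda>y. indicator (msupp M) y * g y)"
          by (rule nn_integral_msupp(3)[OF facts(1) fin gm gB])
        have it: "integrable M (\<lambda>y. indicator (msupp M) y * trunc f k y)"
        proof (rule nn_integral_msupp(3)[OF facts(1) fin tm, where c=c and B="\<bar>c\<bar> + L + \<bar>c\<bar>"])
          fix y assume "y \<in> msupp M"
          then have "y \<in> V" using MC CV by blast
          from v[OF this] show "c \<le> trunc f k y" "\<bar>trunc f k y\<bar> \<le> \<bar>c\<bar> + L + \<bar>c\<bar>" by linarith+
        qed
        have ic: "integrable M (\<lambda>y. indicator (msupp M) y * c)"
          by (rule nn_integral_msupp(3)[OF facts(1) fin, where c=c and B="\<bar>c\<bar>"]) simp_all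
        have cint: "(\<integral>y. indicator (msupp M) y * c \<partial>M) = c"
          using facts(1,4) emeasure_msupp[OF facts(1)] SB by (simp add: measure_def)
        have "(\<integral>y. indicator (msupp M) y * trunc f k y \<partial>M) - c
            = (\<integral>y. indicator (msupp M) y * trunc f k y - indicator (msupp M) y * c \<partial>M)"
          unfolding Bochner_Integration.integral_diff[OF it ic] cint ..
        also have "\<dots> \<le> (\<integral>y. indicator (msupp M) y * g y \<partial>M)"
        proof (rule integral_mono[OF Bochner_Integration.integrable_diff[OF it ic] ig])
          show "indicator (msupp M) y * trunc f k y - indicator (msupp M) y * c \<le> indicator (msupp M) y * g y" for y
            using gge[of y] by (cases "y \<in> msupp M") auto
        qed
        finally show ?thesis using le gx by simp
      qed
      have "(\<integral>y. indicator (msupp M) y * trunc f k y \<partial>M) \<le> trunc f k x"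
      proof (rule field_le_epsilon)
        fix e :: real assume e: "e > 0"
        \<comment> \<open>Dividing by \<open>2 * L + 1\<close> rather than \<open>2 * L\<close>
          allows \<open>L = 0\<close>.\<close>
        have "(\<integral>y. indicator (msupp M) y * trunc f k y \<partial>M) \<le> trunc f k x + 2 * L * (e / (2 * L + 1))"
          using e L0 by (intro main) (simp add: divide_pos_pos)
        also have "2 * L * (e / (2 * L + 1)) \<le> e"
          using e L0 by (simp add: divide_le_eq algebra_simps)
        finally show "(\<integral>y. indicator (msupp M) y * trunc f k y \<partial>M) \<le> trunc f k x + e" by simp
      qed
      then have "ereal (\<integral>y. indicator (msupp M) y * trunc f k y \<partial>M) \<le> ereal (trunc f k x)" by simp
      also have "\<dots> \<le> f x" by (rule ereal_trunc(3)[where f=f, OF cV]) (use x CV in blast)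
      finally show "ereal (\<integral>y. indicator (msupp M) y * trunc f (real k) y \<partial>M) \<le> f x" .
    qed
  qed
  then show "M \<in> jensen_cpt x C" by (simp add: jensen_cpt_def)
qed

lemma jensen_cpt_mono: "C \<subseteq> K \<Longrightarrow> jensen_cpt x C \<subseteq> jensen_cpt x K"
  unfolding jensen_cpt_def by blast

theorem theorem4p5:
  fixes K A :: "'a::euclidean_space set"
  assumes "DIM('a) \<ge> 2"
    and "compact K"
    and "A \<subseteq> K"
    and "openin fine_topology A"
    and "openin fine_topology ((fine_topology interior_of K) - A)"
    and "\<forall>x\<in>A. \<forall>\<mu>\<in>jensen_cpt x K. msupp \<mu> \<subseteq> closure A"
  shows "\<forall>x\<in>A. jensen_cpt x K \<subseteq> jensen_cpt x (closure A)
                \<and> jensen_cpt x K = jensen_cpt x (closure A)"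
proof
  fix x assume x: "x \<in> A"
  have AK: "closure A \<subseteq> K" using assms(2,3) by (simp add: closure_minimal compact_imp_closed)
  have "jensen_cpt x K \<subseteq> jensen_cpt x (closure A)"
    using assms(6) x closure_subset[of A]
    by (intro jensen_cpt_subset_of_support[OF assms(1,2) closed_closure AK]) auto
  with jensen_cpt_mono[OF AK, of x]
  show "jensen_cpt x K \<subseteq> jensen_cpt x (closure A) \<and> jensen_cpt x K = jensen_cpt x (closure A)" by blast
qed

end
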